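(* Let $q\le 1$. Uniformizing variables $\beta$ (one variable for each vertex of $G$) determine a spherical orthogonal ring pattern with $R<\frac{\pi}{2}$ if and only if they lie in the interval $\beta\in[0,2K]$ and for all internal vertices satisfy the condition $$\sum_{k=1}^4 \big(g(\beta+\beta_k)-g(\beta-\beta_k)\big)=2\pi,$$ where $\beta$ is the variable at the vertex and the sum is taken over all four neighboring rings, with variables $\beta_k$. For a boundary vertex $v$ the variable $\beta$ satisfies $$\pi V(v)+\sum_k \big(g(\beta-\beta_k)-g(\beta+\beta_k)\big)=\Theta(v)\quad\text{if } r>0,$$ $$\sum_k \big(g(\beta-\beta_k)-g(\beta+\beta_k)\big)=\Theta(v)\quad\text{if } r<0,$$ where the sums are over the neighboring rings of $v$, $\Theta(v)$ is the total nominal angle at the vertex, and $V(v)$ is the valence of $v$, i.e. the number of neighboring rings orthogonal to the ring centered at $v$.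
   Context: Combinatorics: $\Pi\subset\mathbb{Z}^2$ is a simply connected cell complex defined by a subset of elementary squares of the $\mathbb{Z}^2$ lattice, identified with its vertex set. $G=\{(m,n)\in\Pi: m+n\text{ even}\}$, $G^*=\{(m,n)\in\Pi:m+n\text{ odd}\}$. Vertices $v_{m,n}$ and $v_{m\pm1,n\pm1}$ of $G$ are called neighboring. A vertex of $G$ is internal if it has four neighbors in $G$, and a boundary vertex if it has fewer than four. Rings: a spherical ring is a pair of concentric circles on $S^2$ forming an annulus: the inner circle $c$ with signed spherical radius $r$ (positive for counter-clockwise, negative for clockwise orientation) and the outer circle $C$ with spherical radius $R>0$. An orthogonal ring pattern with combinatorics $\Pi$ consists of rings $(C_{m,n},c_{m,n})$ associated to the vertices of $G$ and points $\ell\in S^2$ associated to the vertices of $G^*$ such that: (1) the rings at neighboring vertices $v_i,v_j$ intersect orthogonally: $C_i$ intersects $c_j$ orthogonally and $C_j$ intersects $c_i$ orthogonally; (2) for any four consecutively neighboring orthogonal rings at $v_{m,n},v_{m+1,n-1},v_{m+2,n},v_{m+1,n+1}$ ($m+n$ even) the inner circles $c_{m,n},c_{m+2,n}$ and the outer circles $C_{m+1,n-1},C_{m+1,n+1}$ pass through one point $\ell_{m+1,n}$ (so the two inner circles touch there, and so do the two outer circles); (3) for any ring the four touching points $\ell_{m+1,n}=c_{m,n}\cap c_{m+2,n}$, $\ell_{m,n+1}=C_{m,n}\cap C_{m,n+2}$, $\ell_{m-1,n}=c_{m,n}\cap c_{m-2,n}$, $\ell_{m,n-1}=C_{m,n}\cap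 C_{m,n-2}$ are in counter-clockwise order if $r_{m,n}>0$ and in clockwise order if $r_{m,n}<0$. Uniformization: all rings of a pattern satisfy $q\cos r=\cos R$ with a common constant $q\le1$, and the ring corresponding to $\beta$ is given by $\cos r=\operatorname{sn}(\beta,q)$, $\sin r=\operatorname{cn}(\beta,q)$, $\sin R=\operatorname{dn}(\beta,q)$. Here $\operatorname{sn},\operatorname{cn},\operatorname{dn}$ are the Jacobi elliptic functions of modulus $q$, and $K,K'$ are the complete elliptic integrals of the first kind of modulus $q$ and of the complementary modulus. For $q=1$ (circle patterns, $r=R$) one has $\operatorname{sn}=\tanh$, $\operatorname{cn}=\operatorname{dn}=1/\cosh$, $K'=\pi/2$, $K=\infty$. Function $g$: $g:\mathbb{R}\to\mathbb{R}$ is the smooth function $g(x)=\frac{\pi}{2}-\arg\operatorname{sn}\big(\frac{x+iK'}{2},q\big)$ with the continuous branch normalized by $g(0)=0$. Angles: the opening angle at the ring $(r,R)$ of $v$ towards the neighboring ring $(r_k,R_k)$ is $\theta_k=\varphi_k+\psi_k$, $\varphi_k=\arctan\frac{\tan R_k}{\sin r}$, $\psi_k=\arctan\frac{\tan r_k}{\sin R}$; the cone angle is $\Theta(v)=\sum_k\theta_k$ over all neighboring rings. For an internal vertex of an orthogonal ring pattern $\Theta=2\pi$ if $r>0$ and $\Theta=-2\pi$ if $r<0$.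
   Formalization: Stated for 0<q≤1, β in one period (−2K,2K]; [0,2K] becomes (0,2K), since β=0,2K give R=π/2; β=K (r=0, no ring) is excluded; touching points are required on all squares, also at the boundary, with each consecutive turn in (0,π) or (−π,0) by the sign of r, so that Θ=±2π holds. *)

theory Defs
  imports "HOL-Analysis.Analysis"
begin

text \<open>The parameter \<open>q\<close> is the modulus (not the parameter \<open>m = q\<^sup>2\<close>), \<open>0 < q \<le> 1\<close>.\<close>

text \<open>Incomplete elliptic integral of the first kind (an oriented integral).\<close>

definition ell_F :: "real \<Rightarrow> real \<Rightarrow> real" where
  "ell_F q \<phi> = (LBINT t=0..\<phi>. 1 / sqrt (1 - q\<^sup>2 * (sin t)\<^sup>2))"

text \<open>Complete elliptic integral of the first kind; extended-real valued, so that it is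
  \<open>\<infinity>\<close> for \<open>q = 1\<close>.\<close>

definition ell_K :: "real \<Rightarrow> ereal" where
  "ell_K q = enn2ereal (\<integral>\<^sup>+ t\<in>{0..pi/2}. ennreal (1 / sqrt (1 - q\<^sup>2 * (sin t)\<^sup>2)) \<partial>lborel)"

text \<open>The complementary integral, finite for \<open>0 < q \<le> 1\<close>.\<close>

definition ell_K' :: "real \<Rightarrow> real" where
  "ell_K' q = real_of_ereal (ell_K (sqrt (1 - q\<^sup>2)))"

text \<open>The amplitude inverts \<open>ell_F q\<close>, which is a bijection onto the reals from the whole
  line if \<open>q < 1\<close>, and from the open interval between \<open>-pi/2\<close> and \<open>pi/2\<close> if \<open>q = 1\<close>.\<close>

definition jacobi_am :: "real \<Rightarrow> real \<Rightarrow> real" where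
  "jacobi_am q u = (THE \<phi>. (q < 1 \<or> \<bar>\<phi>\<bar> < pi/2) \<and> ell_F q \<phi> = u)"

definition jacobi_sn :: "real \<Rightarrow> real \<Rightarrow> real" where
  "jacobi_sn q u = sin (jacobi_am q u)"

definition jacobi_cn :: "real \<Rightarrow> real \<Rightarrow> real" where
  "jacobi_cn q u = cos (jacobi_am q u)"

definition jacobi_dn :: "real \<Rightarrow> real \<Rightarrow> real" where
  "jacobi_dn q u = sqrt (1 - q\<^sup>2 * (jacobi_sn q u)\<^sup>2)"

text \<open>The poles of \<open>sn\<close> closest to the real axis have imaginary part \<open>\<plusminus>K'\<close>. On the strip
  \<open>\<bar>Im z\<bar> < K'\<close> the complex \<open>sn\<close> is the analytic continuation of the real one; outside the
  strip, where it is not needed, it is set to 0.\<close>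

definition jacobi_sn_complex :: "real \<Rightarrow> complex \<Rightarrow> complex" where
  "jacobi_sn_complex q =
     (THE f. f holomorphic_on {z. \<bar>Im z\<bar> < ell_K' q} \<and>
             (\<forall>x::real. f (complex_of_real x) = complex_of_real (jacobi_sn q x)) \<and>
             (\<forall>z. \<bar>Im z\<bar> \<ge> ell_K' q \<longrightarrow> f z = 0))"

text \<open>\<open>pi/2 - g\<close> is a continuous branch of the argument along the line \<open>Im z = K'/2\<close>.\<close>

definition ring_g :: "real \<Rightarrow> real \<Rightarrow> real" where
  "ring_g q =
     (THE g. continuous_on UNIV g \<and> g 0 = 0 \<and>
             (\<forall>x. is_Arg (jacobi_sn_complex q ((complex_of_real x + \<i> * complex_of_real (ell_K' q)) / 2))
                         (pi/2 - g x)))"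

text \<open>\<open>(r, R)\<close> is the ring given by the uniformizing variable \<open>\<beta>\<close>.\<close>

definition ring_uniformization :: "real \<Rightarrow> real \<Rightarrow> real \<Rightarrow> real \<Rightarrow> bool" where
  "ring_uniformization q \<beta> r R \<longleftrightarrow>
     - pi < r \<and> r \<le> pi \<and> 0 < R \<and> R < pi \<and>
     cos r = jacobi_sn q \<beta> \<and> sin r = jacobi_cn q \<beta> \<and>
     sin R = jacobi_dn q \<beta> \<and> cos R = q * cos r"

text \<open>A cell complex is given by the set \<open>Q\<close> of its unit squares, each named by its lower left
  corner.\<close>

type_synonym lattice = "int \<times> int"

definition corners :: "lattice \<Rightarrow> lattice set" where
  "corners s = {fst s, fst s + 1} \<times> {snd s, snd s + 1}"

definition cell :: "lattice \<Rightarrow> (real \<times> real) set" where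
  "cell s = {real_of_int (fst s)..real_of_int (fst s) + 1} \<times>
            {real_of_int (snd s)..real_of_int (snd s) + 1}"

definition simply_connected_complex :: "lattice set \<Rightarrow> bool" where
  "simply_connected_complex Q \<longleftrightarrow> simply_connected (\<Union>s\<in>Q. cell s)"

definition verts :: "lattice set \<Rightarrow> lattice set" where
  "verts Q = (\<Union>s\<in>Q. corners s)"

definition G_verts :: "lattice set \<Rightarrow> lattice set" where
  "G_verts Q = {v \<in> verts Q. even (fst v + snd v)}"

definition Gstar_verts :: "lattice set \<Rightarrow> lattice set" where
  "Gstar_verts Q = {v \<in> verts Q. odd (fst v + snd v)}"

text \<open>Vertices \<open>(m, n)\<close> and \<open>(m \<plusminus> 1, n \<plusminus> 1)\<close> are neighbours if they are opposite corners of a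
  square of the complex.\<close>

definition nbrs :: "lattice set \<Rightarrow> lattice \<Rightarrow> lattice set" where
  "nbrs Q v = {w. \<bar>fst w - fst v\<bar> = 1 \<and> \<bar>snd w - snd v\<bar> = 1 \<and>
                  (\<exists>s\<in>Q. v \<in> corners s \<and> w \<in> corners s)}"

definition internal_verts :: "lattice set \<Rightarrow> lattice set" where
  "internal_verts Q = {v \<in> G_verts Q. card (nbrs Q v) = 4}"

definition boundary_verts :: "lattice set \<Rightarrow> lattice set" where
  "boundary_verts Q = {v \<in> G_verts Q. card (nbrs Q v) < 4}"

definition S2 :: "(real^3) set" where
  "S2 = sphere 0 1"

definition sph_dist :: "real^3 \<Rightarrow> real^3 \<Rightarrow> real" where
  "sph_dist x y = arccos (x \<bullet> y)"

text \<open>The sign of the spherical radius \<open>\<rho>\<close> only records the orientation of the circle.\<close>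

definition sph_circle :: "real^3 \<Rightarrow> real \<Rightarrow> (real^3) set" where
  "sph_circle p \<rho> = {x \<in> S2. sph_dist p x = \<bar>\<rho>\<bar>}"

text \<open>At a point \<open>x\<close> of a circle with centre \<open>p\<close> the vector \<open>cross3 p x\<close> is tangent to it.\<close>

definition orthogonal_circles :: "real^3 \<Rightarrow> real \<Rightarrow> real^3 \<Rightarrow> real \<Rightarrow> bool" where
  "orthogonal_circles p \<rho> p' \<rho>' \<longleftrightarrow>
     sph_circle p \<rho> \<inter> sph_circle p' \<rho>' \<noteq> {} \<and>
     (\<forall>x \<in> sph_circle p \<rho> \<inter> sph_circle p' \<rho>'. cross3 p x \<bullet> cross3 p' x = 0)"

text \<open>Equality \<open>\<bar>r\<bar> = R\<close> is admitted because of the case \<open>q = 1\<close> of circle patterns.\<close>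

definition spherical_ring :: "real^3 \<Rightarrow> real \<Rightarrow> real \<Rightarrow> bool" where
  "spherical_ring p r R \<longleftrightarrow> p \<in> S2 \<and> r \<noteq> 0 \<and> \<bar>r\<bar> \<le> R \<and> R < pi"

text \<open>The turn from \<open>x\<close> to \<open>y\<close> around \<open>p\<close>, seen from outside the sphere, is counter-clockwise
  by an angle strictly between 0 and pi.\<close>

definition ccw_turn :: "real^3 \<Rightarrow> real^3 \<Rightarrow> real^3 \<Rightarrow> bool" where
  "ccw_turn p x y \<longleftrightarrow> p \<bullet> cross3 x y > 0"

definition oriented_turn :: "real \<Rightarrow> real^3 \<Rightarrow> real^3 \<Rightarrow> real^3 \<Rightarrow> bool" where
  "oriented_turn r p x y \<longleftrightarrow> (r > 0 \<longrightarrow> ccw_turn p x y) \<and> (r < 0 \<longrightarrow> ccw_turn p y x)"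

text \<open>Here \<open>p v\<close> is the common centre of the ring at \<open>v\<close>, with outer circle
  \<open>sph_circle (p v) (R v)\<close> and inner circle \<open>sph_circle (p v) (r v)\<close>.

  The point at a vertex of \<open>G\<^sup>*\<close> lies on the inner circles of its horizontal and on
  the outer circles of its vertical neighbours in the complex. If all four squares around it
  belong to the complex, these are the two inner and two outer circles of four consecutively
  neighbouring rings; at the boundary there are fewer circles through the point.

  In the last condition, two touching points of a ring which are consecutive in the order east, north, west,
  south belong to a common square exactly if the ring has a neighbour in the corresponding
  diagonal direction. The turn from one to the next is the opening angle towards that neighbour;
  it lies between 0 and pi if \<open>r > 0\<close> and between -pi and 0 if \<open>r < 0\<close>. For a ring with four
  neighbours the turns then add up to \<open>2 * pi\<close> or \<open>- 2 * pi\<close>, so that the four points are in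
  counter-clockwise or clockwise order. For a ring with fewer neighbours the condition is what
  ties the sign of \<open>r\<close> to the geometry.\<close>

definition orthogonal_ring_pattern ::
  "lattice set \<Rightarrow> (lattice \<Rightarrow> real^3) \<Rightarrow> (lattice \<Rightarrow> real) \<Rightarrow> (lattice \<Rightarrow> real) \<Rightarrow>
   (lattice \<Rightarrow> real^3) \<Rightarrow> bool" where
  "orthogonal_ring_pattern Q p r R pt \<longleftrightarrow>
     (\<forall>v \<in> G_verts Q. spherical_ring (p v) (r v) (R v)) \<and>
     (\<forall>u \<in> Gstar_verts Q. pt u \<in> S2) \<and>
     (\<forall>v \<in> G_verts Q. \<forall>w \<in> nbrs Q v.
        orthogonal_circles (p v) (R v) (p w) (r w) \<and>
        orthogonal_circles (p w) (R w) (p v) (r v)) \<and>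
     (\<forall>(m, n) \<in> G_verts Q. \<forall>(m', n') \<in> nbrs Q (m, n).
        pt (m', n) \<in> sph_circle (p (m, n)) (r (m, n)) \<and>
        pt (m, n') \<in> sph_circle (p (m, n)) (R (m, n))) \<and>
     (\<forall>(m, n) \<in> G_verts Q.
        let turn = oriented_turn (r (m, n)) (p (m, n));
            east = pt (m + 1, n); north = pt (m, n + 1);
            west = pt (m - 1, n); south = pt (m, n - 1)
        in ((m + 1, n + 1) \<in> nbrs Q (m, n) \<longrightarrow> turn east north) \<and>
           ((m - 1, n + 1) \<in> nbrs Q (m, n) \<longrightarrow> turn north west) \<and>
           ((m - 1, n - 1) \<in> nbrs Q (m, n) \<longrightarrow> turn west south) \<and>
           ((m + 1, n - 1) \<in> nbrs Q (m, n) \<longrightarrow> turn south east))"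

definition opening_angle :: "real \<Rightarrow> real \<Rightarrow> real \<Rightarrow> real \<Rightarrow> real" where
  "opening_angle r R r' R' = arctan (tan R' / sin r) + arctan (tan r' / sin R)"

definition cone_angle ::
  "lattice set \<Rightarrow> (lattice \<Rightarrow> real) \<Rightarrow> (lattice \<Rightarrow> real) \<Rightarrow> lattice \<Rightarrow> real" where
  "cone_angle Q r R v = (\<Sum>w \<in> nbrs Q v. opening_angle (r v) (R v) (r w) (R w))"

definition determines_ring_pattern ::
  "lattice set \<Rightarrow> (lattice \<Rightarrow> real) \<Rightarrow> (lattice \<Rightarrow> real) \<Rightarrow> bool" where
  "determines_ring_pattern Q r R \<longleftrightarrow> (\<exists>p pt. orthogonal_ring_pattern Q p r R pt)"

end

theory Submission
  imports Defs "HOL-Complex_Analysis.Complex_Analysis"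
begin

text \<open>
  The condition on the variables is the statement that the angles of the spherical quadrilaterals
  of the pattern close up at every vertex, and a simply connected complex has no further
  obstruction.

  A square of the complex with ring centres \<open>v\<close>, \<open>w\<close> and touching points \<open>a\<close>, \<open>b\<close> becomes a
  quadrilateral with right angles at \<open>a\<close> and \<open>b\<close>, made of two right-angled triangles over the
  segment \<open>vw\<close>. Its angle at \<open>v\<close> is the opening angle. If the side from \<open>v\<close> to the touching point
  of the inner circles is measured by the signed radius \<open>r\<close>, also when \<open>r < 0\<close>, this angle is
  given by one formula, \<open>turn_angle\<close>, with values between \<open>0\<close> and \<open>pi\<close>; it exceeds the
  opening angle by \<open>pi\<close> if \<open>r < 0\<close>, and equals it if \<open>r > 0\<close>. So in both cases the
  opening angles at an internal vertex have the required sum exactly if the four values of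
  \<open>turn_angle\<close> add up to \<open>2 * pi\<close>.

  \<^emph>\<open>Analysis.\<close> In uniformizing variables \<open>turn_angle\<close> equals
  \<open>pi - (g(\<beta> + \<beta>') - g(\<beta> - \<beta>'))\<close> (\<open>ring_g_diff\<close>). This comes from the closed form
  \<open>g(x) = (am x + arcsin (q sn x)) / 2\<close> (\<open>ring_g_eq\<close>), whose derivative is
  \<open>(dn x + q cn x) / 2\<close>: by the addition theorems both sides have the same derivative in \<open>\<beta>\<close>, and
  at \<open>\<beta> = 0\<close> the identity is elementary. It gives the formulas at boundary vertices and turns the
  condition at internal vertices into the condition on \<open>turn_angle\<close>.

  \<^emph>\<open>From a pattern to the condition.\<close> The orientation of the touching points decides on which side
  of \<open>vw\<close> each of them lies, so the turn from one to the next is \<open>turn_angle\<close>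
  (\<open>turn_between_touching_points\<close>). The four turns around an internal centre compose to the
  identity, and their sum lies strictly between \<open>0\<close> and \<open>4 * pi\<close>; hence it is \<open>2 * pi\<close>.

  \<^emph>\<open>From the condition to a pattern.\<close> To each square a frame is to be assigned, an element of
  \<open>SO(3)\<close>, which places the quadrilateral of the square on the sphere. Neighbouring squares
  prescribe the ratio of their frames. The closing of a quadrilateral (\<open>ring_square_rotation\<close>)
  and the angle sum at a vertex make the product of these ratios around every interior vertex
  trivial. Within each row the ratios are integrated directly; what remains is a labelling of the
  contacts between the maximal horizontal strips of consecutive rows. Since the complex is simply
  connected, the strips and their contacts form a forest: for every contact a circle-valued
  function that winds once when the contact is crossed has a logarithm, which gives an
  integer colouring of the strips that changes at this contact only (\<open>row_crossing_colouring\<close>).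
  On a forest every labelling by group elements has a potential (\<open>forest_potential\<close>).
\<close>

section \<open>Potentials on labelled forests\<close>

text \<open>An edge may be traversed against its direction and then contributes its inverse label. The length is
  recorded because closed walks are treated by induction on it.\<close>

inductive edge_walk :: "('n \<Rightarrow> 'n \<Rightarrow> bool) \<Rightarrow> ('n \<Rightarrow> 'n \<Rightarrow> 'g::group_add) \<Rightarrow> nat \<Rightarrow> 'n \<Rightarrow> 'g \<Rightarrow> 'n \<Rightarrow> bool"
  for E lab where
  edge_walk_nil: "edge_walk E lab 0 a 0 a"
| edge_walk_fwd: "E a b \<Longrightarrow> edge_walk E lab n b h c \<Longrightarrow> edge_walk E lab (Suc n) a (lab a b + h) c"
| edge_walk_bwd: "E b a \<Longrightarrow> edge_walk E lab n b h c \<Longrightarrow> edge_walk E lab (Suc n) a (- lab b a + h) c"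

lemma edge_walk_append:
  assumes "edge_walk E lab n a g b" and "edge_walk E lab m b h c"
  shows "edge_walk E lab (n + m) a (g + h) c"
  using assms by (induction rule: edge_walk.induct) (auto simp: add.assoc intro: edge_walk.intros)

lemma edge_walk_single_fwd: "E a b \<Longrightarrow> edge_walk E lab 1 a (lab a b) b"
  using edge_walk_fwd[OF _ edge_walk_nil, of E a b lab] by simp

lemma edge_walk_single_bwd: "E b a \<Longrightarrow> edge_walk E lab 1 a (- lab b a) b"
  using edge_walk_bwd[OF _ edge_walk_nil, of E b a lab] by simp

lemma edge_walk_reverse:
  assumes "edge_walk E lab n a g b"
  shows "edge_walk E lab n b (- g) a"
  using assms
proof (induction rule: edge_walk.induct)
  case (edge_walk_nil a)
  show ?case using edge_walk.edge_walk_nil by force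
next
  case (edge_walk_fwd a b n h c)
  show ?case
    using edge_walk_append[OF edge_walk_fwd.IH edge_walk_single_bwd[of E a b lab]] edge_walk_fwd.hyps
    by (simp add: minus_add)
next
  case (edge_walk_bwd b a n h c)
  show ?case
    using edge_walk_append[OF edge_walk_bwd.IH edge_walk_single_fwd[of E b a lab]] edge_walk_bwd.hyps
    by (simp add: minus_add)
qed

text \<open>The colour cannot change before the walk passes over the edge \<open>(a, b)\<close> for the first time; the
  walk is split there.\<close>

lemma edge_walk_first_crossing:
  fixes c :: "'n \<Rightarrow> int"
  assumes walk: "edge_walk E lab n x h y" and diff: "c x \<noteq> c y"
    and col: "\<And>x y. E x y \<Longrightarrow> (x, y) \<noteq> (a, b) \<Longrightarrow> c x = c y"
  shows "\<exists>k m g l h'. k + m < n \<and> h = g + l + h' \<and>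
     (edge_walk E lab k x g a \<and> c x = c a \<and> l = lab a b \<and> edge_walk E lab m b h' y \<or>
      edge_walk E lab k x g b \<and> c x = c b \<and> l = - lab a b \<and> edge_walk E lab m a h' y)"
  using walk diff
proof (induction rule: edge_walk.induct)
  case (edge_walk_nil x)
  then show ?case by simp
next
  case (edge_walk_fwd x z n h y)
  show ?case
  proof (cases "(x, z) = (a, b)")
    case True
    then show ?thesis
      using edge_walk_fwd.hyps edge_walk_nil[of E lab a]
      by (intro exI[of _ 0] exI[of _ n] exI[of _ 0] exI[of _ "lab a b"] exI[of _ h]) auto
  next
    case False
    then have cc: "c x = c z" using col edge_walk_fwd.hyps by blast
    then obtain k m g l h' where *: "k + m < n" "h = g + l + h'"
     "edge_walk E lab k z g a \<and> c z = c a \<and> l = lab a b \<and> edge_walk E lab m b h' y \<or>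
      edge_walk E lab k z g b \<and> c z = c b \<and> l = - lab a b \<and> edge_walk E lab m a h' y"
      using edge_walk_fwd by metis
    have "edge_walk E lab (Suc k) x (lab x z + g) w" if "edge_walk E lab k z g w" for w
      using edge_walk.edge_walk_fwd[of E x z lab, OF edge_walk_fwd.hyps(1) that] .
    then have "edge_walk E lab (Suc k) x (lab x z + g) a \<and> c x = c a \<and> l = lab a b \<and> edge_walk E lab m b h' y \<or>
      edge_walk E lab (Suc k) x (lab x z + g) b \<and> c x = c b \<and> l = - lab a b \<and> edge_walk E lab m a h' y"
      using *(3) unfolding cc by blast
    moreover have "Suc k + m < Suc n" using *(1) by simp
    moreover have "lab x z + h = lab x z + g + l + h'" using *(2) by (simp add: add.assoc)
    ultimately show ?thesis by blast
  qed
next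
  case (edge_walk_bwd z x n h y)
  show ?case
  proof (cases "(z, x) = (a, b)")
    case True
    then show ?thesis
      using edge_walk_bwd.hyps edge_walk_nil[of E lab b]
      by (intro exI[of _ 0] exI[of _ n] exI[of _ 0] exI[of _ "- lab a b"] exI[of _ h]) auto
  next
    case False
    then have cc: "c x = c z" using col[of z x] edge_walk_bwd.hyps by force
    then obtain k m g l h' where *: "k + m < n" "h = g + l + h'"
     "edge_walk E lab k z g a \<and> c z = c a \<and> l = lab a b \<and> edge_walk E lab m b h' y \<or>
      edge_walk E lab k z g b \<and> c z = c b \<and> l = - lab a b \<and> edge_walk E lab m a h' y"
      using edge_walk_bwd by metis
    have "edge_walk E lab (Suc k) x (- lab z x + g) w" if "edge_walk E lab k z g w" for w
      using edge_walk.edge_walk_bwd[of E z x lab, OF edge_walk_bwd.hyps(1) that] .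
    then have "edge_walk E lab (Suc k) x (- lab z x + g) a \<and> c x = c a \<and> l = lab a b \<and> edge_walk E lab m b h' y \<or>
      edge_walk E lab (Suc k) x (- lab z x + g) b \<and> c x = c b \<and> l = - lab a b \<and> edge_walk E lab m a h' y"
      using *(3) unfolding cc by blast
    moreover have "Suc k + m < Suc n" using *(1) by simp
    moreover have "- lab z x + h = - lab z x + g + l + h'" using *(2) by (simp add: add.assoc)
    ultimately show ?thesis by blast
  qed
qed

text \<open>A closed walk whose first step crosses an edge ends with the colour of its starting point, so it
  has to cross that edge again, and for the first time in the reverse direction, because until then it
  has stayed on the far side. Between the two crossings and after the second one it is a shorter closed
  walk. The labels cancel from the inside outwards, as a noncommutative group requires.\<close>

lemma closed_edge_walk_trivial:
  fixes E :: "'n \<Rightarrow> 'n \<Rightarrow> bool" and lab :: "'n \<Rightarrow> 'n \<Rightarrow> 'g::group_add"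
  assumes bridge: "\<And>a b. E a b \<Longrightarrow> \<exists>c::'n \<Rightarrow> int. c a \<noteq> c b \<and> (\<forall>x y. E x y \<longrightarrow> (x, y) \<noteq> (a, b) \<longrightarrow> c x = c y)"
    and "edge_walk E lab n x h x"
  shows "h = 0"
  using assms(2)
proof (induction n arbitrary: x h rule: less_induct)
  case (less n)
  from less.prems show ?case
  proof cases
    case edge_walk_nil
    then show ?thesis by simp
  next
    case (edge_walk_fwd z n' h1)
    obtain c :: "'n \<Rightarrow> int" where c: "c x \<noteq> c z" "\<And>u v. E u v \<Longrightarrow> (u, v) \<noteq> (x, z) \<Longrightarrow> c u = c v"
      using bridge[OF edge_walk_fwd(3)] by blast
    obtain k m g l h' where *: "k + m < n'" "h1 = g + l + h'"
     "edge_walk E lab k z g x \<and> c z = c x \<and> l = lab x z \<and> edge_walk E lab m z h' x \<or>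
      edge_walk E lab k z g z \<and> c z = c z \<and> l = - lab x z \<and> edge_walk E lab m x h' x"
      using edge_walk_first_crossing[OF edge_walk_fwd(4), of c x z] c by metis
    then have w: "edge_walk E lab k z g z" "l = - lab x z" "edge_walk E lab m x h' x" using c by auto
    then show ?thesis using * edge_walk_fwd less.IH[of k z g] less.IH[of m x h'] by simp
  next
    case (edge_walk_bwd z n' h1)
    obtain c :: "'n \<Rightarrow> int" where c: "c z \<noteq> c x" "\<And>u v. E u v \<Longrightarrow> (u, v) \<noteq> (z, x) \<Longrightarrow> c u = c v"
      using bridge[OF edge_walk_bwd(3)] by blast
    obtain k m g l h' where *: "k + m < n'" "h1 = g + l + h'"
     "edge_walk E lab k z g z \<and> c z = c z \<and> l = lab z x \<and> edge_walk E lab m x h' x \<or>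
      edge_walk E lab k z g x \<and> c z = c x \<and> l = - lab z x \<and> edge_walk E lab m z h' x"
      using edge_walk_first_crossing[OF edge_walk_bwd(4), of c z x] c by metis
    then have w: "edge_walk E lab k z g z" "l = lab z x" "edge_walk E lab m x h' x" using c by auto
    then show ?thesis using * edge_walk_bwd less.IH[of k z g] less.IH[of m x h'] by simp
  qed
qed

text \<open>The hypothesis says that the graph is a forest: every edge separates. The potential of a node is the
  label of a walk from a base node of its component, which does not depend on the walk.\<close>

lemma forest_potential:
  fixes E :: "'n \<Rightarrow> 'n \<Rightarrow> bool" and lab :: "'n \<Rightarrow> 'n \<Rightarrow> 'g::group_add"
  assumes bridge: "\<And>a b. E a b \<Longrightarrow> \<exists>c::'n \<Rightarrow> int. c a \<noteq> c b \<and> (\<forall>x y. E x y \<longrightarrow> (x, y) \<noteq> (a, b) \<longrightarrow> c x = c y)"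
  shows "\<exists>H. \<forall>a b. E a b \<longrightarrow> H b = H a + lab a b"
proof -
  define conn where "conn a b \<longleftrightarrow> (\<exists>n h. edge_walk E lab n a h b)" for a b
  have conn_refl: "conn a a" for a unfolding conn_def by (intro exI, rule edge_walk_nil)
  have conn_sym: "conn a b \<Longrightarrow> conn b a" for a b unfolding conn_def by (metis edge_walk_reverse)
  have conn_trans: "conn a b \<Longrightarrow> conn b c \<Longrightarrow> conn a c" for a b c
    unfolding conn_def by (metis edge_walk_append)
  define base where "base a = (SOME b. conn b a)" for a
  have base: "conn (base a) a" for a unfolding base_def by (rule someI, rule conn_refl)
  have base_eq: "base a = base b" if "conn a b" for a b
  proof -
    have "conn x a \<longleftrightarrow> conn x b" for x using that conn_trans conn_sym by blast
    then show ?thesis by (simp add: base_def)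
  qed
  define H where "H a = (SOME h. \<exists>n. edge_walk E lab n (base a) h a)" for a
  have H: "\<exists>n. edge_walk E lab n (base a) (H a) a" for a
    unfolding H_def by (rule someI_ex) (use base[of a] in \<open>auto simp: conn_def\<close>)
  have "H b = H a + lab a b" if e: "E a b" for a b
  proof -
    have cab: "conn a b" unfolding conn_def by (intro exI, rule edge_walk_single_fwd[of E a b lab, OF e])
    obtain n m where n: "edge_walk E lab n (base a) (H a) a" and m: "edge_walk E lab m (base a) (H b) b"
      using H[of a] H[of b] base_eq[OF cab] by auto
    have w: "edge_walk E lab (n + (1 + m)) (base a) (H a + (lab a b + - H b)) (base a)"
      by (intro edge_walk_append[OF n] edge_walk_append[OF edge_walk_single_fwd[of E a b lab]] edge_walk_reverse[OF m] e)
    have "H a + (lab a b + - H b) = 0" by (rule closed_edge_walk_trivial[OF bridge w])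
    then have "(H a + lab a b) + - H b = 0" by (simp only: add.assoc)
    then show ?thesis by (metis add_uminus_conv_diff eq_iff_diff_eq_0)
  qed
  then show ?thesis by blast
qed

section \<open>Row strips of a simply connected cell complex\<close>

text \<open>The linked squares of a square form the maximal horizontal strip of \<open>Q\<close> through it.\<close>

definition row_linked :: "lattice set \<Rightarrow> lattice \<Rightarrow> lattice \<Rightarrow> bool" where
  "row_linked Q s t \<longleftrightarrow> snd s = snd t \<and>
     (\<forall>m. min (fst s) (fst t) \<le> m \<and> m \<le> max (fst s) (fst t) \<longrightarrow> (m, snd s) \<in> Q)"

definition row_piece :: "lattice set \<Rightarrow> lattice \<Rightarrow> lattice set" where
  "row_piece Q s = {t. row_linked Q s t}"

lemma row_linked_iff: "row_linked Q (i, j) (k, l) \<longleftrightarrow>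
    l = j \<and> (\<forall>m. (i \<le> m \<and> m \<le> k \<or> k \<le> m \<and> m \<le> i) \<longrightarrow> (m, j) \<in> Q)"
  by (fastforce simp: row_linked_def min_def max_def)

lemma row_linked_refl: "s \<in> Q \<Longrightarrow> row_linked Q s s"
  by (cases s) (auto simp: row_linked_iff)

lemma row_linked_sym: "row_linked Q s t \<Longrightarrow> row_linked Q t s"
  by (cases s; cases t) (auto simp: row_linked_iff)

lemma row_linked_trans: "row_linked Q s t \<Longrightarrow> row_linked Q t u \<Longrightarrow> row_linked Q s u"
proof (cases s; cases t; cases u)
  fix i j k l m n assume *: "s = (i, j)" "t = (k, l)" "u = (m, n)" and a: "row_linked Q s t" "row_linked Q t u"
  have e: "l = j" "n = j" using a * by (auto simp: row_linked_iff)
  have 1: "(x, j) \<in> Q" if "i \<le> x \<and> x \<le> k \<or> k \<le> x \<and> x \<le> i" for x using a(1) that * by (auto simp: row_linked_iff)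
  have 2: "(x, j) \<in> Q" if "k \<le> x \<and> x \<le> m \<or> m \<le> x \<and> x \<le> k" for x using a(2) that * e by (auto simp: row_linked_iff)
  have "(x, j) \<in> Q" if "i \<le> x \<and> x \<le> m \<or> m \<le> x \<and> x \<le> i" for x
    using 1[of x] 2[of x] that by linarith
  then show "row_linked Q s u" using * e by (auto simp: row_linked_iff)
qed

lemma row_piece_eq_iff: "s \<in> Q \<Longrightarrow> t \<in> Q \<Longrightarrow> row_piece Q s = row_piece Q t \<longleftrightarrow> row_linked Q s t"
proof
  assume "t \<in> Q" "row_piece Q s = row_piece Q t"
  then show "row_linked Q s t" using row_linked_refl[of t Q] by (auto simp: row_piece_def)
next
  assume "row_linked Q s t"
  then show "row_piece Q s = row_piece Q t"
    unfolding row_piece_def using row_linked_trans row_linked_sym by blast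
qed

lemma row_linked_in: "row_linked Q s t \<Longrightarrow> s \<in> Q \<and> t \<in> Q"
  by (cases s; cases t) (auto simp: row_linked_iff)

text \<open>The lattice cells form a locally finite family.\<close>

lemma closed_Union_cells: "closed (\<Union>s\<in>A. cell s)"
proof -
  have "locally_finite_in euclidean (cell ` A)"
    unfolding locally_finite_in_def
  proof (intro conjI ballI)
    fix x :: "real \<times> real" assume "x \<in> topspace euclidean"
    define B where "B = {\<lfloor>fst x\<rfloor> - 3..\<lfloor>fst x\<rfloor> + 3} \<times> {\<lfloor>snd x\<rfloor> - 3..\<lfloor>snd x\<rfloor> + 3}"
    have "s \<in> B" if "y \<in> cell s" "y \<in> ball x 1" for s y
    proof -
      have "dist (fst x) (fst y) < 1" "dist (snd x) (snd y) < 1"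
        using that(2) dist_fst_le[of x y] dist_snd_le[of x y] by (auto simp: mem_ball)
      moreover have "of_int (fst s) \<le> fst y" "fst y \<le> of_int (fst s) + 1" "of_int (snd s) \<le> snd y" "snd y \<le> of_int (snd s) + 1"
        using that(1) by (auto simp: cell_def)
      ultimately have "\<lfloor>fst x\<rfloor> - 3 \<le> fst s" "fst s \<le> \<lfloor>fst x\<rfloor> + 3" "\<lfloor>snd x\<rfloor> - 3 \<le> snd s" "snd s \<le> \<lfloor>snd x\<rfloor> + 3"
        unfolding dist_real_def by linarith+
      then show ?thesis by (simp add: B_def mem_Times_iff)
    qed
    then have "{U \<in> cell ` A. U \<inter> ball x 1 \<noteq> {}} \<subseteq> cell ` B" by blast
    moreover have "finite (cell ` B)" by (simp add: B_def)
    ultimately have "finite {U \<in> cell ` A. U \<inter> ball x 1 \<noteq> {}}" by (rule finite_subset)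
    then show "\<exists>V. openin euclidean V \<and> x \<in> V \<and> finite {U \<in> cell ` A. U \<inter> V \<noteq> {}}"
      by (intro exI[of _ "ball x 1"]) auto
  qed auto
  moreover have "closedin euclidean S" if "S \<in> cell ` A" for S
    using that by (auto simp: cell_def intro!: closed_Times)
  ultimately have "closedin euclidean (\<Union>(cell ` A))" by (intro closedin_locally_finite_Union) auto
  then show ?thesis by simp
qed

lemma convex_cell: "convex (cell s)"
  by (auto simp: cell_def intro!: convex_Times)

text \<open>A small ball around \<open>x\<close> meets only cells that contain \<open>x\<close>, and these are convex; within the
  complex it is therefore star-shaped about \<open>x\<close>.\<close>

lemma locally_path_connected_complex: "locally path_connected (\<Union>s\<in>Q. cell s)"
proof (subst locally_path_connected_im_kleinen, intro allI impI)
  let ?X = "\<Union>s\<in>Q. cell s"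
  fix V x assume V: "openin (top_of_set ?X) V \<and> x \<in> V"
  then obtain T where T: "open T" "V = ?X \<inter> T" by (auto simp: openin_open)
  have "closed (\<Union>s\<in>{s\<in>Q. x \<notin> cell s}. cell s)" by (rule closed_Union_cells)
  then have "open (T - (\<Union>s\<in>{s\<in>Q. x \<notin> cell s}. cell s))" using T by blast
  moreover have "x \<in> T - (\<Union>s\<in>{s\<in>Q. x \<notin> cell s}. cell s)" using V T by auto
  ultimately obtain e where e: "e > 0" "ball x e \<subseteq> T - (\<Union>s\<in>{s\<in>Q. x \<notin> cell s}. cell s)"
    by (meson open_contains_ball)
  let ?U = "?X \<inter> ball x e"
  have "\<exists>p. path p \<and> path_image p \<subseteq> V \<and> pathstart p = x \<and> pathfinish p = y" if y: "y \<in> ?U" for y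
  proof -
    obtain s where s: "s \<in> Q" "y \<in> cell s" using y by blast
    then have "x \<in> cell s" using e y by blast
    then have "closed_segment x y \<subseteq> cell s \<inter> ball x e"
      using s y e(1) closed_segment_subset[OF _ _ convex_cell, of x s y]
        closed_segment_subset[OF _ _ convex_ball, of x x e y] by auto
    then have "closed_segment x y \<subseteq> V" using s(1) e T by blast
    then show ?thesis by (intro exI[of _ "linepath x y"]) auto
  qed
  then show "\<exists>U. openin (top_of_set ?X) U \<and> x \<in> U \<and> U \<subseteq> V \<and>
      (\<forall>y. y \<in> U \<longrightarrow> (\<exists>p. path p \<and> path_image p \<subseteq> V \<and> pathstart p = x \<and> pathfinish p = y))"
    using V T e by (intro exI[of _ ?U] conjI openin_open_Int) auto
qed

text \<open>Such a \<open>g\<close> has values in the discrete set of multiples of \<open>2 * pi * \<i>\<close>.\<close>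

lemma exp_integer_on_connected:
  fixes g :: "'a::topological_space \<Rightarrow> complex"
  assumes "connected S" "continuous_on S g" "\<And>z. z \<in> S \<Longrightarrow> exp (g z) = 1" "x \<in> S" "y \<in> S"
  shows "g x = g y"
proof -
  have "g constant_on S"
  proof (rule continuous_discrete_range_constant[OF assms(1,2)])
    fix x assume x: "x \<in> S"
    show "\<exists>e>0. \<forall>y. y \<in> S \<and> g y \<noteq> g x \<longrightarrow> e \<le> norm (g y - g x)"
    proof (intro exI[of _ "2 * pi"] conjI allI impI)
      fix y assume y: "y \<in> S \<and> g y \<noteq> g x"
      then have "exp (g y) = exp (g x)" using assms(3) x by simp
      then obtain n :: int where n: "g y = g x + (of_int (2 * n) * pi) * \<i>" by (auto simp: exp_eq)
      then have "n \<noteq> 0" using y by auto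
      then have "1 \<le> \<bar>real_of_int n\<bar>" by linarith
      moreover have "norm (g y - g x) = 2 * pi * \<bar>real_of_int n\<bar>" using n by (simp add: norm_mult abs_mult)
      ultimately show "2 * pi \<le> norm (g y - g x)" by simp
    qed simp
  qed
  then show ?thesis using assms(4,5) by (auto simp: constant_on_def)
qed

text \<open>Let \<open>J\<close> be the strip of \<open>b\<close> and \<open>I\<close> the strip of \<open>a\<close> below it. On \<open>J\<close> let \<open>u\<close> be the distance to
  the contact of \<open>I\<close> and \<open>J\<close>, cut off at 1. Every other strip that touches \<open>J\<close> does so at distance at
  least 1, so \<open>cis (2 * pi * u)\<close> on \<open>J\<close> and the constant 1 elsewhere fit together to a continuous map
  into the circle. It has a logarithm \<open>g\<close> on the simply connected complex. Outside \<open>J\<close> the number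
  \<open>g / (2 * pi * \<i>)\<close> is an integer constant on each cell; on \<open>J\<close> the same holds after subtraction of
  \<open>u - 1\<close>. These integers agree at all contacts with \<open>u = 1\<close> and differ by 1 where \<open>u = 0\<close>.\<close>

lemma row_crossing_colouring:
  assumes sc: "simply_connected_complex Q" and ab: "a \<in> Q" "b \<in> Q" "snd b = snd a + 1"
    and touch: "cell a \<inter> cell b \<noteq> {}"
  shows "\<exists>c :: lattice \<Rightarrow> int. c b = c a + 1 \<and>
    (\<forall>s t. s \<in> Q \<and> t \<in> Q \<and> cell s \<inter> cell t \<noteq> {} \<longrightarrow> 
       \<not> (row_linked Q s a \<and> row_linked Q t b) \<longrightarrow> \<not> (row_linked Q t a \<and> row_linked Q s b) \<longrightarrow> c s = c t)"
proof -
  define I J where "I = row_piece Q a" and "J = row_piece Q b"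
  have sub: "row_piece Q s \<subseteq> Q" for s using row_linked_in by (fastforce simp: row_piece_def)
  have IQ: "I \<subseteq> Q" "J \<subseteq> Q" "a \<in> I" "b \<in> J"
    using sub row_linked_refl[OF ab(1)] row_linked_refl[OF ab(2)] by (simp_all add: I_def J_def) (simp_all add: row_piece_def)
  have memI: "x \<in> I \<longleftrightarrow> row_linked Q x a" and memJ: "x \<in> J \<longleftrightarrow> row_linked Q x b" for x
    unfolding I_def J_def row_piece_def mem_Collect_eq by (rule iffI; erule row_linked_sym)+
  define X where "X = (\<Union>s\<in>Q. cell s)"
  define RI RJ where "RI = (\<Union>s\<in>I. cell s)" and "RJ = (\<Union>s\<in>J. cell s)"
  define O' where "O' = RI \<inter> RJ"
  have O_ne: "O' \<noteq> {}" using touch IQ by (auto simp: O'_def RI_def RJ_def)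
  define u where "u z = min 1 (infdist z O')" for z
  have contu: "continuous_on A u" for A unfolding u_def by (intro continuous_intros)
  \<comment> \<open>The contacts of \<open>J\<close> with strips other than \<open>I\<close> have distance at least 1 from \<open>O'\<close>: a strip in the row
    of \<open>I\<close> is separated from \<open>I\<close> by at least one missing square, and a strip above \<open>J\<close> by the height of the row.\<close>
  have far: "u z = 1" if s: "s \<in> Q" "s \<notin> I" "s \<notin> J" and z: "z \<in> cell s" "z \<in> RJ" for s z
  proof -
    obtain t where t: "t \<in> J" "z \<in> cell t" using z by (auto simp: RJ_def)
    have "1 \<le> dist z y" if y: "y \<in> O'" for y
    proof -
      obtain v w where vw: "v \<in> I" "y \<in> cell v" "w \<in> J" "y \<in> cell w" using y by (auto simp: O'_def RI_def RJ_def)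
      have rows: "snd v = snd a" "snd w = snd a + 1" "snd t = snd a + 1"
        using vw t ab(3) by (auto simp: I_def J_def row_piece_def row_linked_def)
      have yc: "snd y = snd a + 1" using vw(2,4) rows by (auto simp: cell_def)
      show ?thesis
      proof (cases "snd s = snd a")
        case True
        obtain i where sv: "s = (i, snd a)" using True by (cases s) auto
        obtain k where vv: "v = (k, snd a)" using rows by (cases v) auto
        have "\<not> row_linked Q v s" using vw(1) s(2) row_linked_trans unfolding I_def row_piece_def by blast
        then obtain m where m: "(k \<le> m \<and> m \<le> i \<or> i \<le> m \<and> m \<le> k)" "(m, snd a) \<notin> Q"
          by (auto simp: sv vv row_linked_iff)
        have "(i, snd a) \<in> Q" "(k, snd a) \<in> Q" using s(1) vw(1) IQ sv vv by auto
        then have "m \<noteq> i" "m \<noteq> k" using m(2) by auto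
        then have "k + 1 < i \<or> i + 1 < k" using m(1) by presburger
        then have "1 \<le> \<bar>fst z - fst y\<bar>" using z(1) vw(2) unfolding sv vv cell_def by auto
        then show ?thesis using dist_fst_le[of z y] by (simp add: dist_real_def)
      next
        case False
        show ?thesis
        proof (cases "snd s = snd a + 1")
          case True
          obtain i where sv: "s = (i, snd a + 1)" using True by (cases s) auto
          obtain k where tv: "t = (k, snd a + 1)" using rows by (cases t) auto
          have "\<not> row_linked Q t s" using t(1) s(3) row_linked_trans unfolding J_def row_piece_def by blast
          then obtain m where m: "(k \<le> m \<and> m \<le> i \<or> i \<le> m \<and> m \<le> k)" "(m, snd a + 1) \<notin> Q"
            by (auto simp: sv tv row_linked_iff)
          have "(i, snd a + 1) \<in> Q" "(k, snd a + 1) \<in> Q" using s(1) t(1) IQ sv tv by auto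
          then have "m \<noteq> i" "m \<noteq> k" using m(2) by auto
          then have "k + 1 < i \<or> i + 1 < k" using m(1) by presburger
          then have False using z(1) t(2) unfolding sv tv cell_def by auto
          then show ?thesis ..
        next
          case neq: False
          have "snd z = snd a + 2"
            using z(1) t(2) rows False neq unfolding cell_def by auto
          then have "1 \<le> \<bar>snd z - snd y\<bar>" using yc by simp
          then show ?thesis using dist_snd_le[of z y] by (simp add: dist_real_def)
        qed
      qed
    qed
    then have "1 \<le> infdist z O'" using O_ne by (simp add: infdist_def cINF_greatest)
    then show ?thesis by (simp add: u_def)
  qed
  have near: "u z = 0" if "z \<in> RI" "z \<in> RJ" for z
    using that by (simp add: u_def O'_def)
  define RK where "RK = (\<Union>s\<in>Q - J. cell s)"
  have X_eq: "X = RJ \<union> RK" using IQ by (auto simp: X_def RJ_def RK_def)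
  define f where "f z = (if z \<in> RJ then cis (2 * pi * u z) else 1)" for z
  have f1: "f z = 1" if "z \<in> RK" for z
  proof (cases "z \<in> RJ")
    case True
    obtain s where s: "s \<in> Q" "s \<notin> J" "z \<in> cell s" using \<open>z \<in> RK\<close> by (auto simp: RK_def)
    have "u z = 0 \<or> u z = 1"
      using far[OF s(1) _ s(2,3) True] near[OF _ True] s(3) by (cases "s \<in> I") (auto simp: RI_def)
    then show ?thesis by (auto simp: f_def)
  qed (simp add: f_def)
  have contf: "continuous_on X f"
    unfolding X_eq
  proof (rule continuous_on_closed_Un)
    show "closed RJ" "closed RK" by (auto simp: RJ_def RK_def closed_Union_cells)
    have "continuous_on RJ (\<lambda>z. cis (2 * pi * u z))" by (intro continuous_intros contu)
    then show "continuous_on RJ f" by (rule continuous_on_eq) (simp add: f_def)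
    show "continuous_on RK f" by (rule continuous_on_eq[of _ "\<lambda>_. 1"]) (auto simp: f1)
  qed
  obtain g where g: "continuous_on X g" "\<And>z. z \<in> X \<Longrightarrow> f z = exp (g z)"
  proof (rule continuous_logarithm_on_simply_connected[OF contf])
    show "simply_connected X" using sc by (simp add: simply_connected_complex_def X_def)
    show "locally path_connected X" unfolding X_def by (rule locally_path_connected_complex)
    show "f z \<noteq> 0" for z by (simp add: f_def)
  qed auto
  define h where "h s z = (if s \<in> J then g z - of_real (2 * pi * (u z - 1)) * \<i> else g z)" for s z
  have cellX: "cell s \<subseteq> X" if "s \<in> Q" for s using that by (auto simp: X_def)
  have hexp: "exp (h s z) = 1" if "s \<in> Q" "z \<in> cell s" for s z
  proof (cases "s \<in> J")
    case True
    then have "z \<in> RJ" using that by (auto simp: RJ_def)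
    then have "exp (g z) = cis (2 * pi * u z)" using g(2)[of z] cellX[OF that(1)] that(2) by (auto simp: f_def)
    moreover have "exp (of_real (2 * pi * (u z - 1)) * \<i>) = cis (2 * pi * u z)"
      using exp_two_pi_i by (simp add: cis_conv_exp right_diff_distrib left_diff_distrib exp_diff mult_ac)
    ultimately show ?thesis using True by (simp add: h_def exp_diff)
  next
    case False
    then have "z \<in> RK" using that by (auto simp: RK_def)
    then have "exp (g z) = 1" using g(2)[of z] f1[of z] cellX[OF that(1)] that(2) by auto
    then show ?thesis using False by (simp add: h_def)
  qed
  have hconst: "h s z = h s z'" if "s \<in> Q" "z \<in> cell s" "z' \<in> cell s" for s z z'
  proof (rule exp_integer_on_connected[of "cell s"])
    show "connected (cell s)" using convex_cell convex_connected by blast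
    have "continuous_on (cell s) g" using g(1) cellX[OF that(1)] continuous_on_subset by blast
    then show "continuous_on (cell s) (h s)" unfolding h_def[abs_def] 
      by (cases "s \<in> J") (auto intro!: continuous_intros contu)
  qed (use that hexp in auto)
  define lower where "lower s = (real_of_int (fst s), real_of_int (snd s))" for s :: lattice
  have lower: "lower s \<in> cell s" for s by (simp add: lower_def cell_def)
  define c where "c s = \<lfloor>Im (h s (lower s)) / (2 * pi)\<rfloor>" for s
  have c: "h s z = of_int (c s) * (2 * pi) * \<i>" if s: "s \<in> Q" and z: "z \<in> cell s" for s z
  proof -
    have "\<exists>n :: int. h s z = 0 + (of_int (2 * n) * pi) * \<i>"
      using hexp[OF s z] exp_eq[of "h s z" 0] unfolding exp_zero by blast
    then obtain n :: int where n: "h s z = (of_int (2 * n) * pi) * \<i>" by auto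
    then have "h s (lower s) = (of_int (2 * n) * pi) * \<i>" using hconst[OF s z lower] by simp
    then have "c s = n" by (simp add: c_def)
    then show ?thesis using n by simp
  qed
  \<comment> \<open>The integers of two cells can be compared at a common point.\<close>
  have c_eqI: "c s = c t + k" if "s \<in> Q" "t \<in> Q" "z \<in> cell s" "z \<in> cell t" "h s z = h t z + of_int k * (2 * pi) * \<i>" for s t z k
  proof -
    have "of_int (c s) * (2 * pi) * \<i> = of_int (c t) * (2 * pi) * \<i> + of_int k * (2 * pi) * \<i>"
      using c[of s z] c[of t z] that by simp
    then have "real_of_int (c s) * (2 * pi) = of_int (c t) * (2 * pi) + of_int k * (2 * pi)"
      by (simp add: complex_eq_iff)
    then have "real_of_int (c s) = of_int (c t) + of_int k"
      by (metis distrib_right mult_right_cancel pi_neq_zero mult_eq_0_iff zero_neq_numeral)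
    then show ?thesis by linarith
  qed
  have aJ: "a \<notin> J" using ab(3) by (auto simp: J_def row_piece_def row_linked_def)
  have c1: "c t = c s" if "s \<in> Q" "t \<in> J" "s \<notin> I" "s \<notin> J" "z \<in> cell s" "z \<in> cell t" for s t z
  proof -
    have "u z = 1" using far[OF that(1,3,4,5)] that(2,6) by (auto simp: RJ_def)
    then show ?thesis using c_eqI[of t s z 0] that IQ by (auto simp: h_def)
  qed
  show ?thesis
  proof (intro exI[of _ c] conjI allI impI)
    obtain z where z: "z \<in> cell a" "z \<in> cell b" using touch by blast
    have "u z = 0" using near[of z] z IQ by (auto simp: RI_def RJ_def)
    then show "c b = c a + 1" using c_eqI[of b a z 1] z ab IQ aJ by (auto simp: h_def)
  next
    fix s t assume st: "s \<in> Q \<and> t \<in> Q \<and> cell s \<inter> cell t \<noteq> {}"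
      and n1: "\<not> (row_linked Q s a \<and> row_linked Q t b)" and n2: "\<not> (row_linked Q t a \<and> row_linked Q s b)"
    obtain z where z: "z \<in> cell s" "z \<in> cell t" using st by blast
    have n: "\<not> (s \<in> I \<and> t \<in> J)" "\<not> (t \<in> I \<and> s \<in> J)"
      using n1 n2 by (auto simp only: memI memJ)
    have IJ: "I \<inter> J = {}" using ab(3) by (auto simp: I_def J_def row_piece_def row_linked_def)
    show "c s = c t"
    proof (cases "s \<in> J \<longleftrightarrow> t \<in> J")
      case True
      then show ?thesis using c_eqI[of s t z 0] z st by (auto simp: h_def)
    next
      case False
      then show ?thesis using c1[of s t z] c1[of t s z] z st n by (cases "s \<in> J") auto
    qed
  qed
qed

section \<open>Flat labellings of a simply connected cell complex\<close>

lemma exists_int_sums: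
  fixes T :: "int \<Rightarrow> 'g::group_add"
  shows "\<exists>A. \<forall>i. A (i + 1) = A i + T i"
proof -
  define B where "B = rec_nat 0 (\<lambda>n b. b + T (int n))"
  define C where "C = rec_nat 0 (\<lambda>n b. b - T (- int n - 1))"
  have B: "B 0 = 0" "B (Suc n) = B n + T (int n)" for n by (simp_all add: B_def)
  have C: "C 0 = 0" "C (Suc n) = C n - T (- int n - 1)" for n by (simp_all add: C_def)
  define A where "A i = (if 0 \<le> i then B (nat i) else C (nat (- i)))" for i
  have "A (i + 1) = A i + T i" for i
  proof (cases "0 \<le> i")
    case True
    then show ?thesis using B(2)[of "nat i"] by (simp add: A_def nat_add_distrib)
  next
    case False
    define n where "n = nat (- i - 1)"
    have i: "i = - int n - 1" using False by (simp add: n_def)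
    have e: "nat (1 + int n) = Suc n" by simp
    have "A i = C n - T i" using C(2)[of n] e unfolding i by (simp add: A_def)
    moreover have "A (i + 1) = C n" unfolding i using B(1) C(1) by (cases n) (auto simp: A_def nat_add_distrib)
    ultimately show ?thesis by simp
  qed
  then show ?thesis by blast
qed

text \<open>Two squares that share only a corner count as being in contact only if neither of the other two squares
  in the same two rows at that corner is present; otherwise they are connected through it.\<close>

definition upward_contact :: "lattice set \<Rightarrow> lattice \<Rightarrow> lattice \<Rightarrow> bool" where
  "upward_contact Q s t \<longleftrightarrow> s \<in> Q \<and> t \<in> Q \<and> snd t = snd s + 1 \<and>
     (fst t = fst s \<or>
      \<bar>fst t - fst s\<bar> = 1 \<and> (fst t, snd s) \<notin> Q \<and> (fst s, snd t) \<notin> Q)"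

lemma upward_contact_touch: "upward_contact Q s t \<Longrightarrow> cell s \<inter> cell t \<noteq> {}"
proof -
  assume "upward_contact Q s t"
  then have "snd t = snd s + 1" "\<bar>fst t - fst s\<bar> \<le> 1" by (auto simp: upward_contact_def)
  then have "(real_of_int (max (fst s) (fst t)), real_of_int (snd t)) \<in> cell s \<inter> cell t"
    by (auto simp: cell_def max_def abs_le_iff)
  then show ?thesis by blast
qed

text \<open>Two strips of consecutive rows meet either along edges or in a single corner, so all contacts
  between them are vertical or there is only one.\<close>

lemma row_contact_unique:
  assumes "upward_contact Q (i, j) (i', j + 1)" "upward_contact Q (k, j) (k', j + 1)"
    and "row_linked Q (i, j) (k, j)" "row_linked Q (i', j + 1) (k', j + 1)"
  shows "i = i' \<and> k = k' \<or> i = k \<and> i' = k'"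
proof -
  have r1: "(m, j) \<in> Q" if "i \<le> m \<and> m \<le> k \<or> k \<le> m \<and> m \<le> i" for m
    using assms(3) that by (auto simp: row_linked_iff)
  have r2: "(m, j + 1) \<in> Q" if "i' \<le> m \<and> m \<le> k' \<or> k' \<le> m \<and> m \<le> i'" for m
    using assms(4) that by (auto simp: row_linked_iff)
  have a: "i' = i \<or> (i' = i + 1 \<or> i' = i - 1) \<and> (i', j) \<notin> Q \<and> (i, j + 1) \<notin> Q"
    using assms(1) by (auto simp: upward_contact_def)
  have b: "k' = k \<or> (k' = k + 1 \<or> k' = k - 1) \<and> (k', j) \<notin> Q \<and> (k, j + 1) \<notin> Q"
    using assms(2) by (auto simp: upward_contact_def)
  show ?thesis
    using a b r1[of i'] r1[of k'] r2[of i] r2[of k] by smt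
qed

lemma row_linked_induct:
  assumes "row_linked Q (i, j) (k, j)"
    and step: "\<And>m. (m, j) \<in> Q \<Longrightarrow> (m + 1, j) \<in> Q \<Longrightarrow> i \<le> m \<and> m + 1 \<le> k \<or> k \<le> m \<and> m + 1 \<le> i \<Longrightarrow> f m = f (m + 1)"
  shows "f i = f k"
proof -
  have up: "f x = f (x + int n)" if "\<And>m. x \<le> m \<Longrightarrow> m + 1 \<le> x + int n \<Longrightarrow> f m = f (m + 1)" for x n
    using that
  proof (induction n)
    case (Suc n)
    then have "f x = f (x + int n)" by simp
    also have "\<dots> = f (x + int n + 1)" using Suc.prems[of "x + int n"] by simp
    finally show ?case by (simp add: algebra_simps)
  qed simp
  have mem: "(m, j) \<in> Q" if "i \<le> m \<and> m \<le> k \<or> k \<le> m \<and> m \<le> i" for m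
    using assms(1) that by (auto simp: row_linked_iff)
  show ?thesis
  proof (cases "i \<le> k")
    case True
    then show ?thesis using up[of i "nat (k - i)"] step mem by simp
  next
    case False
    then show ?thesis using up[of k "nat (i - k)"] step mem by simp
  qed
qed

text \<open>A labelling of the steps between neighbouring squares that is flat, that is, has trivial product around
  each interior vertex, is the difference of a potential. Steps over a corner contact may be labelled
  arbitrarily: for the forest of strips described below such a contact is an edge like any other.

  Subtracting sums along the rows makes the horizontal labels trivial. Flatness then says that
  the vertical labels are constant along the contact of two strips, so they label the edges of the graph of
  strips, which is a forest by \<open>row_crossing_colouring\<close>.\<close>

lemma flat_labelling_potential:
  fixes T :: "lattice \<Rightarrow> 'g::group_add" and U :: "lattice \<Rightarrow> lattice \<Rightarrow> 'g"
  assumes sc: "simply_connected_complex Q"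
    and flat: "\<And>i j. {(i, j), (i + 1, j), (i, j + 1), (i + 1, j + 1)} \<subseteq> Q \<Longrightarrow>
      T (i, j) + U (i + 1, j) (i + 1, j + 1) = U (i, j) (i, j + 1) + T (i, j + 1)"
  obtains F where "\<And>i j. (i, j) \<in> Q \<Longrightarrow> (i + 1, j) \<in> Q \<Longrightarrow> F (i + 1, j) = F (i, j) + T (i, j)"
    and "\<And>s t. upward_contact Q s t \<Longrightarrow> F t = F s + U s t"
proof -
  have "\<forall>j. \<exists>A. \<forall>i. A (i + 1) = A i + T (i, j)" by (intro allI exists_int_sums)
  then obtain A' where A': "\<And>i j. A' j (i + 1) = A' j i + T (i, j)" by metis
  \<comment> \<open>The potential of the horizontal labels along each row separately, and the vertical labels corrected by it.\<close>
  define A where "A s = A' (snd s) (fst s)" for s :: lattice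
  have A: "A (i + 1, j) = A (i, j) + T (i, j)" for i j by (simp add: A_def A')
  define lab where "lab s t = A s + U s t - A t" for s t
  have lab_vert: "lab (i, j) (i, j + 1) = lab (i + 1, j) (i + 1, j + 1)"
    if "{(i, j), (i + 1, j), (i, j + 1), (i + 1, j + 1)} \<subseteq> Q" for i j
  proof -
    have "lab (i + 1, j) (i + 1, j + 1) = A (i, j) + (T (i, j) + U (i + 1, j) (i + 1, j + 1)) - (A (i, j + 1) + T (i, j + 1))"
      by (simp add: lab_def A add.assoc)
    also have "\<dots> = A (i, j) + U (i, j) (i, j + 1) - A (i, j + 1)"
      unfolding flat[OF that] by (simp add: diff_conv_add_uminus minus_add add.assoc del: add_uminus_conv_diff)
    finally show ?thesis by (simp add: lab_def)
  qed
  have lab_eq: "lab s t = lab s' t'"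
    if c: "upward_contact Q s t" "upward_contact Q s' t'" and l: "row_linked Q s s'" "row_linked Q t t'" for s t s' t'
  proof -
    obtain i j where s: "s = (i, j)" by (cases s)
    obtain k where s': "s' = (k, j)" using l(1) s by (cases s') (auto simp: row_linked_iff)
    obtain i' where t: "t = (i', j + 1)" using c(1) s by (cases t) (auto simp: upward_contact_def)
    obtain k' where t': "t' = (k', j + 1)" using c(2) s' by (cases t') (auto simp: upward_contact_def)
    show ?thesis
    proof (cases "i = i' \<and> k = k'")
      case True
      have "lab (i, j) (i, j + 1) = lab (k, j) (k, j + 1)"
      proof (rule row_linked_induct[of Q i j k "\<lambda>m. lab (m, j) (m, j + 1)"])
        show "row_linked Q (i, j) (k, j)" using l s s' by simp
        fix m assume "(m, j) \<in> Q" "(m + 1, j) \<in> Q" "i \<le> m \<and> m + 1 \<le> k \<or> k \<le> m \<and> m + 1 \<le> i"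
        moreover have "(m, j + 1) \<in> Q" "(m + 1, j + 1) \<in> Q"
          using l(2) t t' True calculation(3) by (auto simp: row_linked_iff)
        ultimately show "lab (m, j) (m, j + 1) = lab (m + 1, j) (m + 1, j + 1)"
          using lab_vert by simp
      qed
      then show ?thesis using s t s' t' True by simp
    next
      case False
      then show ?thesis using row_contact_unique[of Q i j i' k k'] c l s t s' t' by auto
    qed
  qed
  define E where "E I J \<longleftrightarrow> (\<exists>s t. upward_contact Q s t \<and> I = row_piece Q s \<and> J = row_piece Q t)" for I J
  define elab where "elab I J = (SOME l. \<exists>s t. upward_contact Q s t \<and> I = row_piece Q s \<and> J = row_piece Q t \<and> l = lab s t)" for I J
  have elab: "elab (row_piece Q s) (row_piece Q t) = lab s t" if c: "upward_contact Q s t" for s t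
  proof -
    have "\<exists>s' t'. upward_contact Q s' t' \<and> row_piece Q s = row_piece Q s' \<and> row_piece Q t = row_piece Q t' \<and>
      elab (row_piece Q s) (row_piece Q t) = lab s' t'"
      unfolding elab_def by (rule someI_ex) (use c in blast)
    then obtain s' t' where *: "upward_contact Q s' t'" "row_piece Q s = row_piece Q s'" "row_piece Q t = row_piece Q t'"
      "elab (row_piece Q s) (row_piece Q t) = lab s' t'" by blast
    have "s \<in> Q" "t \<in> Q" "s' \<in> Q" "t' \<in> Q" using c *(1) by (auto simp: upward_contact_def)
    then show ?thesis using * c lab_eq[of s t s' t'] row_piece_eq_iff by metis
  qed
  have bridge: "\<exists>c::lattice set \<Rightarrow> int. c I \<noteq> c J \<and> (\<forall>x y. E x y \<longrightarrow> (x, y) \<noteq> (I, J) \<longrightarrow> c x = c y)" if "E I J" for I J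
  proof -
    obtain a b where ab: "upward_contact Q a b" "I = row_piece Q a" "J = row_piece Q b"
      using \<open>E I J\<close> unfolding E_def by blast
    have abQ: "a \<in> Q" "b \<in> Q" "snd b = snd a + 1" using ab(1) by (auto simp: upward_contact_def)
    obtain c :: "lattice \<Rightarrow> int" where c: "c b = c a + 1"
      "\<And>s t. s \<in> Q \<Longrightarrow> t \<in> Q \<Longrightarrow> cell s \<inter> cell t \<noteq> {} \<Longrightarrow>
       \<not> (row_linked Q s a \<and> row_linked Q t b) \<Longrightarrow> \<not> (row_linked Q t a \<and> row_linked Q s b) \<Longrightarrow> c s = c t"
      using row_crossing_colouring[OF sc abQ upward_contact_touch[OF ab(1)]] by blast
    have cl: "c s = c t" if l: "row_linked Q s t" for s t
    proof -
      obtain i j where s: "s = (i, j)" by (cases s)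
      obtain k where t: "t = (k, j)" using l s by (cases t) (auto simp: row_linked_iff)
      have "c (i, j) = c (k, j)"
      proof (rule row_linked_induct[of Q i j k "\<lambda>m. c (m, j)"])
        show "row_linked Q (i, j) (k, j)" using l s t by simp
        fix m assume m: "(m, j) \<in> Q" "(m + 1, j) \<in> Q"
        have "(real_of_int (m + 1), real_of_int j) \<in> cell (m, j) \<inter> cell (m + 1, j)" by (simp add: cell_def)
        then show "c (m, j) = c (m + 1, j)"
          using abQ(3) by (intro c(2) m) (auto simp: row_linked_def)
      qed
      then show ?thesis using s t by simp
    qed
    define cc where "cc K = c (SOME s. s \<in> K)" for K
    have cc: "cc (row_piece Q s) = c s" if "s \<in> Q" for s
    proof -
      have "(SOME t. t \<in> row_piece Q s) \<in> row_piece Q s"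
        by (rule someI[of _ s]) (use row_linked_refl[OF that] in \<open>simp add: row_piece_def\<close>)
      then show ?thesis using cl by (simp add: cc_def row_piece_def)
    qed
    show ?thesis
    proof (intro exI[of _ cc] conjI allI impI)
      show "cc I \<noteq> cc J" using cc abQ ab c(1) by simp
      fix x y assume "E x y" and ne: "(x, y) \<noteq> (I, J)"
      then obtain s t where st: "upward_contact Q s t" "x = row_piece Q s" "y = row_piece Q t"
        unfolding E_def by blast
      have stQ: "s \<in> Q" "t \<in> Q" "snd t = snd s + 1" using st(1) by (auto simp: upward_contact_def)
      have "c s = c t"
      proof (rule c(2)[OF stQ(1,2) upward_contact_touch[OF st(1)]])
        show "\<not> (row_linked Q s a \<and> row_linked Q t b)"
          using ne st(2,3) ab(2,3) row_piece_eq_iff[of s Q a] row_piece_eq_iff[of t Q b] stQ abQ by simp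
        show "\<not> (row_linked Q t a \<and> row_linked Q s b)"
          using stQ(3) abQ(3) by (auto simp: row_linked_def)
      qed
      then show "cc x = cc y" using cc stQ st by simp
    qed
  qed
  obtain H where H: "\<And>I J. E I J \<Longrightarrow> H J = H I + elab I J"
    using forest_potential[of E elab] bridge by blast
  show thesis
  proof (rule that[of "\<lambda>s. H (row_piece Q s) + A s"])
    fix i j assume *: "(i, j) \<in> Q" "(i + 1, j) \<in> Q"
    have "row_linked Q (i, j) (i + 1, j)"
      unfolding row_linked_iff
    proof (intro conjI allI impI)
      fix m assume "i \<le> m \<and> m \<le> i + 1 \<or> i + 1 \<le> m \<and> m \<le> i"
      then have "m = i \<or> m = i + 1" by linarith
      then show "(m, j) \<in> Q" using * by auto
    qed simp
    then have "row_piece Q (i + 1, j) = row_piece Q (i, j)" using row_piece_eq_iff * by blast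
    then show "H (row_piece Q (i + 1, j)) + A (i + 1, j) = H (row_piece Q (i, j)) + A (i, j) + T (i, j)"
      by (simp add: A add.assoc)
  next
    fix s t assume c: "upward_contact Q s t"
    then have "H (row_piece Q t) = H (row_piece Q s) + elab (row_piece Q s) (row_piece Q t)"
      unfolding E_def by (intro H[unfolded E_def]) blast
    then show "H (row_piece Q t) + A t = H (row_piece Q s) + A s + U s t"
      using elab[OF c] by (simp add: lab_def diff_conv_add_uminus add.assoc del: add_uminus_conv_diff)
  qed
qed

section \<open>Jacobi's elliptic functions on the real line\<close>

text \<open>The interval that \<open>ell_F k\<close> maps bijectively onto the real line; for \<open>k = 1\<close> the integrand
  \<open>1 / cos\<close> has a pole at each end of it.\<close>

definition ell_dom :: "real \<Rightarrow> real set" where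
  "ell_dom k = (if k < 1 then UNIV else {-pi/2<..<pi/2})"

lemma ell_dom_props:
  "open (ell_dom k)" "convex (ell_dom k)" "0 \<in> ell_dom k"
  by (auto simp: ell_dom_def)

lemma ell_dom_seg: "x \<in> ell_dom k \<Longrightarrow> y \<in> ell_dom k \<Longrightarrow> {x..y} \<subseteq> ell_dom k"
  by (auto simp: ell_dom_def split: if_splits)

lemma ell_radicand_pos:
  assumes "0 \<le> k" "k \<le> 1" "t \<in> ell_dom k"
  shows "0 < 1 - k\<^sup>2 * (sin t)\<^sup>2"
proof (cases "k < 1")
  case True
  have "k\<^sup>2 * (sin t)\<^sup>2 \<le> k\<^sup>2 * 1"
    by (intro mult_left_mono) (auto simp: abs_square_le_1)
  moreover have "k\<^sup>2 < 1" using True assms by (simp add: power_less_one_iff)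
  ultimately show ?thesis by linarith
next
  case False
  then have k: "k = 1" using assms by simp
  have "cos t > 0" using assms(3) k by (intro cos_gt_zero_pi) (auto simp: ell_dom_def)
  then have "(cos t)\<^sup>2 > 0" by (simp only: zero_less_power)
  then show ?thesis unfolding k cos_squared_eq by simp
qed

lemma ell_F_deriv:
  assumes k: "0 \<le> k" "k \<le> 1" and x: "x \<in> ell_dom k"
  shows "(ell_F k has_real_derivative 1 / sqrt (1 - k\<^sup>2 * (sin x)\<^sup>2)) (at x)"
proof -
  let ?f = "\<lambda>t. 1 / sqrt (1 - k\<^sup>2 * (sin t)\<^sup>2)"
  obtain a b where ab: "a < x" "x < b" "a < 0" "0 < b" "a \<in> ell_dom k" "b \<in> ell_dom k"
  proof (cases "k < 1")
    case True
    show thesis by (rule that[of "min x 0 - 1" "max x 0 + 1"]) (use True in \<open>auto simp: ell_dom_def\<close>)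
  next
    case False
    then have "-pi/2 < x" "x < pi/2" using x by (auto simp: ell_dom_def)
    then show thesis
      by (intro that[of "(min x 0 - pi/2)/2" "(max x 0 + pi/2)/2"]) (use False in \<open>auto simp: ell_dom_def min_def max_def field_simps\<close>)
  qed
  have sub: "{a..b} \<subseteq> ell_dom k" using ab ell_dom_seg by blast
  have pos: "0 < 1 - k\<^sup>2 * (sin t)\<^sup>2" if "t \<in> {a..b}" for t
    using ell_radicand_pos k sub that by blast
  have "continuous_on {a..b} ?f"
    by (intro continuous_intros) (use pos in force)
  then have "((\<lambda>u. LBINT y=ereal 0..u. ?f y) has_vector_derivative ?f x) (at x within {a..b})"
    using ab by (intro interval_integral_FTC2) auto
  then have "((\<lambda>u. LBINT y=ereal 0..u. ?f y) has_vector_derivative ?f x) (at x)"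
    using ab by (simp add: at_within_Icc_at)
  then show ?thesis
    by (simp add: has_real_derivative_iff_has_vector_derivative ell_F_def[abs_def] zero_ereal_def)
qed

lemma ell_F_0: "ell_F k 0 = 0"
  by (simp add: ell_F_def zero_ereal_def)

lemma ell_F_strict_mono:
  assumes k: "0 \<le> k" "k \<le> 1" and "x \<in> ell_dom k" "y \<in> ell_dom k" "x < y"
  shows "ell_F k x < ell_F k y"
proof (rule DERIV_pos_imp_increasing[OF \<open>x < y\<close>])
  fix t assume "x \<le> t" "t \<le> y"
  then have t: "t \<in> ell_dom k" using assms ell_dom_seg by force
  show "\<exists>y. (ell_F k has_real_derivative y) (at t) \<and> 0 < y"
    using ell_F_deriv[OF k t] ell_radicand_pos[OF k t] by force
qed

lemma ell_F_unit:
  assumes "\<bar>\<phi>\<bar> < pi/2"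
  shows "ell_F 1 \<phi> = artanh (sin \<phi>)"
proof -
  let ?D = "{-pi/2<..<pi/2}"
  have d: "((\<lambda>x. ell_F 1 x - artanh (sin x)) has_real_derivative 0) (at x)" if "x \<in> ?D" for x
  proof -
    have c: "cos x > 0" using that by (intro cos_gt_zero_pi) auto
    then have "sin x \<noteq> 1" "sin x \<noteq> - 1" using sin_cos_squared_add[of x] by (auto simp: power2_eq_square)
    then have s: "\<bar>sin x\<bar> < 1" using sin_le_one[of x] sin_ge_minus_one[of x] by linarith
    have e: "sqrt (1 - (sin x)\<^sup>2) = cos x"
      using c by (intro real_sqrt_unique) (auto simp: cos_squared_eq)
    have "(ell_F 1 has_real_derivative 1 / cos x) (at x)"
      using ell_F_deriv[of 1 x] that e by (simp add: ell_dom_def)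
    moreover have "((\<lambda>x. artanh (sin x)) has_real_derivative (1 / (1 - (sin x)\<^sup>2)) * cos x) (at x)"
      by (rule DERIV_chain2[where f=artanh and g=sin]) (use s in \<open>auto intro!: derivative_eq_intros\<close>)
    moreover have "(1 / (1 - (sin x)\<^sup>2)) * cos x = 1 / cos x"
      unfolding cos_squared_eq[symmetric] using c by (simp add: power2_eq_square)
    ultimately show ?thesis by (metis DERIV_diff diff_self)
  qed
  have "(\<lambda>x. ell_F 1 x - artanh (sin x)) \<phi> = (\<lambda>x. ell_F 1 x - artanh (sin x)) 0"
  proof -
    obtain c where "\<forall>x\<in>?D. ell_F 1 x - artanh (sin x) = c"
      using has_field_derivative_zero_constant[of ?D "\<lambda>x. ell_F 1 x - artanh (sin x)"] d
      by (auto intro: has_field_derivative_at_within)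
    moreover have "\<phi> \<in> ?D" "0 \<in> ?D" using assms by (auto simp: abs_less_iff)
    ultimately show ?thesis by metis
  qed
  then show ?thesis by (simp add: ell_F_0)
qed

text \<open>For \<open>k < 1\<close> the derivative is at least 1; for \<open>k = 1\<close> there is the explicit formula
  \<open>ell_F_unit\<close>.\<close>

lemma ell_F_surj:
  assumes k: "0 \<le> k" "k \<le> 1"
  shows "\<exists>\<phi>\<in>ell_dom k. ell_F k \<phi> = u"
proof (cases "k < 1")
  case True
  then have D: "ell_dom k = UNIV" by (simp add: ell_dom_def)
  have diff: "(\<lambda>x. ell_F k x - x) x \<le> (\<lambda>x. ell_F k x - x) y" if "x \<le> y" for x y
  proof (rule DERIV_nonneg_imp_nondecreasing[OF that])
    fix t
    have "sqrt (1 - k\<^sup>2 * (sin t)\<^sup>2) \<le> 1" by simp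
    moreover have "0 < sqrt (1 - k\<^sup>2 * (sin t)\<^sup>2)" using ell_radicand_pos[OF k] D by simp
    ultimately have "1 / sqrt (1 - k\<^sup>2 * (sin t)\<^sup>2) \<ge> 1" by simp
    moreover have "((\<lambda>x. ell_F k x - x) has_real_derivative 1 / sqrt (1 - k\<^sup>2 * (sin t)\<^sup>2) - 1) (at t)"
      using ell_F_deriv[OF k] D by (auto intro!: derivative_eq_intros)
    ultimately show "\<exists>y. ((\<lambda>x. ell_F k x - x) has_real_derivative y) (at t) \<and> 0 \<le> y"
      by (meson diff_ge_0_iff_ge)
  qed
  have "isCont (ell_F k) x" for x using ell_F_deriv[OF k] D DERIV_isCont by blast
  then have "\<exists>x\<ge>- \<bar>u\<bar>. x \<le> \<bar>u\<bar> \<and> ell_F k x = u"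
    using diff[of 0 "\<bar>u\<bar>"] diff[of "-\<bar>u\<bar>" 0] by (intro IVT) (auto simp: ell_F_0)
  then show ?thesis using D by auto
next
  case False
  then have k1: "k = 1" using k by simp
  let ?p = "arcsin (tanh u)"
  have t: "-1 < tanh u" "tanh u < 1" using tanh_real_bounds[of u] by auto
  then have "-pi/2 < ?p" "?p < pi/2" using arcsin_lt_bounded[of "tanh u"] by auto
  then show ?thesis using ell_F_unit[of ?p] t by (intro bexI[of _ ?p]) (auto simp: k1 ell_dom_def abs_less_iff artanh_tanh_real)
qed

lemma ell_dom_iff: "k \<le> 1 \<Longrightarrow> (k < 1 \<or> \<bar>\<phi>\<bar> < pi/2) \<longleftrightarrow> \<phi> \<in> ell_dom k"
  by (auto simp: ell_dom_def)

lemma jacobi_am_unique: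
  assumes k: "0 \<le> k" "k \<le> 1" and "\<phi> \<in> ell_dom k" 
  shows "jacobi_am k (ell_F k \<phi>) = \<phi>"
  unfolding jacobi_am_def ell_dom_iff[OF k(2)]
  using ell_F_strict_mono[OF k] assms(3) by (intro the_equality) (auto, metis less_irrefl linorder_neqE_linordered_idom)

lemma jacobi_am:
  assumes k: "0 \<le> k" "k \<le> 1"
  shows "jacobi_am k u \<in> ell_dom k" "ell_F k (jacobi_am k u) = u"
  using ell_F_surj[OF k, of u] jacobi_am_unique[OF k] by auto

lemma jacobi_am_0: "0 \<le> k \<Longrightarrow> k \<le> 1 \<Longrightarrow> jacobi_am k 0 = 0"
  using jacobi_am_unique[of k 0] ell_dom_props by (simp add: ell_F_0)

lemma jacobi_am_less_iff:
  assumes k: "0 \<le> k" "k \<le> 1"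
  shows "jacobi_am k u < jacobi_am k v \<longleftrightarrow> u < v"
  using ell_F_strict_mono[OF k] jacobi_am[OF k] by (metis linorder_neqE_linordered_idom less_asym)

lemma jacobi_dn_pos:
  assumes k: "0 \<le> k" "k \<le> 1"
  shows "0 < jacobi_dn k u"
  using ell_radicand_pos[OF k jacobi_am(1)[OF k]] by (simp add: jacobi_dn_def jacobi_sn_def)

lemma jacobi_am_deriv:
  assumes k: "0 \<le> k" "k \<le> 1"
  shows "(jacobi_am k has_real_derivative jacobi_dn k u) (at u)"
proof -
  let ?x = "jacobi_am k u"
  have "(jacobi_am k has_real_derivative inverse (1 / sqrt (1 - k\<^sup>2 * (sin ?x)\<^sup>2))) (at (ell_F k ?x))"
  proof (rule has_field_derivative_inverse_strong[where S="ell_dom k" and f="ell_F k"])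
    show "(ell_F k has_real_derivative 1 / sqrt (1 - k\<^sup>2 * (sin ?x)\<^sup>2)) (at ?x)"
      by (rule ell_F_deriv[OF k jacobi_am(1)[OF k]])
    show "continuous_on (ell_dom k) (ell_F k)"
      using ell_F_deriv[OF k] by (intro continuous_at_imp_continuous_on ballI DERIV_isCont) blast
    show "1 / sqrt (1 - k\<^sup>2 * (sin ?x)\<^sup>2) \<noteq> 0"
      using ell_radicand_pos[OF k jacobi_am(1)[OF k, of u]] by simp
  qed (use jacobi_am[OF k] jacobi_am_unique[OF k] ell_dom_props in auto)
  then show ?thesis using jacobi_am[OF k] by (simp add: jacobi_dn_def jacobi_sn_def)
qed

lemma jacobi_identities:
  assumes k: "0 \<le> k" "k \<le> 1"
  shows "(jacobi_cn k u)\<^sup>2 = 1 - (jacobi_sn k u)\<^sup>2"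
    and "(jacobi_dn k u)\<^sup>2 = 1 - k\<^sup>2 * (jacobi_sn k u)\<^sup>2"
proof -
  show "(jacobi_cn k u)\<^sup>2 = 1 - (jacobi_sn k u)\<^sup>2"
    by (simp add: jacobi_cn_def jacobi_sn_def cos_squared_eq)
  show "(jacobi_dn k u)\<^sup>2 = 1 - k\<^sup>2 * (jacobi_sn k u)\<^sup>2"
    using ell_radicand_pos[OF k jacobi_am(1)[OF k, of u]] by (simp add: jacobi_dn_def jacobi_sn_def)
qed

lemma jacobi_derivs:
  assumes k: "0 \<le> k" "k \<le> 1"
  shows "(jacobi_sn k has_real_derivative jacobi_cn k u * jacobi_dn k u) (at u)"
    and "(jacobi_cn k has_real_derivative - (jacobi_sn k u * jacobi_dn k u)) (at u)"
    and "(jacobi_dn k has_real_derivative - (k\<^sup>2 * jacobi_sn k u * jacobi_cn k u)) (at u)"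
proof -
  show 1: "(jacobi_sn k has_real_derivative jacobi_cn k u * jacobi_dn k u) (at u)"
    unfolding jacobi_sn_def[abs_def] jacobi_cn_def
    by (auto intro!: derivative_eq_intros jacobi_am_deriv[OF k] simp: jacobi_sn_def)
  show "(jacobi_cn k has_real_derivative - (jacobi_sn k u * jacobi_dn k u)) (at u)"
    unfolding jacobi_cn_def[abs_def] jacobi_sn_def
    by (auto intro!: derivative_eq_intros jacobi_am_deriv[OF k])
  have p: "1 - k\<^sup>2 * (jacobi_sn k u)\<^sup>2 > 0"
    using jacobi_dn_pos[OF k, of u] by (simp add: jacobi_dn_def)
  then show "(jacobi_dn k has_real_derivative - (k\<^sup>2 * jacobi_sn k u * jacobi_cn k u)) (at u)"
    unfolding jacobi_dn_def[abs_def]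
    by (auto intro!: derivative_eq_intros 1 simp: jacobi_dn_def field_simps)
qed

lemma jacobi_at_0:
  assumes k: "0 \<le> k" "k \<le> 1"
  shows "jacobi_sn k 0 = 0" "jacobi_cn k 0 = 1" "jacobi_dn k 0 = 1"
  by (simp_all add: jacobi_sn_def jacobi_cn_def jacobi_dn_def jacobi_am_0[OF k])

lemma ell_F_minus:
  assumes k: "0 \<le> k" "k \<le> 1" and x: "x \<in> ell_dom k"
  shows "ell_F k (- x) = - ell_F k x"
proof -
  have m: "- t \<in> ell_dom k" if "t \<in> ell_dom k" for t
    using that by (auto simp: ell_dom_def split: if_splits)
  have "((\<lambda>t. ell_F k t + ell_F k (- t)) has_real_derivative 0) (at t)" if t: "t \<in> ell_dom k" for t
  proof -
    let ?e = "1 / sqrt (1 - k\<^sup>2 * (sin t)\<^sup>2)"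
    have "((\<lambda>t. ell_F k (- t)) has_real_derivative ?e * (-1)) (at t)"
      by (rule DERIV_chain2[where f="ell_F k" and g=uminus])
         (use ell_F_deriv[OF k m[OF t]] in \<open>auto intro!: derivative_eq_intros\<close>)
    from DERIV_add[OF ell_F_deriv[OF k t] this] show ?thesis by simp
  qed
  then have "(\<lambda>t. ell_F k t + ell_F k (- t)) x = (\<lambda>t. ell_F k t + ell_F k (- t)) 0"
    using has_field_derivative_zero_constant[of "ell_dom k" "\<lambda>t. ell_F k t + ell_F k (- t)"] x
      ell_dom_props(2,3)[of k] by (metis has_field_derivative_at_within)
  then show ?thesis by (simp add: ell_F_0)
qed

lemma jacobi_am_minus:
  assumes k: "0 \<le> k" "k \<le> 1"
  shows "jacobi_am k (- u) = - jacobi_am k u"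
proof -
  have "- jacobi_am k u \<in> ell_dom k"
    using jacobi_am(1)[OF k, of u] by (auto simp: ell_dom_def split: if_splits)
  from jacobi_am_unique[OF k this] show ?thesis
    using ell_F_minus[OF k jacobi_am(1)[OF k, of u]] jacobi_am(2)[OF k] by simp
qed

lemma jacobi_minus:
  assumes k: "0 \<le> k" "k \<le> 1"
  shows "jacobi_sn k (- u) = - jacobi_sn k u" "jacobi_cn k (- u) = jacobi_cn k u" "jacobi_dn k (- u) = jacobi_dn k u"
  by (simp_all add: jacobi_sn_def jacobi_cn_def jacobi_dn_def jacobi_am_minus[OF k])

lemma ell_F_pi:
  assumes k: "0 \<le> k" "k < 1"
  shows "ell_F k pi = 2 * ell_F k (pi/2)"
proof -
  have k': "0 \<le> k" "k \<le> 1" using k by auto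
  have D: "t \<in> ell_dom k" for t using k by (simp add: ell_dom_def)
  have "((\<lambda>t. ell_F k t + ell_F k (pi - t)) has_real_derivative 0) (at t)" for t
  proof -
    let ?e = "1 / sqrt (1 - k\<^sup>2 * (sin t)\<^sup>2)"
    have "((\<lambda>t. ell_F k (pi - t)) has_real_derivative ?e * (-1)) (at t)"
      by (rule DERIV_chain2[where f="ell_F k" and g="\<lambda>t. pi - t"])
         (use ell_F_deriv[OF k' D, of "pi - t"] in \<open>auto intro!: derivative_eq_intros\<close>)
    from DERIV_add[OF ell_F_deriv[OF k' D] this] show ?thesis by simp
  qed
  then have "(\<lambda>t. ell_F k t + ell_F k (pi - t)) 0 = (\<lambda>t. ell_F k t + ell_F k (pi - t)) (pi/2)"
    using DERIV_const_ratio_const DERIV_isconst_all by blast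
  then show ?thesis by (simp add: ell_F_0)
qed

lemma ell_K_less_1:
  assumes k: "0 \<le> k" "k < 1"
  shows "ell_K k = ereal (ell_F k (pi/2))"
proof -
  have k': "0 \<le> k" "k \<le> 1" using k by auto
  have D: "t \<in> ell_dom k" for t using k by (simp add: ell_dom_def)
  have "(\<integral>\<^sup>+ t. ennreal (1 / sqrt (1 - k\<^sup>2 * (sin t)\<^sup>2)) * indicator {0..pi/2} t \<partial>lborel) = ell_F k (pi/2) - ell_F k 0"
    by (rule nn_integral_FTC_Icc) (use ell_F_deriv[OF k' D] ell_radicand_pos[OF k' D] in \<open>auto intro: less_imp_le\<close>)
  moreover have "ell_F k (pi/2) \<ge> 0"
    using ell_F_strict_mono[OF k' D D, of 0 "pi/2"] by (simp add: ell_F_0)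
  ultimately show ?thesis by (simp add: ell_K_def ell_F_0)
qed

text \<open>The integral bounds every value of \<open>ell_F 1\<close> on its domain, and these values are unbounded.\<close>

lemma ell_K_1: "ell_K 1 = \<infinity>"
proof (rule ereal_top)
  fix B :: real
  let ?f = "\<lambda>t::real. ennreal (1 / sqrt (1 - 1\<^sup>2 * (sin t)\<^sup>2))"
  obtain p where p: "p \<in> ell_dom 1" "ell_F 1 p = max B 0" using ell_F_surj[of 1 "max B 0"] by auto
  have p0: "0 \<le> p"
    using ell_F_strict_mono[of 1 p 0] p ell_dom_props(3)[of 1] by (force simp: ell_F_0)
  have "(\<integral>\<^sup>+ t. ?f t * indicator {0..p} t \<partial>lborel) = ell_F 1 p - ell_F 1 0"
  proof (rule nn_integral_FTC_Icc[OF _ _ _ p0])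
    fix x assume "x \<in> {0..p}"
    then have x: "x \<in> ell_dom 1" using p(1) ell_dom_props(3)[of 1] ell_dom_seg[of 0 1 p] by blast
    show "(ell_F 1 has_real_derivative 1 / sqrt (1 - 1\<^sup>2 * (sin x)\<^sup>2)) (at x)"
      using ell_F_deriv[of 1, OF _ _ x] by simp
    show "0 \<le> 1 / sqrt (1 - 1\<^sup>2 * (sin x)\<^sup>2)"
      using ell_radicand_pos[of 1, OF _ _ x] by simp
  qed auto
  moreover have "(\<integral>\<^sup>+ t. ?f t * indicator {0..p} t \<partial>lborel) \<le> (\<integral>\<^sup>+ t. ?f t * indicator {0..pi/2} t \<partial>lborel)"
    using p(1) by (intro nn_integral_mono) (auto simp: indicator_def ell_dom_def)
  ultimately have "ennreal (max B 0) \<le> (\<integral>\<^sup>+ t. ?f t * indicator {0..pi/2} t \<partial>lborel)"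
    using p by (simp add: ell_F_0)
  then have "enn2ereal (ennreal (max B 0)) \<le> ell_K 1"
    unfolding ell_K_def by (simp only: less_eq_ennreal.rep_eq)
  then show "ereal B \<le> ell_K 1"
    by (metis enn2ereal_ennreal ereal_less_eq(3) max.cobounded1 max.cobounded2 order_trans)
qed

text \<open>On the given range the amplitude runs from \<open>- pi\<close> to \<open>pi\<close> if \<open>k < 1\<close>, and stays between
  \<open>- pi/2\<close> and \<open>pi/2\<close> if \<open>k = 1\<close>. This is the condition \<open>R < pi/2\<close> on rings.\<close>

lemma jacobi_sn_pos_iff:
  assumes k: "0 \<le> k" "k \<le> 1" and \<beta>: "ereal \<beta> \<in> {- (2 * ell_K k)<..2 * ell_K k}"
  shows "jacobi_sn k \<beta> > 0 \<longleftrightarrow> ereal \<beta> \<in> {0<..<2 * ell_K k}"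
proof -
  let ?a = "jacobi_am k \<beta>"
  have pos: "0 < ?a \<longleftrightarrow> 0 < \<beta>" using jacobi_am_less_iff[OF k, of 0 \<beta>] by (simp add: jacobi_am_0[OF k])
  show ?thesis
  proof (cases "k < 1")
    case True
    have D: "t \<in> ell_dom k" for t using True by (simp add: ell_dom_def)
    define L where "L = 2 * ell_F k (pi/2)"
    have K2: "2 * ell_K k = ereal L" using True k by (simp add: ell_K_less_1 L_def)
    have amL: "jacobi_am k L = pi" using jacobi_am_unique[OF k D, of pi] ell_F_pi[OF k(1) True] by (simp add: L_def)
    have b: "- L < \<beta>" "\<beta> \<le> L" using \<beta> unfolding K2 by auto
    have a: "- pi < ?a" "?a \<le> pi" "?a < pi \<longleftrightarrow> \<beta> < L"
      using jacobi_am_less_iff[OF k, of "-L" \<beta>] jacobi_am_less_iff[OF k, of L \<beta>] jacobi_am_less_iff[OF k, of \<beta> L] b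
      by (auto simp: jacobi_am_minus[OF k] amL)
    have "sin ?a > 0 \<longleftrightarrow> 0 < ?a \<and> ?a < pi"
    proof
      assume s: "sin ?a > 0"
      show "0 < ?a \<and> ?a < pi"
      proof (rule ccontr)
        assume "\<not> ?thesis"
        then have "?a \<le> 0 \<or> ?a = pi" using a by linarith
        then show False using s a sin_ge_zero[of "- ?a"] by auto
      qed
    qed (simp add: sin_gt_zero)
    then show ?thesis using pos a unfolding K2 by (simp add: jacobi_sn_def)
  next
    case False
    then have k1: "k = 1" using k by simp
    have a: "- pi/2 < ?a" "?a < pi/2" using jacobi_am(1)[OF k, of \<beta>] by (auto simp: ell_dom_def k1)
    have "sin ?a > 0 \<longleftrightarrow> 0 < ?a"
      using a sin_gt_zero[of ?a] sin_ge_zero[of "- ?a"] pi_gt_zero by (cases "0 < ?a") auto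
    then show ?thesis using pos by (simp add: jacobi_sn_def k1 ell_K_1)
  qed
qed

lemma addition_denominator_pos:
  assumes k: "0 \<le> k" "k \<le> 1"
  shows "0 < 1 - k\<^sup>2 * (jacobi_sn k u)\<^sup>2 * (jacobi_sn k v)\<^sup>2"
proof -
  have "(jacobi_dn k u)\<^sup>2 > 0" using jacobi_dn_pos[OF k, of u] by simp
  then have "k\<^sup>2 * (jacobi_sn k u)\<^sup>2 < 1" using jacobi_identities(2)[OF k, of u] by simp
  moreover have "(jacobi_sn k v)\<^sup>2 \<le> 1" by (simp add: jacobi_sn_def abs_square_le_1)
  moreover have "k\<^sup>2 * (jacobi_sn k u)\<^sup>2 * (jacobi_sn k v)\<^sup>2 \<le> k\<^sup>2 * (jacobi_sn k u)\<^sup>2 * 1"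
    by (intro mult_left_mono calculation) auto
  ultimately show ?thesis by linarith
qed

lemma quotient_deriv_zero:
  fixes N M :: "real \<Rightarrow> real"
  assumes "(N has_real_derivative n) (at t)" "(M has_real_derivative m) (at t)" "M t \<noteq> 0" "n * M t = N t * m"
  shows "((\<lambda>t. N t / M t) has_real_derivative 0) (at t)"
  using DERIV_divide[OF assms(1,2,3)] assms(4) by simp

text \<open>With \<open>u + v = w\<close> fixed, the right-hand sides are functions of \<open>u\<close> with derivative zero; at \<open>u = 0\<close>
  they have the values at \<open>w\<close>.\<close>

lemma jacobi_addition:
  assumes k: "0 \<le> k" "k \<le> 1"
  defines "\<Delta> u v \<equiv> 1 - k\<^sup>2 * (jacobi_sn k u)\<^sup>2 * (jacobi_sn k v)\<^sup>2"
  shows "jacobi_sn k (u + v) = (jacobi_sn k u * jacobi_cn k v * jacobi_dn k v + jacobi_sn k v * jacobi_cn k u * jacobi_dn k u) / \<Delta> u v"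
    and "jacobi_cn k (u + v) = (jacobi_cn k u * jacobi_cn k v - jacobi_sn k u * jacobi_sn k v * jacobi_dn k u * jacobi_dn k v) / \<Delta> u v"
    and "jacobi_dn k (u + v) = (jacobi_dn k u * jacobi_dn k v - k\<^sup>2 * jacobi_sn k u * jacobi_sn k v * jacobi_cn k u * jacobi_cn k v) / \<Delta> u v"
proof -
  define w where "w = u + v"
  define s c d where "s = jacobi_sn k" and "c = jacobi_cn k" and "d = jacobi_dn k"
  define M where "M t = 1 - k\<^sup>2 * (s t)\<^sup>2 * (s (w - t))\<^sup>2" for t
  have M0: "M t \<noteq> 0" for t using addition_denominator_pos[OF k, of t "w - t"] by (simp add: M_def s_def)
  have rel: "(c t)\<^sup>2 = 1 - (s t)\<^sup>2" "(d t)\<^sup>2 = 1 - k\<^sup>2 * (s t)\<^sup>2" for t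
    using jacobi_identities[OF k] by (auto simp: s_def c_def d_def)
  have D: "(s has_real_derivative c t * d t) (at t)" "(c has_real_derivative - (s t * d t)) (at t)"
    "(d has_real_derivative - (k\<^sup>2 * s t * c t)) (at t)" for t
    using jacobi_derivs[OF k] by (auto simp: s_def c_def d_def)
  have lin: "((\<lambda>t. w - t) has_real_derivative - 1) (at t)" for t by (auto intro!: derivative_eq_intros)
  have D': "((\<lambda>t. s (w - t)) has_real_derivative - (c (w - t) * d (w - t))) (at t)"
    "((\<lambda>t. c (w - t)) has_real_derivative s (w - t) * d (w - t)) (at t)"
    "((\<lambda>t. d (w - t)) has_real_derivative k\<^sup>2 * s (w - t) * c (w - t)) (at t)" for t
    using DERIV_chain2[OF D(1) lin, of t] DERIV_chain2[OF D(2) lin, of t] DERIV_chain2[OF D(3) lin, of t] by auto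
  \<comment> \<open>The derivative of the common denominator, used for all three quotients.\<close>
  have M': "(M has_real_derivative - 2 * k\<^sup>2 * s t * s (w - t) * (s (w - t) * c t * d t - s t * c (w - t) * d (w - t))) (at t)" for t
    unfolding M_def[abs_def] by (auto intro!: derivative_eq_intros D D' simp: power2_eq_square algebra_simps)
  have S: "((\<lambda>t. (s t * c (w - t) * d (w - t) + s (w - t) * c t * d t) / M t) has_real_derivative 0) (at t)" for t
  proof (rule quotient_deriv_zero[OF _ M' M0])
    show "((\<lambda>t. s t * c (w - t) * d (w - t) + s (w - t) * c t * d t) has_real_derivative
      s t * s (w - t) * ((d (w - t))\<^sup>2 + k\<^sup>2 * (c (w - t))\<^sup>2 - (d t)\<^sup>2 - k\<^sup>2 * (c t)\<^sup>2)) (at t)"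
      by (auto intro!: derivative_eq_intros D D' simp: power2_eq_square algebra_simps)
    show "s t * s (w - t) * ((d (w - t))\<^sup>2 + k\<^sup>2 * (c (w - t))\<^sup>2 - (d t)\<^sup>2 - k\<^sup>2 * (c t)\<^sup>2) * M t =
      (s t * c (w - t) * d (w - t) + s (w - t) * c t * d t) * (- 2 * k\<^sup>2 * s t * s (w - t) * (s (w - t) * c t * d t - s t * c (w - t) * d (w - t)))"
      unfolding M_def using rel[of t] rel[of "w - t"] by algebra
  qed
  have C: "((\<lambda>t. (c t * c (w - t) - s t * s (w - t) * d t * d (w - t)) / M t) has_real_derivative 0) (at t)" for t
  proof (rule quotient_deriv_zero[OF _ M' M0])
    let ?n = "- (s t * d t * c (w - t)) + c t * (s (w - t) * d (w - t)) - c t * d t * s (w - t) * d t * d (w - t)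
      + s t * (c (w - t) * d (w - t)) * d t * d (w - t) + s t * s (w - t) * (k\<^sup>2 * s t * c t) * d (w - t)
      - s t * s (w - t) * d t * (k\<^sup>2 * s (w - t) * c (w - t))"
    show "((\<lambda>t. c t * c (w - t) - s t * s (w - t) * d t * d (w - t)) has_real_derivative ?n) (at t)"
      by (auto intro!: derivative_eq_intros D D' simp: algebra_simps)
    show "?n * M t = (c t * c (w - t) - s t * s (w - t) * d t * d (w - t)) * (- 2 * k\<^sup>2 * s t * s (w - t) * (s (w - t) * c t * d t - s t * c (w - t) * d (w - t)))"
      unfolding M_def using rel[of t] rel[of "w - t"] by algebra
  qed
  have Dd: "((\<lambda>t. (d t * d (w - t) - k\<^sup>2 * s t * s (w - t) * c t * c (w - t)) / M t) has_real_derivative 0) (at t)" for t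
  proof (rule quotient_deriv_zero[OF _ M' M0])
    let ?n = "- (k\<^sup>2 * s t * c t * d (w - t)) + d t * (k\<^sup>2 * s (w - t) * c (w - t)) - k\<^sup>2 * (c t * d t * s (w - t) * c t * c (w - t)
      - s t * (c (w - t) * d (w - t)) * c t * c (w - t) - s t * s (w - t) * (s t * d t) * c (w - t)
      + s t * s (w - t) * c t * (s (w - t) * d (w - t)))"
    show "((\<lambda>t. d t * d (w - t) - k\<^sup>2 * s t * s (w - t) * c t * c (w - t)) has_real_derivative ?n) (at t)"
      by (auto intro!: derivative_eq_intros D D' simp: algebra_simps)
    show "?n * M t = (d t * d (w - t) - k\<^sup>2 * s t * s (w - t) * c t * c (w - t)) * (- 2 * k\<^sup>2 * s t * s (w - t) * (s (w - t) * c t * d t - s t * c (w - t) * d (w - t)))"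
      unfolding M_def using rel[of t] rel[of "w - t"] by algebra
  qed
  have z: "s 0 = 0" "c 0 = 1" "d 0 = 1" using jacobi_at_0[OF k] by (auto simp: s_def c_def d_def)
  have const: "f u = f 0" if "\<And>t. (f has_real_derivative 0) (at t)" for f :: "real \<Rightarrow> real"
    using DERIV_isconst_all that by blast
  have wu: "w - u = v" by (simp add: w_def)
  show "jacobi_sn k (u + v) = (jacobi_sn k u * jacobi_cn k v * jacobi_dn k v + jacobi_sn k v * jacobi_cn k u * jacobi_dn k u) / \<Delta> u v"
    using const[OF S] z wu by (simp add: M_def \<Delta>_def w_def[symmetric]) (simp add: s_def c_def d_def)
  show "jacobi_cn k (u + v) = (jacobi_cn k u * jacobi_cn k v - jacobi_sn k u * jacobi_sn k v * jacobi_dn k u * jacobi_dn k v) / \<Delta> u v"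
    using const[OF C] z wu by (simp add: M_def \<Delta>_def w_def[symmetric]) (simp add: s_def c_def d_def)
  show "jacobi_dn k (u + v) = (jacobi_dn k u * jacobi_dn k v - k\<^sup>2 * jacobi_sn k u * jacobi_sn k v * jacobi_cn k u * jacobi_cn k v) / \<Delta> u v"
    using const[OF Dd] z wu by (simp add: M_def \<Delta>_def w_def[symmetric]) (simp add: s_def c_def d_def)
qed

section \<open>The function g\<close>

lemma ell_K'_eq:
  assumes q: "0 < q" "q \<le> 1"
  shows "ell_K' q = ell_F (sqrt (1 - q\<^sup>2)) (pi/2)" "0 < ell_K' q"
    and "0 \<le> sqrt (1 - q\<^sup>2)" "sqrt (1 - q\<^sup>2) < 1" "(sqrt (1 - q\<^sup>2))\<^sup>2 = 1 - q\<^sup>2"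
proof -
  have q2: "q\<^sup>2 \<le> 1" using q by (simp add: power_le_one)
  show a: "0 \<le> sqrt (1 - q\<^sup>2)" "sqrt (1 - q\<^sup>2) < 1" "(sqrt (1 - q\<^sup>2))\<^sup>2 = 1 - q\<^sup>2"
    using q q2 by auto
  show b: "ell_K' q = ell_F (sqrt (1 - q\<^sup>2)) (pi/2)"
    using ell_K_less_1[OF a(1,2)] by (simp add: ell_K'_def)
  show "0 < ell_K' q"
    unfolding b using ell_F_strict_mono[of "sqrt (1 - q\<^sup>2)" 0 "pi/2"] a by (simp add: ell_F_0 ell_dom_def)
qed

lemma jacobi_cn_pos_strip:
  assumes q: "0 < q" "q \<le> 1" and y: "\<bar>y\<bar> < ell_K' q"
  shows "0 < jacobi_cn (sqrt (1 - q\<^sup>2)) y"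
proof -
  let ?k = "sqrt (1 - q\<^sup>2)"
  have k: "0 \<le> ?k" "?k \<le> 1" using ell_K'_eq[OF q] by auto
  have am: "jacobi_am ?k (ell_K' q) = pi/2"
    using jacobi_am_unique[OF k, of "pi/2"] ell_K'_eq[OF q] by (simp add: ell_dom_def)
  have "jacobi_am ?k y < pi/2" "- (pi/2) < jacobi_am ?k y"
    using y jacobi_am_less_iff[OF k, of y "ell_K' q"] jacobi_am_less_iff[OF k, of "- ell_K' q" y]
    by (auto simp: jacobi_am_minus[OF k] am)
  then show ?thesis unfolding jacobi_cn_def by (intro cos_gt_zero_pi) auto
qed

text \<open>From \<open>cn K' = 0\<close> the duplication formula for \<open>cn\<close> gives a quadratic equation for \<open>sn\<^sup>2\<close> at
  \<open>K'/2\<close>, with factors \<open>(1 - q) * sn\<^sup>2 - 1\<close> and \<open>(1 + q) * sn\<^sup>2 - 1\<close>, the first of which is negative.\<close>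

lemma jacobi_half_K':
  assumes q: "0 < q" "q \<le> 1"
  defines "k \<equiv> sqrt (1 - q\<^sup>2)" and "h \<equiv> ell_K' q / 2"
  shows "(jacobi_sn k h)\<^sup>2 = 1 / (1 + q)" "jacobi_cn k h = jacobi_sn k h * jacobi_dn k h"
proof -
  have k: "0 \<le> k" "k \<le> 1" "k\<^sup>2 = 1 - q\<^sup>2" using ell_K'_eq[OF q] by (auto simp: k_def)
  have h: "0 < h" "\<bar>h\<bar> < ell_K' q" using ell_K'_eq[OF q] by (auto simp: h_def)
  have am: "jacobi_am k (h + h) = pi/2"
    using jacobi_am_unique[OF k(1,2), of "pi/2"] ell_K'_eq[OF q] by (simp add: ell_dom_def k_def h_def)
  have s: "0 < jacobi_sn k h"
  proof -
    have "0 < jacobi_am k h" "jacobi_am k h < pi/2"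
      using jacobi_am_less_iff[OF k(1,2), of 0 h] jacobi_am_less_iff[OF k(1,2), of h "h+h", unfolded am] h
      by (auto simp: jacobi_am_0[OF k(1,2)])
    then show ?thesis unfolding jacobi_sn_def by (intro sin_gt_zero) auto
  qed
  have c: "0 < jacobi_cn k h" unfolding k_def by (rule jacobi_cn_pos_strip[OF q h(2)])
  have d: "0 < jacobi_dn k h" by (rule jacobi_dn_pos[OF k(1,2)])
  have rel: "(jacobi_cn k h)\<^sup>2 = 1 - (jacobi_sn k h)\<^sup>2" "(jacobi_dn k h)\<^sup>2 = 1 - (1 - q\<^sup>2) * (jacobi_sn k h)\<^sup>2"
    using jacobi_identities[OF k(1,2)] k(3) by auto
  have "jacobi_cn k (h + h) = 0" by (simp only: am jacobi_cn_def cos_pi_half)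
  then have e: "(jacobi_cn k h)\<^sup>2 = (jacobi_sn k h * jacobi_dn k h)\<^sup>2"
    using jacobi_addition(2)[OF k(1,2), of h h] addition_denominator_pos[OF k(1,2), of h h]
    by (simp add: power2_eq_square algebra_simps)
  then show "jacobi_cn k h = jacobi_sn k h * jacobi_dn k h"
    by (rule power2_eq_imp_eq) (use s c d in auto)
  have "((1 - q) * (jacobi_sn k h)\<^sup>2 - 1) * ((1 + q) * (jacobi_sn k h)\<^sup>2 - 1) = 0"
    using e rel by (simp add: power_mult_distrib) algebra
  moreover have "(1 - q) * (jacobi_sn k h)\<^sup>2 - 1 < 0"
  proof -
    have "(jacobi_cn k h)\<^sup>2 > 0" using c by simp
    then have "(jacobi_sn k h)\<^sup>2 < 1" using rel by simp
    moreover have "(1 - q) * (jacobi_sn k h)\<^sup>2 \<le> 1 * (jacobi_sn k h)\<^sup>2"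
      using q by (intro mult_right_mono) auto
    ultimately show ?thesis by linarith
  qed
  ultimately have "(1 + q) * (jacobi_sn k h)\<^sup>2 - 1 = 0" by (metis less_irrefl mult_eq_0_iff)
  then have "(jacobi_sn k h)\<^sup>2 * (1 + q) = 1" by (simp add: mult.commute)
  then show "(jacobi_sn k h)\<^sup>2 = 1 / (1 + q)" using q by (simp add: eq_divide_eq)
qed

text \<open>The addition theorem for \<open>sn (x + \<i> * y)\<close> together with Jacobi's imaginary transformation, which
  expresses the values at \<open>\<i> * y\<close> by functions of \<open>y\<close> of the complementary modulus.\<close>

definition sn_strip :: "real \<Rightarrow> complex \<Rightarrow> complex" where
  "sn_strip q z =
     (let k = sqrt (1 - q\<^sup>2); x = Re z; y = Im z in
      Complex (jacobi_sn q x * jacobi_dn k y)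
              (jacobi_cn q x * jacobi_dn q x * jacobi_sn k y * jacobi_cn k y) /
      of_real (1 - (jacobi_sn k y)\<^sup>2 * (jacobi_dn q x)\<^sup>2))"

lemma sn_strip_denominator_pos:
  assumes q: "0 < q" "q \<le> 1" and y: "\<bar>y\<bar> < ell_K' q"
  shows "0 < 1 - (jacobi_sn (sqrt (1 - q\<^sup>2)) y)\<^sup>2 * (jacobi_dn q x)\<^sup>2"
proof -
  let ?k = "sqrt (1 - q\<^sup>2)"
  have k: "0 \<le> ?k" "?k \<le> 1" using ell_K'_eq[OF q] by auto
  have "(jacobi_cn ?k y)\<^sup>2 > 0" using jacobi_cn_pos_strip[OF q y] by simp
  then have "(jacobi_sn ?k y)\<^sup>2 < 1" using jacobi_identities(1)[OF k, of y] by simp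
  moreover have "(jacobi_sn ?k y)\<^sup>2 * (jacobi_dn q x)\<^sup>2 \<le> (jacobi_sn ?k y)\<^sup>2 * 1"
    using jacobi_identities(2)[of q x] q by (intro mult_left_mono) auto
  ultimately show ?thesis by linarith
qed

text \<open>The Cauchy-Riemann equations for a quotient \<open>N / D\<close>, where \<open>a\<close>, \<open>b\<close> and \<open>e\<close>, \<open>g\<close> are the partial
  derivatives of \<open>N\<close> and \<open>D\<close> in the real and the imaginary direction.\<close>

lemma quotient_CR:
  fixes N D :: "complex \<Rightarrow> complex"
  assumes "(N has_derivative (\<lambda>h. a * of_real (Re h) + b * of_real (Im h))) (at z)"
    and "(D has_derivative (\<lambda>h. e * of_real (Re h) + g * of_real (Im h))) (at z)"
    and "D z \<noteq> 0" and "b * D z - N z * g = \<i> * (a * D z - N z * e)"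
  shows "((\<lambda>z. N z / D z) has_field_derivative (a * D z - N z * e) / (D z * D z)) (at z)"
proof -
  have "((\<lambda>z. N z / D z) has_derivative
      (\<lambda>h. ((a * of_real (Re h) + b * of_real (Im h)) * D z - N z * (e * of_real (Re h) + g * of_real (Im h))) / (D z * D z))) (at z)"
    using has_derivative_divide'[OF assms(1,2,3)] .
  moreover have "((a * of_real (Re h) + b * of_real (Im h)) * D z - N z * (e * of_real (Re h) + g * of_real (Im h))) / (D z * D z)
      = (a * D z - N z * e) / (D z * D z) * h" for h
  proof -
    have "(a * of_real (Re h) + b * of_real (Im h)) * D z - N z * (e * of_real (Re h) + g * of_real (Im h))
      = (a * D z - N z * e) * of_real (Re h) + (b * D z - N z * g) * of_real (Im h)"
      by (simp add: algebra_simps)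
    also have "\<dots> = (a * D z - N z * e) * (of_real (Re h) + \<i> * of_real (Im h))"
      unfolding assms(4) by (simp add: algebra_simps)
    also have "\<dots> = (a * D z - N z * e) * h"
      using complex_eq[of h] by simp
    finally show ?thesis by simp
  qed
  ultimately show ?thesis
    unfolding has_field_derivative_def by (rule has_derivative_eq_rhs[OF _ ext])
qed

text \<open>Real and imaginary part of the last hypothesis of \<open>quotient_CR\<close>.\<close>

lemma CR_complex:
  fixes a a' b b' m n n' e g :: real
  assumes "b * m - n * g = - (a' * m - n' * e)" and "b' * m - n' * g = a * m - n * e"
  shows "(of_real b + \<i> * of_real b') * of_real m - (of_real n + \<i> * of_real n') * of_real g
    = \<i> * ((of_real a + \<i> * of_real a') * of_real m - (of_real n + \<i> * of_real n') * of_real e)"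
  using assms by (simp add: complex_eq_iff)

lemma sn_strip_differentiable:
  assumes q: "0 < q" "q \<le> 1" and z: "\<bar>Im z\<bar> < ell_K' q"
  shows "sn_strip q field_differentiable (at z)"
proof -
  define k where "k = sqrt (1 - q\<^sup>2)"
  have k: "0 \<le> k" "k \<le> 1" "k\<^sup>2 = 1 - q\<^sup>2" using ell_K'_eq[OF q] by (auto simp: k_def)
  have q': "0 \<le> q" "q \<le> 1" using q by auto
  define s c d where "s = jacobi_sn q (Re z)" and "c = jacobi_cn q (Re z)" and "d = jacobi_dn q (Re z)"
  define s1 c1 d1 where "s1 = jacobi_sn k (Im z)" and "c1 = jacobi_cn k (Im z)" and "d1 = jacobi_dn k (Im z)"
  have rel: "c\<^sup>2 = 1 - s\<^sup>2" "d\<^sup>2 = 1 - q\<^sup>2 * s\<^sup>2" "c1\<^sup>2 = 1 - s1\<^sup>2" "d1\<^sup>2 = 1 - (1 - q\<^sup>2) * s1\<^sup>2"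
    using jacobi_identities[OF q', of "Re z"] jacobi_identities[OF k(1,2), of "Im z"] k(3)
    by (auto simp: s_def c_def d_def s1_def c1_def d1_def)
  have re: "(f \<circ> Re has_derivative (\<lambda>h. f' * Re h)) (at z)" if "(f has_real_derivative f') (at (Re z))" for f f'
    unfolding o_def using has_derivative_compose[OF has_derivative_Re[OF has_derivative_ident] that[unfolded has_field_derivative_def], of UNIV]
    by simp
  have im: "(f \<circ> Im has_derivative (\<lambda>h. f' * Im h)) (at z)" if "(f has_real_derivative f') (at (Im z))" for f f'
    unfolding o_def using has_derivative_compose[OF has_derivative_Im[OF has_derivative_ident] that[unfolded has_field_derivative_def], of UNIV]
    by simp
  note DR = jacobi_derivs[OF q', of "Re z", folded s_def c_def d_def]
  note DI = jacobi_derivs[OF k(1,2), of "Im z", folded s1_def c1_def d1_def, unfolded k(3)]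
  note D = re[OF DR(1), unfolded o_def] re[OF DR(2), unfolded o_def] re[OF DR(3), unfolded o_def]
     im[OF DI(1), unfolded o_def] im[OF DI(2), unfolded o_def] im[OF DI(3), unfolded o_def]
  define N1 where "N1 w = jacobi_sn q (Re w) * jacobi_dn k (Im w)" for w
  define N2 where "N2 w = jacobi_cn q (Re w) * jacobi_dn q (Re w) * jacobi_sn k (Im w) * jacobi_cn k (Im w)" for w
  define M where "M w = 1 - (jacobi_sn k (Im w))\<^sup>2 * (jacobi_dn q (Re w))\<^sup>2" for w
  have N1: "(N1 has_derivative (\<lambda>h. (c * d * d1) * Re h + (- s * ((1 - q\<^sup>2) * s1 * c1)) * Im h)) (at z)"
    unfolding N1_def[abs_def]
    by (auto intro!: derivative_eq_intros D simp: s_def c_def d_def s1_def c1_def d1_def algebra_simps)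
  have N2: "(N2 has_derivative (\<lambda>h. (- s * s1 * c1 * (d\<^sup>2 + q\<^sup>2 * c\<^sup>2)) * Re h + (c * d * d1 * (c1\<^sup>2 - s1\<^sup>2)) * Im h)) (at z)"
    unfolding N2_def[abs_def]
    by (auto intro!: derivative_eq_intros D simp: s_def c_def d_def s1_def c1_def d1_def algebra_simps power2_eq_square)
  have M: "(M has_derivative (\<lambda>h. (2 * q\<^sup>2 * s1\<^sup>2 * s * c * d) * Re h + (- 2 * s1 * c1 * d1 * d\<^sup>2) * Im h)) (at z)"
    unfolding M_def[abs_def]
    by (auto intro!: derivative_eq_intros D simp: s_def c_def d_def s1_def c1_def d1_def algebra_simps power2_eq_square)
  have cx: "((\<lambda>w. of_real (f w) :: complex) has_derivative (\<lambda>h. of_real (f' h))) (at z)" if "(f has_derivative f') (at z)" for f f'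
    using bounded_linear.has_derivative[OF bounded_linear_of_real that] .
  let ?a = "of_real (c * d * d1) + \<i> * of_real (- s * s1 * c1 * (d\<^sup>2 + q\<^sup>2 * c\<^sup>2)) :: complex"
  let ?b = "of_real (- s * ((1 - q\<^sup>2) * s1 * c1)) + \<i> * of_real (c * d * d1 * (c1\<^sup>2 - s1\<^sup>2)) :: complex"
  have N: "((\<lambda>w. of_real (N1 w) + \<i> * of_real (N2 w)) has_derivative (\<lambda>h. ?a * of_real (Re h) + ?b * of_real (Im h))) (at z)"
    by (rule has_derivative_eq_rhs, (rule has_derivative_add has_derivative_mult_right cx N1 N2)+)
       (auto simp: algebra_simps)
  have M': "((\<lambda>w. of_real (M w) :: complex) has_derivative (\<lambda>h. of_real (2 * q\<^sup>2 * s1\<^sup>2 * s * c * d) * of_real (Re h) + of_real (- 2 * s1 * c1 * d1 * d\<^sup>2) * of_real (Im h))) (at z)"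
    by (rule has_derivative_eq_rhs, rule cx[OF M]) (auto simp: algebra_simps)
  have Mz: "M z = 1 - s1\<^sup>2 * d\<^sup>2" "N1 z = s * d1" "N2 z = c * d * s1 * c1"
    by (simp_all add: M_def N1_def N2_def s1_def c1_def d1_def s_def c_def d_def)
  have "((\<lambda>w. (of_real (N1 w) + \<i> * of_real (N2 w)) / of_real (M w)) has_field_derivative
     (?a * of_real (M z) - (of_real (N1 z) + \<i> * of_real (N2 z)) * of_real (2 * q\<^sup>2 * s1\<^sup>2 * s * c * d)) / (of_real (M z) * of_real (M z))) (at z)"
  proof (rule quotient_CR[OF N M'])
    have "M z \<noteq> 0"
      using sn_strip_denominator_pos[OF q z, of "Re z"] by (simp add: M_def k_def)
    then show "complex_of_real (M z) \<noteq> 0" by (simp only: of_real_eq_0_iff not_False_eq_True)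
    have i: "(- s * ((1 - q\<^sup>2) * s1 * c1)) * M z - N1 z * (- 2 * s1 * c1 * d1 * d\<^sup>2)
       = - ((- s * s1 * c1 * (d\<^sup>2 + q\<^sup>2 * c\<^sup>2)) * M z - N2 z * (2 * q\<^sup>2 * s1\<^sup>2 * s * c * d))"
      unfolding Mz using rel by algebra
    have ii: "(c * d * d1 * (c1\<^sup>2 - s1\<^sup>2)) * M z - N2 z * (- 2 * s1 * c1 * d1 * d\<^sup>2)
       = (c * d * d1) * M z - N1 z * (2 * q\<^sup>2 * s1\<^sup>2 * s * c * d)"
      unfolding Mz using rel by algebra
    show "?b * of_real (M z) - (of_real (N1 z) + \<i> * of_real (N2 z)) * of_real (- 2 * s1 * c1 * d1 * d\<^sup>2)
      = \<i> * (?a * of_real (M z) - (of_real (N1 z) + \<i> * of_real (N2 z)) * of_real (2 * q\<^sup>2 * s1\<^sup>2 * s * c * d))"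
      by (rule CR_complex[OF i ii])
  qed
  then have "\<exists>f'. ((\<lambda>w. (of_real (N1 w) + \<i> * of_real (N2 w)) / of_real (M w)) has_field_derivative f') (at z)"
    by blast
  moreover have eq: "sn_strip q w = (of_real (N1 w) + \<i> * of_real (N2 w)) / of_real (M w)" for w
    by (simp add: sn_strip_def Let_def N1_def N2_def M_def k_def Complex_eq)
  ultimately show ?thesis
    unfolding field_differentiable_def eq[abs_def] by simp
qed

text \<open>The function \<open>sn_strip\<close> extends the real \<open>sn\<close> to the strip, and holomorphic functions on the strip that
  agree on the real axis are equal.\<close>

lemma jacobi_sn_complex_eq:
  assumes q: "0 < q" "q \<le> 1" and z: "\<bar>Im z\<bar> < ell_K' q"
  shows "jacobi_sn_complex q z = sn_strip q z"
proof -
  define S where "S = {z. \<bar>Im z\<bar> < ell_K' q}"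
  define f0 where "f0 z = (if \<bar>Im z\<bar> < ell_K' q then sn_strip q z else 0)" for z
  have S_eq: "S = {z. Im z < ell_K' q} \<inter> {z. - ell_K' q < Im z}" by (auto simp: S_def)
  have opS: "open S" unfolding S_eq
    by (intro open_Int open_Collect_less continuous_intros)
  have conS: "connected S" unfolding S_eq
    by (intro convex_connected convex_Int convex_halfspace_Im_lt convex_halfspace_Im_gt)
  have hol: "f0 holomorphic_on S"
  proof -
    have "sn_strip q holomorphic_on S"
      unfolding holomorphic_on_def S_def using sn_strip_differentiable[OF q]
      by (auto intro: field_differentiable_at_within)
    then show ?thesis by (rule holomorphic_transform) (auto simp: f0_def S_def)
  qed
  have K: "0 < ell_K' q" using ell_K'_eq[OF q] by simp
  have real: "f0 (of_real x) = of_real (jacobi_sn q x)" for x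
    using K jacobi_at_0[of "sqrt (1 - q\<^sup>2)"] ell_K'_eq[OF q]
    by (auto simp: f0_def sn_strip_def Let_def complex_eq_iff)
  have "jacobi_sn_complex q = f0"
    unfolding jacobi_sn_complex_def S_def[symmetric]
  proof (rule the_equality)
    show "f0 holomorphic_on S \<and> (\<forall>x. f0 (of_real x) = of_real (jacobi_sn q x)) \<and> (\<forall>z. ell_K' q \<le> \<bar>Im z\<bar> \<longrightarrow> f0 z = 0)"
      using hol real by (auto simp: f0_def)
  next
    fix f assume f: "f holomorphic_on S \<and> (\<forall>x. f (of_real x) = of_real (jacobi_sn q x)) \<and> (\<forall>z. ell_K' q \<le> \<bar>Im z\<bar> \<longrightarrow> f z = 0)"
    have lim: "(0::complex) islimpt \<real>"
      unfolding islimpt_approachable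
    proof (intro allI impI)
      fix e :: real assume "0 < e"
      then show "\<exists>x'\<in>\<real>. x' \<noteq> (0::complex) \<and> dist x' 0 < e"
        by (intro bexI[of _ "of_real (e/2)"]) auto
    qed
    show "f = f0"
    proof
      fix w
      show "f w = f0 w"
      proof (cases "w \<in> S")
        case True
        have "f w - f0 w = 0"
        proof (rule analytic_continuation[where f = "\<lambda>z. f z - f0 z" and S = S and U = "\<real>" and \<xi> = 0])
          show "\<real> \<subseteq> S" using K by (auto simp: S_def Reals_def)
        qed (use f hol real K True opS conS lim in \<open>auto intro!: holomorphic_intros simp: S_def Reals_def\<close>)
        then show ?thesis by simp
      qed (use f in \<open>auto simp: f0_def S_def\<close>)
    qed
  qed
  then show ?thesis using z by (simp add: f0_def)
qed

text \<open>The closed form of \<open>ring_g\<close>. In terms of the ring uniformized by \<open>x\<close> it is \<open>(pi - r - R) / 2\<close>,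
  as long as \<open>\<bar>am x\<bar> \<le> pi/2\<close>.\<close>

definition ring_angle :: "real \<Rightarrow> real \<Rightarrow> real" where
  "ring_angle q x = (jacobi_am q x + arcsin (q * jacobi_sn q x)) / 2"

lemma ring_angle_deriv:
  assumes q: "0 < q" "q \<le> 1"
  shows "(ring_angle q has_real_derivative (jacobi_dn q x + q * jacobi_cn q x) / 2) (at x)"
proof -
  have q': "0 \<le> q" "q \<le> 1" using q by auto
  have d: "0 < jacobi_dn q x" by (rule jacobi_dn_pos[OF q'])
  have e: "sqrt (1 - (q * jacobi_sn q x)\<^sup>2) = jacobi_dn q x"
    by (simp add: jacobi_dn_def power_mult_distrib)
  then have "(q * jacobi_sn q x)\<^sup>2 < 1" using d by (metis diff_gt_0_iff_gt real_sqrt_gt_0_iff)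
  then have "\<bar>q * jacobi_sn q x\<bar> < 1" by (simp only: abs_square_less_1)
  then have "((\<lambda>x. arcsin (q * jacobi_sn q x)) has_real_derivative inverse (jacobi_dn q x) * (q * (jacobi_cn q x * jacobi_dn q x))) (at x)"
    unfolding e[symmetric]
    by (intro DERIV_chain2[where f=arcsin] DERIV_arcsin DERIV_cmult jacobi_derivs[OF q', unfolded jacobi_dn_def, folded e]) 
       (auto simp: e intro!: jacobi_derivs[OF q'])
  moreover have "inverse (jacobi_dn q x) * (q * (jacobi_cn q x * jacobi_dn q x)) = q * jacobi_cn q x"
    using d by simp
  ultimately have "((\<lambda>x. arcsin (q * jacobi_sn q x)) has_real_derivative q * jacobi_cn q x) (at x)"
    by simp
  from DERIV_cdivide[OF DERIV_add[OF jacobi_am_deriv[OF q', of x] this], of 2]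
  show ?thesis by (simp add: ring_angle_def[abs_def])
qed

lemma ring_angle_0: "0 < q \<Longrightarrow> q \<le> 1 \<Longrightarrow> ring_angle q 0 = 0"
  by (simp add: ring_angle_def jacobi_am_0 jacobi_at_0)

lemma ring_angle_minus: "0 < q \<Longrightarrow> q \<le> 1 \<Longrightarrow> ring_angle q (- x) = - ring_angle q x"
proof -
  assume q: "0 < q" "q \<le> 1"
  then have q': "0 \<le> q" "q \<le> 1" by auto
  have "\<bar>q * jacobi_sn q x\<bar> \<le> 1 * 1" unfolding abs_mult jacobi_sn_def using q by (intro mult_mono) auto
  then show ?thesis
    by (simp add: ring_angle_def jacobi_am_minus[OF q'] jacobi_minus[OF q'] arcsin_minus abs_le_iff field_simps)
qed

text \<open>The right-hand sides are, up to a positive factor, imaginary and real part of \<open>sn\<close> at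
  \<open>u + \<i> * K'/2\<close>. Both pairs, \<open>(cos, sin)\<close> and \<open>(A, B)\<close>, rotate with the same angular velocity
  \<open>h = dn (2 * u) + q * cn (2 * u)\<close>, so their inner product and their cross product are constant.\<close>

lemma ring_angle_half:
  assumes q: "0 < q" "q \<le> 1"
  shows "cos (ring_angle q (2 * u)) = jacobi_cn q u * jacobi_dn q u / (1 + q * (jacobi_sn q u)\<^sup>2)"
    and "sin (ring_angle q (2 * u)) = (1 + q) * jacobi_sn q u / (1 + q * (jacobi_sn q u)\<^sup>2)"
proof -
  have q': "0 \<le> q" "q \<le> 1" using q by auto
  define s c d where "s = jacobi_sn q" and "c = jacobi_cn q" and "d = jacobi_dn q"
  have rel: "(c t)\<^sup>2 = 1 - (s t)\<^sup>2" "(d t)\<^sup>2 = 1 - q\<^sup>2 * (s t)\<^sup>2" for t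
    using jacobi_identities[OF q'] by (auto simp: s_def c_def d_def)
  have D: "(s has_real_derivative c t * d t) (at t)" "(c has_real_derivative - (s t * d t)) (at t)"
    "(d has_real_derivative - (q\<^sup>2 * s t * c t)) (at t)" for t
    using jacobi_derivs[OF q'] by (auto simp: s_def c_def d_def)
  have p: "0 < 1 + q * (s t)\<^sup>2" for t using q by (simp add: add_pos_nonneg)
  then have p0: "1 + q * (s t)\<^sup>2 \<noteq> 0" for t by (metis less_irrefl)
  define A B where "A t = c t * d t / (1 + q * (s t)\<^sup>2)" and "B t = (1 + q) * s t / (1 + q * (s t)\<^sup>2)" for t
  define h where "h t = (1 + q) * (1 - q * (s t)\<^sup>2) / (1 + q * (s t)\<^sup>2)" for t
  have h: "h t = d (2 * t) + q * c (2 * t)" for t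
  proof -
    have m: "1 - q * (s t)\<^sup>2 > 0"
    proof (rule ccontr)
      assume "\<not> ?thesis"
      then have "1 \<le> q * (s t)\<^sup>2" by simp
      then have "1 * 1 \<le> (q * (s t)\<^sup>2) * (q * (s t)\<^sup>2)" by (intro mult_mono) auto
      then show False using addition_denominator_pos[OF q', of t t] by (simp add: s_def power2_eq_square algebra_simps)
    qed
    have den: "1 - q\<^sup>2 * (s t)\<^sup>2 * (s t)\<^sup>2 = (1 - q * (s t)\<^sup>2) * (1 + q * (s t)\<^sup>2)" by algebra
    have "d (2 * t) + q * c (2 * t) = (d t * d t - q\<^sup>2 * s t * s t * c t * c t + q * (c t * c t - s t * s t * d t * d t)) / (1 - q\<^sup>2 * (s t)\<^sup>2 * (s t)\<^sup>2)"
      using jacobi_addition(2,3)[OF q', of t t] by (simp add: s_def c_def d_def add_divide_distrib)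
    also have "d t * d t - q\<^sup>2 * s t * s t * c t * c t + q * (c t * c t - s t * s t * d t * d t) = (1 + q) * (1 - q * (s t)\<^sup>2) * (1 - q * (s t)\<^sup>2)"
      using rel[of t] by algebra
    also have "\<dots> / (1 - q\<^sup>2 * (s t)\<^sup>2 * (s t)\<^sup>2) = h t"
      unfolding den h_def using m p[of t] by (simp add: divide_simps)
    finally show ?thesis by simp
  qed
  have A: "(A has_real_derivative - (B t * h t)) (at t)" for t
  proof -
    have "((\<lambda>t. c t * d t) has_real_derivative - (s t * (d t)\<^sup>2) - q\<^sup>2 * s t * (c t)\<^sup>2) (at t)"
      by (auto intro!: derivative_eq_intros D simp: power2_eq_square algebra_simps)
    moreover have P: "((\<lambda>t. 1 + q * (s t)\<^sup>2) has_real_derivative 2 * q * s t * c t * d t) (at t)"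
      by (auto intro!: derivative_eq_intros D simp: power2_eq_square algebra_simps)
    ultimately have "(A has_real_derivative ((- (s t * (d t)\<^sup>2) - q\<^sup>2 * s t * (c t)\<^sup>2) * (1 + q * (s t)\<^sup>2) - c t * d t * (2 * q * s t * c t * d t))
        / ((1 + q * (s t)\<^sup>2) * (1 + q * (s t)\<^sup>2))) (at t)"
      unfolding A_def[abs_def] by (rule DERIV_divide) (rule p0)
    moreover have "(- (s t * (d t)\<^sup>2) - q\<^sup>2 * s t * (c t)\<^sup>2) * (1 + q * (s t)\<^sup>2) - c t * d t * (2 * q * s t * c t * d t)
      = - ((1 + q) * s t) * ((1 + q) * (1 - q * (s t)\<^sup>2))"
      using rel[of t] by algebra
    ultimately show ?thesis by (simp add: B_def h_def)
  qed
  have B: "(B has_real_derivative A t * h t) (at t)" for t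
  proof -
    have "((\<lambda>t. (1 + q) * s t) has_real_derivative (1 + q) * (c t * d t)) (at t)"
      by (auto intro!: derivative_eq_intros D)
    moreover have P: "((\<lambda>t. 1 + q * (s t)\<^sup>2) has_real_derivative 2 * q * s t * c t * d t) (at t)"
      by (auto intro!: derivative_eq_intros D simp: power2_eq_square algebra_simps)
    ultimately have "(B has_real_derivative ((1 + q) * (c t * d t) * (1 + q * (s t)\<^sup>2) - (1 + q) * s t * (2 * q * s t * c t * d t))
        / ((1 + q * (s t)\<^sup>2) * (1 + q * (s t)\<^sup>2))) (at t)"
      unfolding B_def[abs_def] by (rule DERIV_divide) (rule p0)
    moreover have "(1 + q) * (c t * d t) * (1 + q * (s t)\<^sup>2) - (1 + q) * s t * (2 * q * s t * c t * d t)
      = c t * d t * ((1 + q) * (1 - q * (s t)\<^sup>2))"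
      by algebra
    ultimately show ?thesis by (simp add: A_def h_def)
  qed
  have G: "((\<lambda>t. ring_angle q (2 * t)) has_real_derivative h t) (at t)" for t
    using DERIV_chain2[OF ring_angle_deriv[OF q] DERIV_cmult_Id[of 2], of t] by (simp add: h c_def d_def add_divide_distrib)
  let ?\<gamma> = "\<lambda>t. ring_angle q (2 * t)"
  have "((\<lambda>t. A t * cos (?\<gamma> t) + B t * sin (?\<gamma> t)) has_real_derivative 0) (at t)" for t
    by (rule derivative_eq_intros A B G refl | simp add: algebra_simps)+
  then have P: "A u * cos (?\<gamma> u) + B u * sin (?\<gamma> u) = A 0 * cos (?\<gamma> 0) + B 0 * sin (?\<gamma> 0)"
    using DERIV_isconst_all by blast
  have "((\<lambda>t. B t * cos (?\<gamma> t) - A t * sin (?\<gamma> t)) has_real_derivative 0) (at t)" for t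
    by (rule derivative_eq_intros A B G refl | simp add: algebra_simps)+
  then have Q: "B u * cos (?\<gamma> u) - A u * sin (?\<gamma> u) = B 0 * cos (?\<gamma> 0) - A 0 * sin (?\<gamma> 0)"
    using DERIV_isconst_all by blast
  have z: "A 0 = 1" "B 0 = 0" "?\<gamma> 0 = 0"
    using jacobi_at_0[OF q'] ring_angle_0[OF q] by (auto simp: A_def B_def s_def c_def d_def)
  have PQ: "A u * cos (?\<gamma> u) + B u * sin (?\<gamma> u) = 1" "B u * cos (?\<gamma> u) - A u * sin (?\<gamma> u) = 0"
    using P Q by (simp_all add: z(1,2) ring_angle_0[OF q])
  have "cos (?\<gamma> u) = A u" "sin (?\<gamma> u) = B u"
    using PQ sin_cos_squared_add[of "?\<gamma> u"] by algebra+
  then show "cos (ring_angle q (2 * u)) = jacobi_cn q u * jacobi_dn q u / (1 + q * (jacobi_sn q u)\<^sup>2)"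
    "sin (ring_angle q (2 * u)) = (1 + q) * jacobi_sn q u / (1 + q * (jacobi_sn q u)\<^sup>2)"
    by (simp_all add: A_def B_def s_def c_def d_def)
qed

text \<open>By \<open>jacobi_half_K'\<close> and \<open>ring_angle_half\<close>, \<open>pi/2 - ring_angle\<close> is an argument of \<open>sn\<close> along the line.
  Two continuous branches differ by a constant multiple of \<open>2 * pi\<close>.\<close>

lemma ring_g_eq:
  assumes q: "0 < q" "q \<le> 1"
  shows "ring_g q = ring_angle q"
proof -
  have q': "0 \<le> q" "q \<le> 1" using q by auto
  define w where "w x = jacobi_sn_complex q ((complex_of_real x + \<i> * complex_of_real (ell_K' q)) / 2)" for x
  have cont: "continuous_on UNIV (ring_angle q)"
    using ring_angle_deriv[OF q] DERIV_isCont by (blast intro: continuous_at_imp_continuous_on)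
  have polar: "\<exists>\<rho>>0. w x = of_real \<rho> * exp (\<i> * of_real (pi/2 - ring_angle q x))" for x
  proof -
    define k h u where "k = sqrt (1 - q\<^sup>2)" and "h = ell_K' q / 2" and "u = x / 2"
    have k: "0 \<le> k" "k \<le> 1" using ell_K'_eq[OF q] by (auto simp: k_def)
    have h: "\<bar>h\<bar> < ell_K' q" using ell_K'_eq[OF q] by (simp add: h_def)
    have half: "(jacobi_sn k h)\<^sup>2 = 1 / (1 + q)" "jacobi_cn k h = jacobi_sn k h * jacobi_dn k h"
      using jacobi_half_K'[OF q] by (auto simp: k_def h_def)
    let ?D = "1 - (jacobi_sn k h)\<^sup>2 * (jacobi_dn q u)\<^sup>2"
    have D: "0 < ?D" using sn_strip_denominator_pos[OF q h] by (simp add: k_def)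
    have p: "0 < 1 + q * (jacobi_sn q u)\<^sup>2" using q by (simp add: add_pos_nonneg)
    have d1: "0 < jacobi_dn k h" by (rule jacobi_dn_pos[OF k])
    define \<rho> where "\<rho> = jacobi_dn k h / ((1 + q) * ?D) * (1 + q * (jacobi_sn q u)\<^sup>2)"
    have \<rho>: "\<rho> > 0" unfolding \<rho>_def using d1 D p q by (intro mult_pos_pos divide_pos_pos) auto
    have z: "(complex_of_real x + \<i> * complex_of_real (ell_K' q)) / 2 = Complex u h"
      by (simp add: complex_eq_iff u_def h_def)
    have w: "w x = Complex (jacobi_sn q u * jacobi_dn k h) (jacobi_cn q u * jacobi_dn q u * jacobi_sn k h * jacobi_cn k h) / of_real ?D"
      unfolding w_def z using jacobi_sn_complex_eq[OF q, of "Complex u h"] h by (simp add: sn_strip_def Let_def k_def)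
    have sc: "jacobi_sn k h * jacobi_cn k h = jacobi_dn k h / (1 + q)"
      using half by (simp add: power2_eq_square mult.assoc[symmetric])
    have x2: "2 * u = x" by (simp add: u_def)
    have e: "exp (\<i> * of_real (pi/2 - ring_angle q x)) = Complex (sin (ring_angle q x)) (cos (ring_angle q x))"
      by (simp only: cis_conv_exp[symmetric] cis.code) (simp add: sin_diff cos_diff)
    have 1: "\<rho> * sin (ring_angle q x) = jacobi_sn q u * jacobi_dn k h / ?D"
      unfolding ring_angle_half(2)[OF q, of u, unfolded x2] \<rho>_def using p q D by (simp add: divide_simps)
    have 2: "\<rho> * cos (ring_angle q x) = jacobi_cn q u * jacobi_dn q u * jacobi_sn k h * jacobi_cn k h / ?D"
      unfolding ring_angle_half(1)[OF q, of u, unfolded x2] \<rho>_def mult.assoc sc using p q D by (simp add: divide_simps)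
    have "w x = of_real \<rho> * exp (\<i> * of_real (pi/2 - ring_angle q x))"
      unfolding w e using 1 2 by (simp add: complex_eq_iff)
    then show ?thesis using \<rho> by blast
  qed
  have arg: "is_Arg (w x) (pi/2 - ring_angle q x)" and w0: "w x \<noteq> 0" for x
    using polar[of x] by (auto simp: is_Arg_def norm_mult)
  show ?thesis
    unfolding ring_g_def w_def[symmetric]
  proof (rule the_equality)
    show "continuous_on UNIV (ring_angle q) \<and> ring_angle q 0 = 0 \<and> (\<forall>x. is_Arg (w x) (pi/2 - ring_angle q x))"
      using cont ring_angle_0[OF q] arg by blast
  next
    fix g assume g: "continuous_on UNIV g \<and> g 0 = 0 \<and> (\<forall>x. is_Arg (w x) (pi/2 - g x))"
    define h where "h x = (g x - ring_angle q x) / (2 * pi)" for x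
    have int: "h x \<in> \<int>" for x
    proof -
      have "exp (\<i> * of_real (pi/2 - g x)) = exp (\<i> * of_real (pi/2 - ring_angle q x))"
        using g arg[of x] w0[of x] unfolding is_Arg_def by (metis mult_cancel_left mult_eq_0_iff)
      then obtain n :: int where "\<i> * of_real (pi/2 - g x) = \<i> * of_real (pi/2 - ring_angle q x) + (of_int (2 * n) * pi) * \<i>"
        by (auto simp: exp_eq)
      then have "complex_of_real (pi/2 - g x) = complex_of_real (pi/2 - ring_angle q x + of_int (2 * n) * pi)"
        by (simp add: complex_eq_iff)
      then have "pi/2 - g x = pi/2 - ring_angle q x + of_int (2 * n) * pi"
        by (simp only: of_real_eq_iff)
      then have "g x - ring_angle q x = of_int (- n) * (2 * pi)" by simp
      then have "h x = of_int (- n)" by (simp add: h_def)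
      then show ?thesis by simp
    qed
    have "continuous_on UNIV h" unfolding h_def using g cont by (intro continuous_intros) auto
    then have "h constant_on UNIV"
    proof (rule continuous_discrete_range_constant[OF connected_UNIV])
      fix x :: real
      show "\<exists>e>0. \<forall>y. y \<in> UNIV \<and> h y \<noteq> h x \<longrightarrow> e \<le> norm (h y - h x)"
      proof (intro exI[of _ 1] conjI allI impI)
        fix y assume "y \<in> UNIV \<and> h y \<noteq> h x"
        then show "1 \<le> norm (h y - h x)"
          using int[of x] int[of y] by (auto elim!: Ints_cases)
      qed simp
    qed
    moreover have "h 0 = 0" using g ring_angle_0[OF q] by (simp add: h_def)
    ultimately have "h x = 0" for x by (metis UNIV_I constant_on_def)
    then show "g = ring_angle q" by (auto simp: h_def)
  qed
qed

text \<open>As functions of \<open>x\<close> both sides have the derivative \<open>F\<close>: on the left by direct computation, on the right by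
  the addition theorems for \<open>dn\<close> and \<open>cn\<close>. At \<open>x = 0\<close> the left-hand side is
  \<open>pi - arcsin (q * sn y) - am y\<close>, which uses \<open>0 < am y < pi\<close>.\<close>

lemma ring_g_diff:
  assumes q: "0 < q" "q \<le> 1" and y: "jacobi_sn q y > 0" "0 < jacobi_am q y" "jacobi_am q y < pi"
  shows "pi/2 - arctan (q * jacobi_cn q x * jacobi_sn q y / jacobi_dn q y) + arctan (jacobi_cn q y / (jacobi_dn q x * jacobi_sn q y))
     = pi - (ring_g q (x + y) - ring_g q (x - y))"
proof -
  have q': "0 \<le> q" "q \<le> 1" using q by auto
  define s c d where "s = jacobi_sn q" and "c = jacobi_cn q" and "d = jacobi_dn q"
  have rel: "(c t)\<^sup>2 = 1 - (s t)\<^sup>2" "(d t)\<^sup>2 = 1 - q\<^sup>2 * (s t)\<^sup>2" for t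
    using jacobi_identities[OF q'] by (auto simp: s_def c_def d_def)
  have dp: "0 < d t" for t using jacobi_dn_pos[OF q'] by (simp add: d_def)
  have dn: "d t \<noteq> 0" for t using dp[of t] by simp
  have sy: "0 < s y" using y by (simp add: s_def)
  have D: "(s has_real_derivative c t * d t) (at t)" "(c has_real_derivative - (s t * d t)) (at t)"
    "(d has_real_derivative - (q\<^sup>2 * s t * c t)) (at t)" for t
    using jacobi_derivs[OF q'] by (auto simp: s_def c_def d_def)
  define M where "M t = 1 - q\<^sup>2 * (s t)\<^sup>2 * (s y)\<^sup>2" for t
  have M: "0 < M t" for t using addition_denominator_pos[OF q', of t y] by (simp add: M_def s_def)
  define F where "F t = q * s t * s y * (d t * d y + q * c t * c y) / M t" for t
  define L where "L t = pi/2 - arctan (q * c t * s y / d y) + arctan (c y / (d t * s y))" for t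
  define N where "N t = ring_angle q (t - y) - ring_angle q (t + y)" for t
  have L: "(L has_real_derivative F t) (at t)" for t
  proof -
    have 1: "((\<lambda>t. arctan (q * c t * s y / d y)) has_real_derivative
        inverse (1 + (q * c t * s y / d y)\<^sup>2) * (q * (- (s t * d t)) * s y / d y)) (at t)"
      by (rule DERIV_chain2[where f=arctan]) (auto intro!: derivative_eq_intros D simp: dn)
    have 2: "((\<lambda>t. arctan (c y / (d t * s y))) has_real_derivative
        inverse (1 + (c y / (d t * s y))\<^sup>2) * (c y * q\<^sup>2 * s t * c t / ((d t)\<^sup>2 * s y))) (at t)"
      by (rule DERIV_chain2[where f=arctan])
         (use sy in \<open>auto intro!: derivative_eq_intros D simp: dn power2_eq_square field_simps\<close>)
    have a: "inverse (1 + (q * c t * s y / d y)\<^sup>2) = (d y)\<^sup>2 / M t"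
    proof -
      have "(d y)\<^sup>2 + (q * c t * s y)\<^sup>2 = M t" unfolding M_def using rel[of t] rel[of y] by algebra
      then show ?thesis using M[of t] dn[of y] by (simp add: field_simps power_divide)
    qed
    have b: "inverse (1 + (c y / (d t * s y))\<^sup>2) = (d t * s y)\<^sup>2 / M t"
    proof -
      have "(d t * s y)\<^sup>2 + (c y)\<^sup>2 = M t" unfolding M_def using rel[of t] rel[of y] by algebra
      then show ?thesis using M[of t] dn[of t] sy by (simp add: field_simps power_divide)
    qed
    have "(L has_real_derivative 0 - (d y)\<^sup>2 / M t * (q * (- (s t * d t)) * s y / d y) + (d t * s y)\<^sup>2 / M t * (c y * q\<^sup>2 * s t * c t / ((d t)\<^sup>2 * s y))) (at t)"
      unfolding L_def[abs_def] using 1 2 unfolding a b by (intro DERIV_add DERIV_diff DERIV_const)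
    moreover have "0 - (d y)\<^sup>2 / M t * (q * (- (s t * d t)) * s y / d y) + (d t * s y)\<^sup>2 / M t * (c y * q\<^sup>2 * s t * c t / ((d t)\<^sup>2 * s y)) = F t"
      unfolding F_def using sy dn[of y] dn[of t] M[of t] by (simp add: field_simps power2_eq_square)
    ultimately show ?thesis by simp
  qed
  have N: "(N has_real_derivative F t) (at t)" for t
  proof -
    have "(N has_real_derivative (d (t - y) + q * c (t - y)) / 2 * 1 - (d (t + y) + q * c (t + y)) / 2 * 1) (at t)"
      unfolding N_def[abs_def] c_def d_def
      by (intro DERIV_diff DERIV_chain2[OF ring_angle_deriv[OF q]]) (auto intro!: derivative_eq_intros)
    moreover have "d (t - y) = (d t * d y + q\<^sup>2 * s t * s y * c t * c y) / M t" "c (t - y) = (c t * c y + s t * s y * d t * d y) / M t"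
      using jacobi_addition(2,3)[OF q', of t "- y"] by (auto simp: jacobi_minus[OF q'] M_def s_def c_def d_def)
    moreover have "d (t + y) = (d t * d y - q\<^sup>2 * s t * s y * c t * c y) / M t" "c (t + y) = (c t * c y - s t * s y * d t * d y) / M t"
      using jacobi_addition(2,3)[OF q', of t y] by (auto simp: M_def s_def c_def d_def)
    ultimately have "(N has_real_derivative
        ((d t * d y + q\<^sup>2 * s t * s y * c t * c y) / M t + q * ((c t * c y + s t * s y * d t * d y) / M t)) / 2 * 1
      - ((d t * d y - q\<^sup>2 * s t * s y * c t * c y) / M t + q * ((c t * c y - s t * s y * d t * d y) / M t)) / 2 * 1) (at t)"
      by simp
    also have "((d t * d y + q\<^sup>2 * s t * s y * c t * c y) / M t + q * ((c t * c y + s t * s y * d t * d y) / M t)) / 2 * 1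
      - ((d t * d y - q\<^sup>2 * s t * s y * c t * c y) / M t + q * ((c t * c y - s t * s y * d t * d y) / M t)) / 2 * 1 = F t"
      unfolding F_def by (simp add: add_divide_distrib diff_divide_distrib power2_eq_square algebra_simps)
    finally show ?thesis .
  qed
  have "((\<lambda>t. L t - N t) has_real_derivative 0) (at t)" for t
    using DERIV_diff[OF L N] by simp
  then have "L x - N x = L 0 - N 0" using DERIV_isconst_all by blast
  moreover have "L 0 - N 0 = pi"
  proof -
    define a where "a = jacobi_am q y"
    have z: "s 0 = 0" "c 0 = 1" "d 0 = 1" using jacobi_at_0[OF q'] by (auto simp: s_def c_def d_def)
    have "arctan (c y / s y) = pi/2 - a"
    proof (rule arctan_unique)
      show "tan (pi/2 - a) = c y / s y"
        by (simp add: tan_def cos_diff sin_diff a_def c_def s_def jacobi_cn_def jacobi_sn_def)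
    qed (use y in \<open>auto simp: a_def\<close>)
    moreover have "arctan (q * s y / d y) = arcsin (q * s y)"
    proof -
      have "d y = sqrt (1 - (q * s y)\<^sup>2)" by (simp add: d_def s_def jacobi_dn_def power_mult_distrib)
      then have e: "1 - (q * s y)\<^sup>2 > 0" using dp[of y] by (metis real_sqrt_gt_0_iff)
      then have "\<bar>q * s y\<bar> < 1" by (simp add: abs_square_less_1)
      then show ?thesis using arcsin_arctan[of "q * s y"] \<open>d y = _\<close> by (simp add: abs_less_iff)
    qed
    ultimately show ?thesis
      using z by (simp add: L_def N_def ring_angle_minus[OF q] mult_2[symmetric])
        (simp add: ring_angle_def a_def s_def add_divide_distrib)
  qed
  ultimately show ?thesis
    by (simp add: L_def N_def ring_g_eq[OF q] s_def c_def d_def algebra_simps)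
qed

section \<open>Angles of orthogonal rings\<close>

lemma triple_product_square:
  fixes p a b :: "real^3"
  assumes "norm p = 1"
  shows "(p \<bullet> cross3 a b)\<^sup>2 = (a \<bullet> a - (p \<bullet> a)\<^sup>2) * (b \<bullet> b - (p \<bullet> b)\<^sup>2) - (a \<bullet> b - (p \<bullet> a) * (p \<bullet> b))\<^sup>2"
proof -
  have p: "(p$1)\<^sup>2 + (p$2)\<^sup>2 + (p$3)\<^sup>2 = 1"
    using assms by (simp add: norm_eq_1 inner_vec_def sum_3 power2_eq_square)
  show ?thesis
    unfolding cross3_def inner_vec_def sum_3 using p by simp algebra
qed

text \<open>The number \<open>(a \<bullet> b - (p \<bullet> a) * (p \<bullet> b)) + \<i> * (p \<bullet> cross3 a b)\<close> is the product of the lengths of the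
  projections of \<open>a\<close> and \<open>b\<close> to the plane orthogonal to \<open>p\<close> and of \<open>cis\<close> of the angle from the first to the
  second. The two equations say that these angles add up.\<close>

lemma turn_product:
  fixes p a b e :: "real^3"
  assumes "norm p = 1"
  shows "(a \<bullet> b - (p \<bullet> a) * (p \<bullet> b)) * (b \<bullet> e - (p \<bullet> b) * (p \<bullet> e)) - (p \<bullet> cross3 a b) * (p \<bullet> cross3 b e)
       = (b \<bullet> b - (p \<bullet> b)\<^sup>2) * (a \<bullet> e - (p \<bullet> a) * (p \<bullet> e))"
    and "(a \<bullet> b - (p \<bullet> a) * (p \<bullet> b)) * (p \<bullet> cross3 b e) + (p \<bullet> cross3 a b) * (b \<bullet> e - (p \<bullet> b) * (p \<bullet> e))
       = (b \<bullet> b - (p \<bullet> b)\<^sup>2) * (p \<bullet> cross3 a e)"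
proof -
  have p: "(p$1)\<^sup>2 + (p$2)\<^sup>2 + (p$3)\<^sup>2 = 1"
    using assms by (simp add: norm_eq_1 inner_vec_def sum_3 power2_eq_square)
  show "(a \<bullet> b - (p \<bullet> a) * (p \<bullet> b)) * (b \<bullet> e - (p \<bullet> b) * (p \<bullet> e)) - (p \<bullet> cross3 a b) * (p \<bullet> cross3 b e)
       = (b \<bullet> b - (p \<bullet> b)\<^sup>2) * (a \<bullet> e - (p \<bullet> a) * (p \<bullet> e))"
    unfolding cross3_def inner_vec_def sum_3 using p by simp algebra
  show "(a \<bullet> b - (p \<bullet> a) * (p \<bullet> b)) * (p \<bullet> cross3 b e) + (p \<bullet> cross3 a b) * (b \<bullet> e - (p \<bullet> b) * (p \<bullet> e))
       = (b \<bullet> b - (p \<bullet> b)\<^sup>2) * (p \<bullet> cross3 a e)"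
    unfolding cross3_def inner_vec_def sum_3 using p by simp algebra
qed

text \<open>The angle at the centre of the ring \<open>(r, R)\<close> in the quadrilateral spanned with \<open>(r', R')\<close>, if the side of
  length \<open>r\<close> is signed. The first two terms are the angle in the triangle with legs \<open>r\<close>, \<open>R'\<close>, in the form that
  depends analytically on \<open>r\<close> through \<open>r = 0\<close>, and the last one is the angle in the triangle with legs
  \<open>R\<close>, \<open>r'\<close>.\<close>

definition turn_angle :: "real \<Rightarrow> real \<Rightarrow> real \<Rightarrow> real \<Rightarrow> real" where
  "turn_angle r R r' R' = pi/2 - arctan (sin r * cos R' / sin R') + arctan (sin r' / (sin R * cos r'))"

text \<open>The radii of uniformized rings with \<open>R < pi/2\<close>; for \<open>q = 1\<close> the sign is fixed because \<open>cn\<close> is positive.\<close>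

definition ring_radii :: "real \<Rightarrow> real \<Rightarrow> real \<Rightarrow> bool" where
  "ring_radii q r R \<longleftrightarrow> 0 < q \<and> q \<le> 1 \<and> - pi/2 < r \<and> r < pi/2 \<and> r \<noteq> 0 \<and> 0 < R \<and> R < pi/2 \<and>
     cos R = q * cos r \<and> (q = 1 \<longrightarrow> 0 < r)"

lemma ring_radii_bounds:
  assumes "ring_radii q r R"
  shows "0 < cos r" "0 < cos R" "0 < sin R" "sin r \<noteq> 0" "0 < sin r \<longleftrightarrow> 0 < r" "sin r < 0 \<longleftrightarrow> r < 0" "\<bar>sin r\<bar> \<le> sin R" "cos R * \<bar>sin r\<bar> \<le> cos r * sin R"
    "q < 1 \<Longrightarrow> cos R * \<bar>sin r\<bar> < cos r * sin R" "\<bar>r\<bar> \<le> R"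
proof -
  have a: "0 < q" "q \<le> 1" "- pi/2 < r" "r < pi/2" "r \<noteq> 0" "0 < R" "R < pi/2" "cos R = q * cos r"
    using assms by (auto simp: ring_radii_def)
  show c: "0 < cos r" using a by (intro cos_gt_zero_pi) auto
  show C: "0 < cos R" using a by (intro cos_gt_zero) auto
  show S: "0 < sin R" using a by (intro sin_gt_zero) auto
  have sg: "0 < sin r" if "0 < r" using that a by (intro sin_gt_zero) auto
  have sl: "sin r < 0" if "r < 0" using that a sin_gt_zero[of "- r"] by auto
  show "0 < sin r \<longleftrightarrow> 0 < r" using sg sl a by (metis less_asym linorder_neqE_linordered_idom)
  show "sin r < 0 \<longleftrightarrow> r < 0" using sg sl a by (metis less_asym linorder_neqE_linordered_idom)
  show "sin r \<noteq> 0" using sg sl a by (metis less_irrefl linorder_neqE_linordered_idom)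
  have qc: "cos R \<le> cos r" using a c by simp
  then have "(cos R)\<^sup>2 \<le> (cos r)\<^sup>2" using C by (intro power_mono) auto
  then have "(sin r)\<^sup>2 \<le> (sin R)\<^sup>2" by (simp add: sin_squared_eq)
  then show s: "\<bar>sin r\<bar> \<le> sin R" using S by (simp add: abs_le_square_iff[symmetric])
  show "cos R * \<bar>sin r\<bar> \<le> cos r * sin R" using qc s c C by (intro mult_mono) auto
  show "cos R * \<bar>sin r\<bar> < cos r * sin R" if "q < 1"
  proof -
    have "cos R < cos r" using a that c by simp
    then have "cos R * sin R < cos r * sin R" using S by simp
    moreover have "cos R * \<bar>sin r\<bar> \<le> cos R * sin R" using s C by simp
    ultimately show ?thesis by linarith
  qed
  have "cos R \<le> cos \<bar>r\<bar>" using qc by (simp add: cos_abs_real)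
  then show "\<bar>r\<bar> \<le> R" using a cos_mono_le_eq[of R "\<bar>r\<bar>"] by auto
qed

lemma cos_sin_arctan_quotient:
  assumes "0 < b"
  shows "cos (arctan (a / b)) = b / sqrt (a\<^sup>2 + b\<^sup>2)" "sin (arctan (a / b)) = a / sqrt (a\<^sup>2 + b\<^sup>2)"
proof -
  have "1 + (a / b)\<^sup>2 = (a\<^sup>2 + b\<^sup>2) / b\<^sup>2" using assms by (simp add: field_simps power2_eq_square)
  then have "sqrt (1 + (a / b)\<^sup>2) = sqrt (a\<^sup>2 + b\<^sup>2) / b" using assms by (simp add: real_sqrt_divide)
  then show "cos (arctan (a / b)) = b / sqrt (a\<^sup>2 + b\<^sup>2)" "sin (arctan (a / b)) = a / sqrt (a\<^sup>2 + b\<^sup>2)"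
    using assms by (simp_all add: cos_arctan sin_arctan)
qed

text \<open>\<open>\<Delta>\<close> is the squared sine of the distance of the centres, the common hypotenuse of the two triangles. The
  sine of the angle is positive because an inner radius is at most the outer one in absolute value; equality
  occurs only for \<open>q = 1\<close>, where all signs are positive.\<close>

lemma turn_angle_cos_sin:
  assumes v: "ring_radii q r R" and w: "ring_radii q r' R'"
  defines "\<Delta> \<equiv> 1 - (cos r * cos R')\<^sup>2"
  shows "0 < \<Delta>"
    and "\<Delta> * cos (turn_angle r R r' R') = cos R' * sin r * sin R * cos r' - sin R' * sin r'"
    and "\<Delta> * sin (turn_angle r R r' R') = sin R' * sin R * cos r' + cos R' * sin r * sin r'"
    and "0 < turn_angle r R r' R'" "turn_angle r R r' R' < pi"
proof -
  note bv = ring_radii_bounds[OF v] and bw = ring_radii_bounds[OF w]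
  have qq: "cos R * cos r' = cos r * cos R'" using v w by (simp add: ring_radii_def)
  have d1: "\<Delta> = (sin r * cos R')\<^sup>2 + (sin R')\<^sup>2"
    unfolding \<Delta>_def using sin_cos_squared_add[of r] sin_cos_squared_add[of R'] by algebra
  have d2: "\<Delta> = (sin r')\<^sup>2 + (sin R * cos r')\<^sup>2"
    unfolding \<Delta>_def using sin_cos_squared_add[of r'] sin_cos_squared_add[of R] qq by algebra
  show \<Delta>: "0 < \<Delta>" unfolding d1 using bw by (simp add: add_nonneg_pos)
  let ?A = "arctan (sin r * cos R' / sin R')" and ?B = "arctan (sin r' / (sin R * cos r'))"
  have A: "cos ?A = sin R' / sqrt \<Delta>" "sin ?A = sin r * cos R' / sqrt \<Delta>"
    using cos_sin_arctan_quotient[OF bw(3), of "sin r * cos R'"] by (simp_all add: d1)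
  have p: "0 < sin R * cos r'" using bv bw by simp
  have B: "cos ?B = sin R * cos r' / sqrt \<Delta>" "sin ?B = sin r' / sqrt \<Delta>"
    using cos_sin_arctan_quotient[OF p, of "sin r'"] by (simp_all add: d2)
  have sq: "sqrt \<Delta> * sqrt \<Delta> = \<Delta>" using \<Delta> by simp
  have T: "turn_angle r R r' R' = pi/2 - (?A - ?B)" by (simp add: turn_angle_def)
  have c: "cos (turn_angle r R r' R') = sin ?A * cos ?B - cos ?A * sin ?B"
    unfolding T by (simp add: cos_diff sin_diff)
  have s: "sin (turn_angle r R r' R') = cos ?A * cos ?B + sin ?A * sin ?B"
    unfolding T by (simp add: cos_diff sin_diff)
  show "\<Delta> * cos (turn_angle r R r' R') = cos R' * sin r * sin R * cos r' - sin R' * sin r'"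
    unfolding c A B using \<Delta> sq by (simp add: field_simps)
  show sn: "\<Delta> * sin (turn_angle r R r' R') = sin R' * sin R * cos r' + cos R' * sin r * sin r'"
    unfolding s A B using \<Delta> sq by (simp add: field_simps)
  have "0 < sin R' * sin R * cos r' + cos R' * sin r * sin r'"
  proof (cases "q < 1")
    case True
    have "\<bar>cos R' * sin r * sin r'\<bar> = \<bar>sin r\<bar> * (cos R' * \<bar>sin r'\<bar>)" using bw by (simp add: abs_mult)
    also have "\<dots> < sin R * (cos r' * sin R')"
      by (rule mult_le_less_imp_less[OF bv(7) bw(9)[OF True]]) (use bv bw in auto)
    finally show ?thesis by (simp add: algebra_simps)
  next
    case False
    then have "0 < r" "0 < r'" using v w by (auto simp: ring_radii_def)
    then show ?thesis using bv bw by (intro add_pos_pos mult_pos_pos) auto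
  qed
  then have sp: "0 < sin (turn_angle r R r' R')" using sn \<Delta> by (metis zero_less_mult_pos)
  have lo: "- pi/2 < turn_angle r R r' R'" and hi: "turn_angle r R r' R' < 3 * pi / 2"
    using arctan_bounded[of "sin r * cos R' / sin R'"] arctan_bounded[of "sin r' / (sin R * cos r')"]
    unfolding turn_angle_def by auto
  show "0 < turn_angle r R r' R'"
  proof (rule ccontr)
    assume "\<not> ?thesis"
    then have "0 \<le> sin (- turn_angle r R r' R')" using lo by (intro sin_ge_zero) auto
    then show False using sp by simp
  qed
  show "turn_angle r R r' R' < pi"
  proof (rule ccontr)
    assume "\<not> ?thesis"
    then have "0 \<le> sin (turn_angle r R r' R' - pi)" using hi by (intro sin_ge_zero) auto
    then show False using sp by (simp add: sin_diff)
  qed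
qed

lemma opening_angle_eq_turn_angle:
  assumes v: "ring_radii q r R" and w: "ring_radii q r' R'"
  shows "opening_angle r R r' R' = (if 0 < r then turn_angle r R r' R' else turn_angle r R r' R' - pi)"
proof -
  note bv = ring_radii_bounds[OF v] and bw = ring_radii_bounds[OF w]
  let ?t = "sin r * cos R' / sin R'"
  have t: "?t \<noteq> 0" using bv bw by simp
  have "tan R' / sin r = 1 / ?t" using bw by (simp add: tan_def)
  then have "arctan (tan R' / sin r) = sgn ?t * pi / 2 - arctan ?t" using Transcendental.arctan_inverse[OF t] by simp
  moreover have "sgn ?t = (if 0 < r then 1 else - 1)"
  proof -
    have "0 < ?t \<longleftrightarrow> 0 < r" using bv(5) bw(2,3) by (simp add: zero_less_divide_iff zero_less_mult_iff)
    then show ?thesis using t by (auto simp: sgn_if)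
  qed
  moreover have "tan r' / sin R = sin r' / (sin R * cos r')" by (simp add: tan_def)
  ultimately show ?thesis by (auto simp: opening_angle_def turn_angle_def)
qed

lemma sph_circle_iff:
  assumes "norm p = 1" "\<bar>\<rho>\<bar> \<le> pi"
  shows "x \<in> sph_circle p \<rho> \<longleftrightarrow> norm x = 1 \<and> p \<bullet> x = cos \<rho>"
proof -
  have "arccos (p \<bullet> x) = \<bar>\<rho>\<bar> \<longleftrightarrow> p \<bullet> x = cos \<rho>" if "norm x = 1"
  proof
    assume "arccos (p \<bullet> x) = \<bar>\<rho>\<bar>"
    moreover have "\<bar>p \<bullet> x\<bar> \<le> 1" using Cauchy_Schwarz_ineq2[of p x] assms that by simp
    ultimately show "p \<bullet> x = cos \<rho>" by (metis cos_abs_real cos_arccos_abs)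
  next
    assume "p \<bullet> x = cos \<rho>"
    then show "arccos (p \<bullet> x) = \<bar>\<rho>\<bar>" using assms arccos_cos[of "\<bar>\<rho>\<bar>"] by (simp add: cos_abs_real)
  qed
  then show ?thesis by (auto simp: sph_circle_def S2_def sph_dist_def)
qed

lemma orthogonal_circles_iff:
  assumes "norm p = 1" "norm p' = 1" "\<bar>\<rho>\<bar> \<le> pi" "\<bar>\<rho>'\<bar> \<le> pi"
    and "x \<in> sph_circle p \<rho>" "x \<in> sph_circle p' \<rho>'"
  shows "orthogonal_circles p \<rho> p' \<rho>' \<longleftrightarrow> p \<bullet> p' = cos \<rho> * cos \<rho>'"
proof -
  have "cross3 p y \<bullet> cross3 p' y = p \<bullet> p' - cos \<rho> * cos \<rho>'"
    if "y \<in> sph_circle p \<rho> \<inter> sph_circle p' \<rho>'" for y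
    using that assms by (simp add: sph_circle_iff Cross3.dot_cross norm_eq_1 inner_commute)
  then show ?thesis unfolding orthogonal_circles_def using assms(5,6) by force
qed

text \<open>The incidences determine the positions of \<open>a\<close> and \<open>b\<close> relative to the great circle through the centres up to
  the sides on which they lie. With \<open>a\<close> on the wrong side the angle to \<open>a\<close>
  outweighs that to \<open>b\<close>, whichever side \<open>b\<close> is on, so the turn from \<open>a\<close> to \<open>b\<close> vanishes or has the
  wrong orientation.\<close>

lemma ring_side_of_touching_point:
  fixes p w a b :: "real^3"
  assumes v: "ring_radii q r R" and w: "ring_radii q r' R'"
    and unit: "norm p = 1" "norm w = 1" "norm a = 1" "norm b = 1"
    and inc: "p \<bullet> a = cos r" "p \<bullet> b = cos R" "w \<bullet> a = cos R'" "w \<bullet> b = cos r'" "p \<bullet> w = cos r * cos R'"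
    and \<sigma>: "\<sigma> = 1 \<or> \<sigma> = - 1" and turn: "0 < sin r * \<sigma> * (p \<bullet> cross3 a b)"
  shows "p \<bullet> cross3 a w = \<sigma> * (sin r * sin R')"
proof -
  note bv = ring_radii_bounds[OF v] and bw = ring_radii_bounds[OF w]
  define \<Delta> where "\<Delta> = 1 - (cos r * cos R')\<^sup>2"
  have \<Delta>: "0 < \<Delta>" using turn_angle_cos_sin(1)[OF v w] by (simp add: \<Delta>_def)
  have qq: "cos R * cos r' = cos r * cos R'" using v w by (simp add: ring_radii_def)
  have u: "a \<bullet> a = 1" "b \<bullet> b = 1" "w \<bullet> w = 1" using unit by (auto simp: norm_eq_1)
  have trig: "(sin x)\<^sup>2 + (cos x)\<^sup>2 = 1" for x :: real by simp
  let ?X = "p \<bullet> cross3 a w" and ?Y = "p \<bullet> cross3 w b"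
  have "?X\<^sup>2 = (1 - (cos r)\<^sup>2) * (1 - (cos r * cos R')\<^sup>2) - (cos R' - cos r * (cos r * cos R'))\<^sup>2"
    using triple_product_square[OF unit(1), of a w] inc u by (simp add: inner_commute)
  also have "\<dots> = (sin r * sin R')\<^sup>2" using trig[of r] trig[of R'] by algebra
  finally have X: "?X = sin r * sin R' \<or> ?X = - (sin r * sin R')" by (simp add: power2_eq_iff)
  have "?Y\<^sup>2 = (1 - (cos r * cos R')\<^sup>2) * (1 - (cos R)\<^sup>2) - (cos r' - cos r * cos R' * cos R)\<^sup>2"
    using triple_product_square[OF unit(1), of w b] inc u by (simp add: inner_commute)
  also have "\<dots> = (sin R * sin r')\<^sup>2" using trig[of R] trig[of r'] qq by algebra
  finally have Y: "?Y = sin R * sin r' \<or> ?Y = - (sin R * sin r')" by (simp add: power2_eq_iff)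
  have "\<Delta> * (p \<bullet> cross3 a b) = (cos R' - cos r * (cos r * cos R')) * ?Y + ?X * (cos r' - cos r * cos R' * cos R)"
    using turn_product(2)[OF unit(1), of a w b] inc u by (simp add: inner_commute \<Delta>_def)
  also have "\<dots> = cos R' * (sin r)\<^sup>2 * ?Y + ?X * (cos r' * (sin R)\<^sup>2)"
  proof -
    have "cos R' - cos r * (cos r * cos R') = cos R' * (sin r)\<^sup>2" using trig[of r] by algebra
    moreover have "cos r' - cos r * cos R' * cos R = cos r' * (sin R)\<^sup>2" using trig[of R] qq by algebra
    ultimately show ?thesis by simp
  qed
  finally have e: "\<Delta> * (p \<bullet> cross3 a b) = cos R' * (sin r)\<^sup>2 * ?Y + ?X * (cos r' * (sin R)\<^sup>2)" .
  have pos: "0 < \<Delta> * (sin r * \<sigma> * (p \<bullet> cross3 a b))" using \<Delta> turn by simp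
  have small: "cos R' * \<bar>sin r\<bar> * \<bar>sin r'\<bar> \<le> sin R' * sin R * cos r'"
  proof -
    have "\<bar>sin r\<bar> * (cos R' * \<bar>sin r'\<bar>) \<le> sin R * (cos r' * sin R')"
      by (rule mult_mono[OF bv(7) bw(8)]) (use bv bw in auto)
    then show ?thesis by (simp add: algebra_simps)
  qed
  show ?thesis
  proof (rule ccontr)
    assume "\<not> ?thesis"
    then have X': "?X = - \<sigma> * (sin r * sin R')" using X \<sigma> by auto
    have ss: "\<sigma> * \<sigma> = 1" using \<sigma> by auto
    obtain \<delta> where \<delta>: "\<delta> = 1 \<or> \<delta> = - 1" "?Y = \<delta> * (sin R * sin r')" using Y by (metis mult_1 mult_minus1)
    have "\<Delta> * (sin r * \<sigma> * (p \<bullet> cross3 a b)) = sin r * \<sigma> * (\<Delta> * (p \<bullet> cross3 a b))" by simp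
    also have "\<dots> = (sin r)\<^sup>2 * sin R * (\<sigma> * \<delta> * (cos R' * sin r * sin r') - (\<sigma> * \<sigma>) * (sin R' * sin R * cos r'))"
      unfolding e X' \<delta>(2) by algebra
    also have "\<dots> \<le> 0"
    proof -
      have "\<sigma> * \<delta> * (cos R' * sin r * sin r') \<le> \<bar>\<sigma> * \<delta> * (cos R' * sin r * sin r')\<bar>" by simp
      also have "\<dots> = cos R' * \<bar>sin r\<bar> * \<bar>sin r'\<bar>" using \<sigma> \<delta>(1) bw by (auto simp: abs_mult)
      finally have "\<sigma> * \<delta> * (cos R' * sin r * sin r') - (\<sigma> * \<sigma>) * (sin R' * sin R * cos r') \<le> 0"
        using small ss by simp
      moreover have "0 \<le> (sin r)\<^sup>2 * sin R" using bv by simp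
      ultimately show ?thesis by (simp add: mult_nonneg_nonpos)
    qed
    finally show False using pos by simp
  qed
qed

text \<open>The turn at \<open>p\<close> decides the side of \<open>a\<close> and the turn at \<open>w\<close> that of \<open>b\<close>. The turn from \<open>a\<close> to \<open>b\<close> is then composed
  of the turns from \<open>a\<close> to \<open>w\<close> and from \<open>w\<close> to \<open>b\<close>. The sign \<open>\<sigma>\<close> distinguishes the two diagonal directions, in
  which the inner touching point comes before or after the outer one.\<close>

lemma turn_between_touching_points:
  fixes p w a b :: "real^3"
  assumes v: "ring_radii q r R" and w: "ring_radii q r' R'"
    and unit: "norm p = 1" "norm w = 1" "norm a = 1" "norm b = 1"
    and inc: "p \<bullet> a = cos r" "p \<bullet> b = cos R" "w \<bullet> a = cos R'" "w \<bullet> b = cos r'" "p \<bullet> w = cos r * cos R'"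
    and \<sigma>: "\<sigma> = 1 \<or> \<sigma> = - 1" and turn: "0 < sin r * \<sigma> * (p \<bullet> cross3 a b)" "0 < sin r' * \<sigma> * (w \<bullet> cross3 b a)"
  shows "a \<bullet> b - cos r * cos R = sin r * sin R * cos (turn_angle r R r' R')"
    and "\<sigma> * (p \<bullet> cross3 a b) = sin r * sin R * sin (turn_angle r R r' R')"
proof -
  define \<Delta> where "\<Delta> = 1 - (cos r * cos R')\<^sup>2"
  note T = turn_angle_cos_sin[OF v w, folded \<Delta>_def]
  have qq: "cos R * cos r' = cos r * cos R'" using v w by (simp add: ring_radii_def)
  have u: "a \<bullet> a = 1" "b \<bullet> b = 1" "w \<bullet> w = 1" using unit by (auto simp: norm_eq_1)
  have trig: "(sin x)\<^sup>2 + (cos x)\<^sup>2 = 1" for x :: real by simp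
  have X: "p \<bullet> cross3 a w = \<sigma> * (sin r * sin R')"
    by (rule ring_side_of_touching_point[OF v w unit inc \<sigma> turn(1)])
  have "w \<bullet> cross3 b p = \<sigma> * (sin r' * sin R)"
    using ring_side_of_touching_point[OF w v unit(2,1,4,3), of \<sigma>] inc qq \<sigma> turn(2)
    by (simp add: inner_commute mult.commute)
  moreover have "w \<bullet> cross3 b p = p \<bullet> cross3 w b"
    by (simp add: cross3_def inner_vec_def sum_3 algebra_simps)
  ultimately have Y: "p \<bullet> cross3 w b = \<sigma> * (sin r' * sin R)" by simp
  have ss: "\<sigma> * \<sigma> = 1" using \<sigma> by auto
  have A: "cos R' - cos r * (cos r * cos R') = cos R' * (sin r)\<^sup>2" using trig[of r] by algebra
  have B: "cos r' - cos r * cos R' * cos R = cos r' * (sin R)\<^sup>2" using trig[of R] qq by algebra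
  have "\<Delta> * (a \<bullet> b - cos r * cos R) = (cos R' - cos r * (cos r * cos R')) * (cos r' - cos r * cos R' * cos R)
     - (p \<bullet> cross3 a w) * (p \<bullet> cross3 w b)"
    using turn_product(1)[OF unit(1), of a w b] inc u by (simp add: inner_commute \<Delta>_def)
  also have "\<dots> = sin r * sin R * (\<Delta> * cos (turn_angle r R r' R'))"
    unfolding A B X Y T(2) using ss by algebra
  finally show "a \<bullet> b - cos r * cos R = sin r * sin R * cos (turn_angle r R r' R')" using T(1) by simp
  have "\<Delta> * (p \<bullet> cross3 a b) = (cos R' - cos r * (cos r * cos R')) * (p \<bullet> cross3 w b)
     + (p \<bullet> cross3 a w) * (cos r' - cos r * cos R' * cos R)"
    using turn_product(2)[OF unit(1), of a w b] inc u by (simp add: inner_commute \<Delta>_def)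
  also have "\<dots> = \<sigma> * (sin r * sin R * (\<Delta> * sin (turn_angle r R r' R')))"
    unfolding A B X Y T(3) by algebra
  finally have "p \<bullet> cross3 a b = \<sigma> * (sin r * sin R * sin (turn_angle r R r' R'))" using T(1) by simp
  then show "\<sigma> * (p \<bullet> cross3 a b) = sin r * sin R * sin (turn_angle r R r' R')"
    using ss by (simp add: mult.assoc[symmetric])
qed

section \<open>From a pattern to the angle condition\<close>

lemma nbrs_subset: "nbrs Q (m, n) \<subseteq> {(m + 1, n + 1), (m - 1, n + 1), (m - 1, n - 1), (m + 1, n - 1)}"
  by (auto simp: nbrs_def)

lemma nbrs_sym: "w \<in> nbrs Q v \<longleftrightarrow> v \<in> nbrs Q w"
  by (auto simp: nbrs_def abs_minus_commute)

lemma nbrs_G_verts: "v \<in> G_verts Q \<Longrightarrow> w \<in> nbrs Q v \<Longrightarrow> w \<in> G_verts Q"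
  using nbrs_subset[of Q "fst v" "snd v"] by (auto simp: G_verts_def nbrs_def verts_def)

text \<open>The four orientation conditions of a pattern in one formula: \<open>i * j\<close> is the sign of the diagonal direction.\<close>

lemma ring_pattern_turn:
  assumes pat: "orthogonal_ring_pattern Q p r R pt"
    and v: "(m, n) \<in> G_verts Q" and w: "(m + i, n + j) \<in> nbrs Q (m, n)"
    and ij: "i \<in> {1, - 1}" "j \<in> {1, - 1}" and r: "sgn (sin (r (m, n))) = sgn (r (m, n))"
  shows "0 < sin (r (m, n)) * of_int (i * j) * (p (m, n) \<bullet> cross3 (pt (m + i, n)) (pt (m, n + j)))"
proof -
  let ?a = "pt (m + i, n)" and ?b = "pt (m, n + j)" and ?p = "p (m, n)" and ?r = "r (m, n)"
  have sk: "?p \<bullet> cross3 ?b ?a = - (?p \<bullet> cross3 ?a ?b)"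
    using cross_skew[of ?b ?a] by simp
  have "?r \<noteq> 0" using pat[unfolded orthogonal_ring_pattern_def, THEN conjunct1, THEN bspec, OF v]
    by (simp add: spherical_ring_def)
  moreover have "(0 < ?r \<longrightarrow> 0 < of_int (i * j) * (?p \<bullet> cross3 ?a ?b)) \<and> (?r < 0 \<longrightarrow> of_int (i * j) * (?p \<bullet> cross3 ?a ?b) < 0)"
  proof -
    let ?t = "\<lambda>x y. oriented_turn ?r ?p x y"
    have "((m + 1, n + 1) \<in> nbrs Q (m, n) \<longrightarrow> ?t (pt (m + 1, n)) (pt (m, n + 1))) \<and>
      ((m - 1, n + 1) \<in> nbrs Q (m, n) \<longrightarrow> ?t (pt (m, n + 1)) (pt (m - 1, n))) \<and>
      ((m - 1, n - 1) \<in> nbrs Q (m, n) \<longrightarrow> ?t (pt (m - 1, n)) (pt (m, n - 1))) \<and>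
      ((m + 1, n - 1) \<in> nbrs Q (m, n) \<longrightarrow> ?t (pt (m, n - 1)) (pt (m + 1, n)))"
      using pat[unfolded orthogonal_ring_pattern_def, THEN conjunct2, THEN conjunct2, THEN conjunct2, THEN conjunct2,
        THEN bspec, OF v] by (simp only: Let_def prod.case)
    then have "i * j = 1 \<and> ?t ?a ?b \<or> i * j = - 1 \<and> ?t ?b ?a"
      using w ij by auto
    then show ?thesis by (auto simp: oriented_turn_def ccw_turn_def sk simp del: of_int_mult)
  qed
  moreover have "0 < ?r \<longleftrightarrow> 0 < sin ?r" "?r < 0 \<longleftrightarrow> sin ?r < 0" using r by (metis sgn_greater, metis sgn_less)
  ultimately have "0 < sin ?r * (of_int (i * j) * (?p \<bullet> cross3 ?a ?b))"
    by (metis linorder_neqE_linordered_idom mult_neg_neg mult_pos_pos)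
  then show ?thesis by (simp add: mult.assoc)
qed

lemma ring_pattern_square:
  assumes pat: "orthogonal_ring_pattern Q p r R pt"
    and radii: "\<And>v. v \<in> G_verts Q \<Longrightarrow> ring_radii q (r v) (R v)"
    and v: "(m, n) \<in> G_verts Q" and w: "(m + i, n + j) \<in> nbrs Q (m, n)"
    and ij: "i \<in> {1, - 1}" "j \<in> {1, - 1}"
  defines "a \<equiv> pt (m + i, n)" and "b \<equiv> pt (m, n + j)"
    and "\<theta> \<equiv> turn_angle (r (m, n)) (R (m, n)) (r (m + i, n + j)) (R (m + i, n + j))"
  shows "a \<bullet> b - cos (r (m, n)) * cos (R (m, n)) = sin (r (m, n)) * sin (R (m, n)) * cos \<theta>"
    and "of_int (i * j) * (p (m, n) \<bullet> cross3 a b) = sin (r (m, n)) * sin (R (m, n)) * sin \<theta>"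
    and "p (m, n) \<bullet> a = cos (r (m, n))" "p (m, n) \<bullet> b = cos (R (m, n))"
    and "norm a = 1" "norm b = 1" "norm (p (m, n)) = 1"
proof -
  let ?v = "(m, n)" and ?w = "(m + i, n + j)"
  have wG: "?w \<in> G_verts Q" using nbrs_G_verts v w by blast
  have v': "?v \<in> nbrs Q ?w" using w nbrs_sym by blast
  note rv = radii[OF v] and rw = radii[OF wG]
  have unit: "norm (p ?v) = 1" "norm (p ?w) = 1"
    using pat[unfolded orthogonal_ring_pattern_def, THEN conjunct1] v wG
    by (simp_all add: spherical_ring_def S2_def)
  have le: "\<bar>r ?v\<bar> \<le> pi" "\<bar>R ?v\<bar> \<le> pi" "\<bar>r ?w\<bar> \<le> pi" "\<bar>R ?w\<bar> \<le> pi"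
    using rv rw by (auto simp: ring_radii_def)
  have inc: "\<And>m n m' n'. (m, n) \<in> G_verts Q \<Longrightarrow> (m', n') \<in> nbrs Q (m, n) \<Longrightarrow>
        pt (m', n) \<in> sph_circle (p (m, n)) (r (m, n)) \<and> pt (m, n') \<in> sph_circle (p (m, n)) (R (m, n))"
    using pat[unfolded orthogonal_ring_pattern_def, THEN conjunct2, THEN conjunct2, THEN conjunct2, THEN conjunct1]
    by blast
  have C: "a \<in> sph_circle (p ?v) (r ?v)" "b \<in> sph_circle (p ?v) (R ?v)"
    "b \<in> sph_circle (p ?w) (r ?w)" "a \<in> sph_circle (p ?w) (R ?w)"
    using inc[OF v w] inc[OF wG v'] by (auto simp: a_def b_def)
  then show i1: "p ?v \<bullet> a = cos (r ?v)" and i2: "p ?v \<bullet> b = cos (R ?v)" and n: "norm a = 1" "norm b = 1"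
    using unit le by (auto simp: sph_circle_iff)
  have i3: "p ?w \<bullet> a = cos (R ?w)" and i4: "p ?w \<bullet> b = cos (r ?w)"
    using C unit le by (auto simp: sph_circle_iff)
  have "orthogonal_circles (p ?w) (R ?w) (p ?v) (r ?v)"
    using pat[unfolded orthogonal_ring_pattern_def, THEN conjunct2, THEN conjunct2, THEN conjunct1] v w by blast
  then have i5: "p ?v \<bullet> p ?w = cos (r ?v) * cos (R ?w)"
    using orthogonal_circles_iff[OF unit(2,1) le(4,1) C(4,1)] by (simp add: inner_commute mult.commute)
  have sg: "sgn (sin (r u)) = sgn (r u)" if "u \<in> G_verts Q" for u
    using ring_radii_bounds(4,5)[OF radii[OF that]] radii[OF that] by (auto simp: sgn_if ring_radii_def)
  have t1: "0 < sin (r ?v) * of_int (i * j) * (p ?v \<bullet> cross3 a b)"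
    unfolding a_def b_def by (rule ring_pattern_turn[OF pat v w ij sg[OF v]])
  have "0 < sin (r ?w) * of_int (- i * - j) * (p ?w \<bullet> cross3 (pt (m + i + - i, n + j)) (pt (m + i, n + j + - j)))"
    by (rule ring_pattern_turn[OF pat wG _ _ _ sg[OF wG]]) (use v' ij in auto)
  then have t2: "0 < sin (r ?w) * of_int (i * j) * (p ?w \<bullet> cross3 b a)"
    by (simp add: a_def b_def)
  have \<sigma>: "real_of_int (i * j) = 1 \<or> real_of_int (i * j) = - 1" using ij by auto
  show "a \<bullet> b - cos (r ?v) * cos (R ?v) = sin (r ?v) * sin (R ?v) * cos \<theta>"
    "of_int (i * j) * (p ?v \<bullet> cross3 a b) = sin (r ?v) * sin (R ?v) * sin \<theta>"
    unfolding \<theta>_def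
    using turn_between_touching_points[OF rv rw unit n i1 i2 i3 i4 i5 \<sigma> t1 t2] by auto
  show "norm (p ?v) = 1" by (rule unit)
qed

text \<open>The turns east, north, west, south, east are \<open>\<rho>\<close> times \<open>cis\<close> of the angles, and their product is \<open>\<rho> ^ 4\<close> by
  \<open>turn_product\<close>. So the sum of the four angles is a multiple of \<open>2 * pi\<close>, and it lies strictly between \<open>0\<close> and
  \<open>4 * pi\<close>.\<close>

lemma ring_pattern_angle_sum:
  assumes pat: "orthogonal_ring_pattern Q p r R pt"
    and radii: "\<And>v. v \<in> G_verts Q \<Longrightarrow> ring_radii q (r v) (R v)"
    and int: "v \<in> internal_verts Q"
  shows "(\<Sum>w\<in>nbrs Q v. turn_angle (r v) (R v) (r w) (R w)) = 2 * pi"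
proof -
  obtain m n where v: "v = (m, n)" by (cases v)
  have vG: "(m, n) \<in> G_verts Q" using int v by (simp add: internal_verts_def)
  have nb: "nbrs Q (m, n) = {(m + 1, n + 1), (m - 1, n + 1), (m - 1, n - 1), (m + 1, n - 1)}"
    by (rule card_subset_eq[OF _ nbrs_subset]) (use int v in \<open>auto simp: internal_verts_def card_insert_if\<close>)
  note sq = ring_pattern_square[OF pat radii vG]
  define E N W S where "E = pt (m + 1, n)" and "N = pt (m, n + 1)" and "W = pt (m - 1, n)" and "S = pt (m, n - 1)"
  define \<theta> where "\<theta> w = turn_angle (r v) (R v) (r w) (R w)" for w
  define \<rho> where "\<rho> = sin (r v) * sin (R v)"
  define t where "t x y = Complex (x \<bullet> y - (p v \<bullet> x) * (p v \<bullet> y)) (p v \<bullet> cross3 x y)" for x y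
  have u: "norm (p v) = 1" using sq(7)[of 1 1] nb v by simp
  have tm: "t x y * t y z = of_real (y \<bullet> y - (p v \<bullet> y)\<^sup>2) * t x z" for x y z
    using turn_product[OF u, of x y z] by (simp add: t_def complex_eq_iff)
  have sk: "p v \<bullet> cross3 x y = - (p v \<bullet> cross3 y x)" for x y
    using cross_skew[of x y] by simp
  have pts: "p v \<bullet> E = cos (r v)" "p v \<bullet> W = cos (r v)" "p v \<bullet> N = cos (R v)" "p v \<bullet> S = cos (R v)"
    "norm E = 1" "norm W = 1" "norm N = 1" "norm S = 1"
    using sq(3-6)[of 1 1] sq(3-6)[of "-1" "-1"] nb v by (auto simp: E_def N_def W_def S_def)
  have t1: "t E N = of_real \<rho> * cis (\<theta> (m + 1, n + 1))"
    using sq(1,2)[of 1 1] nb pts v by (simp add: t_def E_def N_def \<rho>_def \<theta>_def complex_eq_iff)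
  have t2: "t N W = of_real \<rho> * cis (\<theta> (m - 1, n + 1))"
    using sq(1,2)[of "-1" 1] nb pts v sk[of N W]
    by (simp add: t_def N_def W_def \<rho>_def \<theta>_def complex_eq_iff inner_commute mult.commute)
  have t3: "t W S = of_real \<rho> * cis (\<theta> (m - 1, n - 1))"
    using sq(1,2)[of "-1" "-1"] nb pts v by (simp add: t_def W_def S_def \<rho>_def \<theta>_def complex_eq_iff)
  have t4: "t S E = of_real \<rho> * cis (\<theta> (m + 1, n - 1))"
    using sq(1,2)[of 1 "-1"] nb pts v sk[of S E]
    by (simp add: t_def S_def E_def \<rho>_def \<theta>_def complex_eq_iff inner_commute mult.commute)
  define s where "s = \<theta> (m + 1, n + 1) + \<theta> (m - 1, n + 1) + \<theta> (m - 1, n - 1) + \<theta> (m + 1, n - 1)"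
  have rv: "ring_radii q (r v) (R v)" using radii vG v by simp
  have \<rho>0: "\<rho> \<noteq> 0" using ring_radii_bounds(3,4)[OF rv] by (simp add: \<rho>_def)
  have nn: "y \<bullet> y = 1" if "norm y = 1" for y :: "real^3" using that by (simp add: norm_eq_1)
  have "t E N * t N W * t W S * t S E = of_real (\<rho> ^ 4)"
  proof -
    have "t E N * t N W * t W S * t S E = of_real ((sin (R v))\<^sup>2 * (sin (r v))\<^sup>2 * (sin (R v))\<^sup>2) * t E E"
      by (simp add: tm mult.assoc nn pts sin_squared_eq)
    also have "t E E = of_real ((sin (r v))\<^sup>2)"
      by (simp add: t_def complex_eq_iff nn pts sin_squared_eq power2_eq_square[symmetric])
    finally show ?thesis by (simp add: \<rho>_def power_mult_distrib power4_eq_xxxx power2_eq_square ac_simps)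
  qed
  moreover have "t E N * t N W * t W S * t S E = of_real (\<rho> ^ 4) * cis s"
    unfolding t1 t2 t3 t4 s_def by (simp add: cis_mult[symmetric] power4_eq_xxxx)
  ultimately have "cis s = 1" using \<rho>0 by simp
  then have "cos s = 1" by (simp add: complex_eq_iff)
  then obtain k :: int where k: "s = k * 2 * pi" using cos_one_2pi_int by auto
  have th: "0 < \<theta> w \<and> \<theta> w < pi" if "w \<in> nbrs Q v" for w
  proof -
    have "w \<in> G_verts Q" using nbrs_G_verts[of v] that vG v by blast
    then show ?thesis unfolding \<theta>_def using turn_angle_cos_sin(4,5)[OF rv radii] by blast
  qed
  have "0 < s" "s < 4 * pi"
    using th[of "(m + 1, n + 1)"] th[of "(m - 1, n + 1)"] th[of "(m - 1, n - 1)"] th[of "(m + 1, n - 1)"] nb v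
    by (auto simp: s_def)
  then have "0 < real_of_int k" "real_of_int k < 2"
    unfolding k using pi_gt_zero by (auto simp: zero_less_mult_iff) 
  then have "k = 1" by linarith
  then have "s = 2 * pi" using k by simp
  moreover have "(\<Sum>w\<in>nbrs Q v. \<theta> w) = s"
    unfolding v nb s_def by simp
  ultimately show ?thesis by (simp add: \<theta>_def)
qed

section \<open>Moving frames on the sphere\<close>

(* Only components of vectors are written with the dollar sign here. *)
no_notation fps_nth (infixl "$" 75)

lemma inv_rotation:
  fixes f :: "real^3 \<Rightarrow> real^3"
  assumes f: "bij f" "\<forall>x y. f x \<bullet> f y = x \<bullet> y" "\<forall>x y. f (cross3 x y) = cross3 (f x) (f y)"
  shows "bij (inv f)" "inv f x \<bullet> inv f y = x \<bullet> y" "inv f (cross3 x y) = cross3 (inv f x) (inv f y)"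
proof -
  have s: "f (inv f x) = x" "inv f (f x) = x" for x using f(1) by (auto simp: bij_is_surj surj_f_inv_f bij_is_inj)
  show "bij (inv f)" using f(1) by (rule bij_imp_bij_inv)
  show "inv f x \<bullet> inv f y = x \<bullet> y" using f(2)[rule_format, of "inv f x" "inv f y"] by (simp add: s)
  show "inv f (cross3 x y) = cross3 (inv f x) (inv f y)"
    using f(3)[rule_format, of "inv f x" "inv f y"] s by metis
qed

text \<open>Rotations of space, written as an additive group, since the class \<open>group_add\<close> does not presuppose
  commutativity. A rotation \<open>X\<close> is read as a moving frame: the first axis is sent to a point of the sphere and the
  second one to the heading at that point.\<close>

typedef rotation = "{f :: real^3 \<Rightarrow> real^3. bij f \<and> (\<forall>x y. f x \<bullet> f y = x \<bullet> y) \<and> (\<forall>x y. f (cross3 x y) = cross3 (f x) (f y))}"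
  morphisms rotate Abs_rotation
  by (rule exI[of _ id]) auto

setup_lifting type_definition_rotation

instantiation rotation :: group_add
begin

lift_definition zero_rotation :: rotation is id by auto

lift_definition plus_rotation :: "rotation \<Rightarrow> rotation \<Rightarrow> rotation" is "(\<circ>)"
  by (auto simp: bij_comp)

lift_definition uminus_rotation :: "rotation \<Rightarrow> rotation" is inv
  using inv_rotation by blast

definition minus_rotation :: "rotation \<Rightarrow> rotation \<Rightarrow> rotation" where
  "minus_rotation a b = a + - b"

instance
proof
  fix a b c :: rotation
  show "a + b + c = a + (b + c)" by transfer auto
  show "0 + a = a" by transfer auto
  show "a + 0 = a" by transfer auto
  show "- a + a = 0" by transfer (auto simp: bij_is_inj)
  show "a + - b = a - b" by (simp add: minus_rotation_def)
qed

end

lemma rotate_plus: "rotate (a + b) x = rotate a (rotate b x)"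
  by transfer simp

lemma rotate_inner: "rotate a x \<bullet> rotate a y = x \<bullet> y"
  by transfer auto

lemma rotate_cross: "cross3 (rotate a x) (rotate a y) = rotate a (cross3 x y)"
  by transfer auto

lemma vec3_eq_iff: "(x::real^3) = y \<longleftrightarrow> x$1 = y$1 \<and> x$2 = y$2 \<and> x$3 = y$3"
  by (simp add: vec_eq_iff forall_3)

text \<open>The frame \<open>X + turn \<alpha>\<close> stands at the same point as \<open>X\<close>, with heading turned to the left by \<open>\<alpha>\<close>.\<close>

lift_definition turn :: "real \<Rightarrow> rotation" is
  "\<lambda>\<alpha> x. vector [x$1, cos \<alpha> * x$2 - sin \<alpha> * x$3, sin \<alpha> * x$2 + cos \<alpha> * x$3]"
proof (intro CollectI conjI allI)
  fix \<alpha> :: real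
  have cs: "sin \<alpha> * sin \<alpha> + cos \<alpha> * cos \<alpha> = 1" using sin_cos_squared_add[of \<alpha>] by (simp add: power2_eq_square)
  let ?f = "\<lambda>\<alpha> (x::real^3). vector [x$1, cos \<alpha> * x$2 - sin \<alpha> * x$3, sin \<alpha> * x$2 + cos \<alpha> * x$3] :: real^3"
  have 1: "?f (- \<alpha>) (?f \<alpha> x) = x" and 2: "?f \<alpha> (?f (- \<alpha>) x) = x" for x :: "real^3"
    unfolding vec3_eq_iff vector_3 sin_minus cos_minus using cs by (intro conjI refl; algebra)+
  show "bij (?f \<alpha>)" by (rule o_bij[of "?f (- \<alpha>)"]) (use 1 2 in \<open>auto simp: fun_eq_iff\<close>)
  show "?f \<alpha> x \<bullet> ?f \<alpha> y = x \<bullet> y" for x y :: "real^3"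
    unfolding inner_vec_def sum_3 vector_3 inner_real_def using cs by algebra
  show "?f \<alpha> (cross3 x y) = cross3 (?f \<alpha> x) (?f \<alpha> y)" for x y :: "real^3"
    unfolding vec3_eq_iff cross3_def vector_3
    by (intro conjI) (use cs in \<open>algebra | simp add: algebra_simps\<close>)+
qed

text \<open>The frame \<open>X + move \<alpha>\<close> has moved from \<open>X\<close> straight ahead by the length \<open>\<alpha>\<close>.\<close>

lift_definition move :: "real \<Rightarrow> rotation" is
  "\<lambda>\<alpha> x. vector [cos \<alpha> * x$1 - sin \<alpha> * x$2, sin \<alpha> * x$1 + cos \<alpha> * x$2, x$3]"
proof (intro CollectI conjI allI)
  fix \<alpha> :: real
  have cs: "sin \<alpha> * sin \<alpha> + cos \<alpha> * cos \<alpha> = 1" using sin_cos_squared_add[of \<alpha>] by (simp add: power2_eq_square)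
  let ?f = "\<lambda>\<alpha> (x::real^3). vector [cos \<alpha> * x$1 - sin \<alpha> * x$2, sin \<alpha> * x$1 + cos \<alpha> * x$2, x$3] :: real^3"
  have 1: "?f (- \<alpha>) (?f \<alpha> x) = x" and 2: "?f \<alpha> (?f (- \<alpha>) x) = x" for x :: "real^3"
    unfolding vec3_eq_iff vector_3 sin_minus cos_minus using cs by (intro conjI refl; algebra)+
  show "bij (?f \<alpha>)" by (rule o_bij[of "?f (- \<alpha>)"]) (use 1 2 in \<open>auto simp: fun_eq_iff\<close>)
  show "?f \<alpha> x \<bullet> ?f \<alpha> y = x \<bullet> y" for x y :: "real^3"
    unfolding inner_vec_def sum_3 vector_3 inner_real_def using cs by algebra
  show "?f \<alpha> (cross3 x y) = cross3 (?f \<alpha> x) (?f \<alpha> y)" for x y :: "real^3"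
    unfolding vec3_eq_iff cross3_def vector_3
    by (intro conjI) (use cs in \<open>algebra | simp add: algebra_simps\<close>)+
qed

lemma rotate_turn: "rotate (turn \<alpha>) x = vector [x$1, cos \<alpha> * x$2 - sin \<alpha> * x$3, sin \<alpha> * x$2 + cos \<alpha> * x$3]"
  by transfer simp

lemma rotate_move: "rotate (move \<alpha>) x = vector [cos \<alpha> * x$1 - sin \<alpha> * x$2, sin \<alpha> * x$1 + cos \<alpha> * x$2, x$3]"
  by transfer simp

lemma rotation_eqI: "(\<And>x. rotate a x = rotate b x) \<Longrightarrow> a = b"
  by transfer auto

lemma turn_add: "turn a + turn b = turn (a + b)"
  by (rule rotation_eqI) (simp add: rotate_plus rotate_turn vec3_eq_iff cos_add sin_add algebra_simps)

lemma move_add: "move a + move b = move (a + b)"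
  by (rule rotation_eqI) (simp add: rotate_plus rotate_move vec3_eq_iff cos_add sin_add algebra_simps)

lemma turn_0: "turn 0 = 0" and move_0: "move 0 = 0"
  by (rule rotation_eqI, simp add: rotate_turn rotate_move vec3_eq_iff zero_rotation.rep_eq)+

lemma turn_add_left: "turn a + (turn b + x) = turn (a + b) + x"
  by (simp add: add.assoc[symmetric] turn_add)

lemma move_add_left: "move a + (move b + x) = move (a + b) + x"
  by (simp add: add.assoc[symmetric] move_add)

lemma move_minus_turn: "move (- a) = turn pi + move a + turn pi"
  by (rule rotation_eqI) (simp add: rotate_plus rotate_turn rotate_move vec3_eq_iff)

lemma turn_periodic: "turn (a + 2 * pi) = turn a"
  by (rule rotation_eqI) (simp add: rotate_turn)

text \<open>In a right-angled triangle with legs \<open>a\<close>, \<open>b\<close> one may walk along the legs or along the hypotenuse \<open>d\<close>. The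
  legs may be negative, which is why the angles are given by cosine and sine.\<close>

lemma right_triangle_rotation:
  assumes d: "cos d = cos a * cos b" "0 < sin d"
    and A: "cos A = sin a * cos b / sin d" "sin A = sin b / sin d"
    and B: "cos B = cos a * sin b / sin d" "sin B = sin a / sin d"
  shows "move a + turn (pi/2) + move b = turn A + move d + turn B"
    and "move a + turn (- (pi/2)) + move b = turn (- A) + move d + turn (- B)"
proof -
  have AB: "sin d * cos A = sin a * cos b" "sin d * sin A = sin b" "sin d * cos B = cos a * sin b" "sin d * sin B = sin a"
    using d(2) A B by simp_all
  have trig: "(sin x)\<^sup>2 + (cos x)\<^sup>2 = 1" for x :: real by simp
  have d2: "(sin d)\<^sup>2 = 1 - (cos a * cos b)\<^sup>2" using trig[of d] d(1) by simp
  have cancel: "x = y" if "(sin d)\<^sup>2 * x = (sin d)\<^sup>2 * y" for x y using that d(2) by simp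
  \<comment> \<open>The lower right block of the matrices; the factor \<open>(sin d)\<^sup>2\<close> makes these identities polynomial.\<close>
  have e22: "cos A * cos d * cos B - sin A * sin B = - sin a * sin b"
    by (rule cancel) (use AB d2 d(1) trig[of a] trig[of b] in algebra)
  have e23: "- cos A * cos d * sin B - sin A * cos B = - cos a"
    by (rule cancel) (use AB d2 d(1) trig[of a] trig[of b] in algebra)
  have e32: "sin A * cos d * cos B + cos A * sin B = cos b"
    by (rule cancel) (use AB d2 d(1) trig[of a] trig[of b] in algebra)
  have e33: "cos A * cos B - sin A * cos d * sin B = 0"
    by (rule cancel) (use AB d2 d(1) trig[of a] trig[of b] in algebra)
  show "move a + turn (pi/2) + move b = turn A + move d + turn B"
  proof (rule rotation_eqI)
    fix x
    show "rotate (move a + turn (pi/2) + move b) x = rotate (turn A + move d + turn B) x"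
      unfolding rotate_plus rotate_turn rotate_move vec3_eq_iff vector_3 cos_pi_half sin_pi_half
      using AB e22 e23 e32 e33 d(1) by (intro conjI; algebra)
  qed
  show "move a + turn (- (pi/2)) + move b = turn (- A) + move d + turn (- B)"
  proof (rule rotation_eqI)
    fix x
    show "rotate (move a + turn (- (pi/2)) + move b) x = rotate (turn (- A) + move d + turn (- B)) x"
      unfolding rotate_plus rotate_turn rotate_move vec3_eq_iff vector_3 cos_minus sin_minus cos_pi_half sin_pi_half
      using AB e22 e23 e32 e33 d(1) by (intro conjI; algebra)
  qed
qed

text \<open>Two ways around the quadrilateral of two neighbouring rings lead to the same frame, since both agree with
  the walk along its diagonal. The first equation starts at a centre, the second one at a touching point; the latter
  is the mirror image of the former.\<close>

lemma ring_square_rotation: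
  assumes v: "ring_radii q r R" and w: "ring_radii q r' R'"
  defines "\<theta> \<equiv> turn_angle r R r' R'" and "\<theta>' \<equiv> turn_angle r' R' r R"
  shows "move r + turn (pi/2) + move R' = turn \<theta> + move R + turn (- (pi/2)) + move r' + turn \<theta>'"
    and "move r + turn (pi - \<theta>) + move R = turn (pi/2) + move R' + turn (\<theta>' - pi) + move r' + turn (pi/2)"
proof -
  note bv = ring_radii_bounds[OF v] and bw = ring_radii_bounds[OF w]
  have qq: "cos R * cos r' = cos r * cos R'" using v w by (simp add: ring_radii_def)
  have trig: "(sin x)\<^sup>2 + (cos x)\<^sup>2 = 1" for x :: real by simp
  define \<Delta> where "\<Delta> = 1 - (cos r * cos R')\<^sup>2"
  have \<Delta>: "0 < \<Delta>" using turn_angle_cos_sin(1)[OF v w] by (simp add: \<Delta>_def)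
  define d where "d = arccos (cos r * cos R')"
  have "\<bar>cos r * cos R'\<bar> \<le> 1" using \<Delta> by (simp add: \<Delta>_def abs_square_le_1[symmetric])
  then have d: "cos d = cos r * cos R'" "sin d = sqrt \<Delta>"
    by (simp_all add: d_def cos_arccos_abs sin_arccos_abs \<Delta>_def)
  have d0: "0 < sin d" using d \<Delta> by simp
  define \<phi> \<psi> where "\<phi> = pi/2 - arctan (sin r * cos R' / sin R')" and "\<psi> = arctan (sin r' / (sin R * cos r'))"
  define \<phi>' \<psi>' where "\<phi>' = pi/2 - arctan (sin r' * cos R / sin R)" and "\<psi>' = arctan (sin r / (sin R' * cos r))"
  have \<theta>: "\<theta> = \<phi> + \<psi>" "\<theta>' = \<phi>' + \<psi>'"
    by (simp_all add: \<theta>_def \<theta>'_def \<phi>_def \<psi>_def \<phi>'_def \<psi>'_def turn_angle_def)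
  have d1: "(sin r * cos R')\<^sup>2 + (sin R')\<^sup>2 = \<Delta>"
    unfolding \<Delta>_def using trig[of r] trig[of R'] by algebra
  have d2: "(sin r')\<^sup>2 + (sin R * cos r')\<^sup>2 = \<Delta>"
    unfolding \<Delta>_def using trig[of r'] trig[of R] qq by algebra
  have d3: "(sin r' * cos R)\<^sup>2 + (sin R)\<^sup>2 = \<Delta>"
    unfolding \<Delta>_def using trig[of r'] trig[of R] qq by algebra
  have d4: "(sin r)\<^sup>2 + (sin R' * cos r)\<^sup>2 = \<Delta>"
    unfolding \<Delta>_def using trig[of r] trig[of R'] by algebra
  have p: "0 < sin R * cos r'" "0 < sin R' * cos r" using bv bw by simp_all
  have \<phi>: "cos \<phi> = sin r * cos R' / sin d" "sin \<phi> = sin R' / sin d"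
    using cos_sin_arctan_quotient[OF bw(3), of "sin r * cos R'"] by (simp_all add: \<phi>_def cos_diff sin_diff d1 d)
  have \<phi>': "cos \<phi>' = cos R * sin r' / sin d" "sin \<phi>' = sin R / sin d"
    using cos_sin_arctan_quotient[OF bv(3), of "sin r' * cos R"] by (simp_all add: \<phi>'_def cos_diff sin_diff d3 d)
  have \<psi>: "cos \<psi> = sin R * cos r' / sin d" "sin \<psi> = sin r' / sin d"
    using cos_sin_arctan_quotient[OF p(1), of "sin r'"] by (simp_all add: \<psi>_def d2 d)
  have \<psi>': "cos \<psi>' = cos r * sin R' / sin d" "sin \<psi>' = sin r / sin d"
    using cos_sin_arctan_quotient[OF p(2), of "sin r"] by (simp_all add: \<psi>'_def d4 d)
  have dq: "cos d = cos R * cos r'" using d qq by simp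
  note t1 = right_triangle_rotation[OF d(1) d0 \<phi> \<psi>']
  note t2 = right_triangle_rotation[OF dq d0 \<psi> \<phi>']
  have "turn \<theta> + (move R + turn (- (pi/2)) + move r') + turn \<theta>' = turn \<phi> + move d + turn \<psi>'"
    unfolding t2(2) \<theta> by (simp add: add.assoc turn_add turn_add_left)
  then show "move r + turn (pi/2) + move R' = turn \<theta> + move R + turn (- (pi/2)) + move r' + turn \<theta>'"
    unfolding t1(1) by (simp add: add.assoc)
  \<comment> \<open>The mirror image of the first equation. Inverting the moves by \<open>r\<close> and \<open>r'\<close> and writing each inverse move as
    a move between two half turns gives the second equation.\<close>
  have m: "turn (- \<theta>) + (move R + turn (pi/2) + move r') + turn (- \<theta>') = move r + turn (- (pi/2)) + move R'"
    unfolding t2(1) t1(2) \<theta> by (simp add: add.assoc turn_add turn_add_left)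
  have tp: "turn pi + turn pi = 0" using turn_periodic[of 0] by (simp add: turn_add turn_0)
  have "move (- r) + (turn (- \<theta>) + (move R + turn (pi/2) + move r') + turn (- \<theta>')) + turn \<theta>' + move (- r') + turn (- (pi/2))
    = move (- r) + (move r + turn (- (pi/2)) + move R') + turn \<theta>' + move (- r') + turn (- (pi/2))"
    unfolding m ..
  then have "move (- r) + turn (- \<theta>) + move R = turn (- (pi/2)) + move R' + turn \<theta>' + move (- r') + turn (- (pi/2))"
    by (simp add: add.assoc turn_add turn_add_left move_add move_add_left turn_0 move_0)
  then have "turn (- pi) + (turn pi + move r + turn pi + turn (- \<theta>) + move R)
    = turn (- pi) + (turn (- (pi/2)) + move R' + turn \<theta>' + (turn pi + move r' + turn pi) + turn (- (pi/2)))"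
    unfolding move_minus_turn by (simp only:)
  moreover have "turn (- pi - pi/2) = turn (pi/2)" using turn_periodic[of "- pi - pi/2"] by (simp add: field_simps)
  moreover have "turn (\<theta>' + pi) = turn (\<theta>' - pi)" using turn_periodic[of "\<theta>' - pi"] by (simp add: algebra_simps)
  ultimately show "move r + turn (pi - \<theta>) + move R = turn (pi/2) + move R' + turn (\<theta>' - pi) + move r' + turn (pi/2)"
    by (simp add: add.assoc turn_add turn_add_left turn_0 algebra_simps)
qed

section \<open>From the angle condition to a pattern\<close>

definition pos :: "rotation \<Rightarrow> real^3" where
  "pos X = rotate X (axis 1 1)"

lemma axis_components: "(axis 1 1 :: real^3) $ 1 = 1" "(axis 1 1 :: real^3) $ 2 = 0" "(axis 1 1 :: real^3) $ 3 = 0"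
  by (simp_all add: axis_def)

lemma rotate_move_axis: "rotate (move a) (axis 1 1) = vector [cos a, sin a, 0]"
  by (simp add: rotate_move axis_components vec3_eq_iff)

lemma pos_turn: "pos (X + turn a) = pos X"
proof -
  have "rotate (turn a) (axis 1 1) = axis 1 1"
    by (simp add: rotate_turn axis_components vec3_eq_iff)
  then show ?thesis by (simp add: pos_def rotate_plus)
qed

lemma norm_pos: "norm (pos X) = 1"
  by (simp add: pos_def norm_eq_1 rotate_inner inner_axis_axis)

lemma pos_move_inner: "pos X \<bullet> pos (X + move a) = cos a"
  by (simp add: pos_def rotate_plus rotate_inner rotate_move_axis)
     (simp add: inner_vec_def sum_3 axis_components)

text \<open>Pythagoras' theorem on the sphere.\<close>

lemma pos_right_angle_inner: "pos (X + move a) \<bullet> pos (X + turn (pi/2) + move b) = cos a * cos b"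
  by (simp add: pos_def rotate_plus rotate_inner rotate_move_axis rotate_turn)
     (simp add: inner_vec_def sum_3)

text \<open>The orientation of a corner with signed sides \<open>a\<close>, \<open>b\<close> and angle \<open>\<alpha>\<close>.\<close>

lemma pos_corner_triple:
  "pos X \<bullet> cross3 (pos (X + move a)) (pos (X + turn \<alpha> + move b)) = sin a * sin b * sin \<alpha>"
  by (simp add: pos_def rotate_plus rotate_inner rotate_cross rotate_move_axis rotate_turn)
     (simp add: inner_vec_def sum_3 axis_components cross3_def)

locale ring_angle_data =
  fixes Q :: "lattice set" and q :: real and r R :: "lattice \<Rightarrow> real"
  assumes complex: "simply_connected_complex Q"
    and radii: "\<And>v. v \<in> G_verts Q \<Longrightarrow> ring_radii q (r v) (R v)"
    and angle_sum: "\<And>v. v \<in> internal_verts Q \<Longrightarrow> (\<Sum>w\<in>nbrs Q v. turn_angle (r v) (R v) (r w) (R w)) = 2 * pi"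
begin

text \<open>The signed length of the horizontal edge to the right of \<open>(i, j)\<close>; \<open>vlen\<close> is that of the vertical edge above: at its even
  end point an edge is a radius of the inner circle if it is horizontal and of the outer circle if it is vertical.\<close>

definition hlen :: "int \<Rightarrow> int \<Rightarrow> real" where
  "hlen i j = (if even (i + j) then r (i, j) else r (i + 1, j))"

definition vlen :: "int \<Rightarrow> int \<Rightarrow> real" where
  "vlen i j = (if even (i + j) then R (i, j) else R (i, j + 1))"

text \<open>The angle at \<open>v\<close> of the quadrilateral of a square with opposite corners \<open>v\<close> and \<open>w\<close>.\<close>

definition corner_angle :: "lattice \<Rightarrow> lattice \<Rightarrow> real" where
  "corner_angle v w = (if even (fst v + snd v) then turn_angle (r v) (R v) (r w) (R w) else pi/2)"

abbreviation "sw i j \<equiv> corner_angle (i, j) (i + 1, j + 1)"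
abbreviation "se i j \<equiv> corner_angle (i + 1, j) (i, j + 1)"
abbreviation "ne i j \<equiv> corner_angle (i + 1, j + 1) (i, j)"
abbreviation "nw i j \<equiv> corner_angle (i, j + 1) (i + 1, j)"

lemma corner_G: "s \<in> Q \<Longrightarrow> v \<in> corners s \<Longrightarrow> even (fst v + snd v) \<Longrightarrow> v \<in> G_verts Q"
  by (auto simp: G_verts_def verts_def)

text \<open>From the lower left corner, heading east, to the upper right corner, heading north.\<close>

lemma square_rotation:
  assumes "(i, j) \<in> Q"
  shows "move (hlen i j) + turn (pi - se i j) + move (vlen (i + 1) j)
    = turn (sw i j) + move (vlen i j) + turn (nw i j - pi) + move (hlen i (j + 1)) + turn (ne i j)"
proof (cases "even (i + j)")
  case True
  have "ring_radii q (r (i, j)) (R (i, j))" "ring_radii q (r (i + 1, j + 1)) (R (i + 1, j + 1))"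
    using radii corner_G[OF assms] True by (auto simp: corners_def)
  from ring_square_rotation(1)[OF this] show ?thesis
    using True by (simp add: hlen_def vlen_def corner_angle_def)
next
  case False
  have "ring_radii q (r (i + 1, j)) (R (i + 1, j))" "ring_radii q (r (i, j + 1)) (R (i, j + 1))"
    using radii corner_G[OF assms] False by (auto simp: corners_def)
  from ring_square_rotation(2)[OF this] show ?thesis
    using False by (simp add: hlen_def vlen_def corner_angle_def)
qed

text \<open>At points of \<open>Gstar_verts\<close> four right angles meet; at centres this is the hypothesis.\<close>

lemma vertex_angle_sum:
  assumes "{(i, j), (i + 1, j), (i, j + 1), (i + 1, j + 1)} \<subseteq> Q"
  shows "ne i j + nw (i + 1) j + se i (j + 1) + sw (i + 1) (j + 1) = 2 * pi"
proof (cases "even (i + j)")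
  case True
  let ?v = "(i + 1, j + 1)"
  have n1: "(i + 2, j + 2) \<in> nbrs Q ?v" unfolding nbrs_def mem_Collect_eq
    by (intro conjI bexI[of _ "(i + 1, j + 1)"]) (use assms in \<open>simp_all add: corners_def\<close>)
  have n2: "(i, j + 2) \<in> nbrs Q ?v" unfolding nbrs_def mem_Collect_eq
    by (intro conjI bexI[of _ "(i, j + 1)"]) (use assms in \<open>simp_all add: corners_def\<close>)
  have n3: "(i, j) \<in> nbrs Q ?v" unfolding nbrs_def mem_Collect_eq
    by (intro conjI bexI[of _ "(i, j)"]) (use assms in \<open>simp_all add: corners_def\<close>)
  have n4: "(i + 2, j) \<in> nbrs Q ?v" unfolding nbrs_def mem_Collect_eq
    by (intro conjI bexI[of _ "(i + 1, j)"]) (use assms in \<open>simp_all add: corners_def\<close>)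
  have nb: "nbrs Q ?v = {(i + 2, j + 2), (i, j + 2), (i, j), (i + 2, j)}"
  proof
    show "nbrs Q ?v \<subseteq> {(i + 2, j + 2), (i, j + 2), (i, j), (i + 2, j)}"
      using nbrs_subset[of Q "i + 1" "j + 1"] by (simp add: insert_commute add.commute)
    show "{(i + 2, j + 2), (i, j + 2), (i, j), (i + 2, j)} \<subseteq> nbrs Q ?v"
      by (intro insert_subsetI empty_subsetI n1 n2 n3 n4)
  qed
  have "?v \<in> corners (i, j)" "(i, j) \<in> Q" using assms by (simp_all add: corners_def)
  then have "?v \<in> G_verts Q" using corner_G[of "(i, j)" ?v] True by simp
  then have "?v \<in> internal_verts Q" by (simp add: internal_verts_def nb)
  from angle_sum[OF this]
  have sum: "(\<Sum>w\<in>{(i + 2, j + 2), (i, j + 2), (i, j), (i + 2, j)}. corner_angle ?v w) = 2 * pi"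
    unfolding nb using True by (simp add: corner_angle_def)
  have "(\<Sum>w\<in>{(i + 2, j + 2), (i, j + 2), (i, j), (i + 2, j)}. f w) = f (i + 2, j + 2) + (f (i, j + 2) + (f (i, j) + f (i + 2, j)))"
    for f :: "lattice \<Rightarrow> real" by simp
  from sum[unfolded this] have "corner_angle ?v (i, j) + corner_angle ?v (i + 2, j) + corner_angle ?v (i, j + 2) + corner_angle ?v (i + 2, j + 2) = 2 * pi"
    by linarith
  moreover have "i + 1 + 1 = i + 2" "j + 1 + 1 = j + 2" by simp_all
  ultimately show ?thesis by (simp only:)
next
  case False
  then show ?thesis by (simp add: corner_angle_def)
qed

text \<open>The frame of a square stands at its lower left corner and is headed east. A step leads to the frame of the
  neighbouring square along their common edge, or through the common corner if they share only that.\<close>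

definition step_east :: "lattice \<Rightarrow> rotation" where
  "step_east = (\<lambda>(i, j). move (hlen i j) + turn (pi - se i j - sw (i + 1) j))"

definition step_up :: "lattice \<Rightarrow> lattice \<Rightarrow> rotation" where
  "step_up = (\<lambda>(i, j) (k, l).
     turn (sw i j) + move (vlen i j) +
     (if k = i then turn (nw i j - pi)
      else if k = i + 1 then turn (nw i j - pi) + move (hlen i (j + 1))
      else move (- hlen k l)))"

lemma step_flat:
  assumes "{(i, j), (i + 1, j), (i, j + 1), (i + 1, j + 1)} \<subseteq> Q"
  shows "step_east (i, j) + step_up (i + 1, j) (i + 1, j + 1) = step_up (i, j) (i, j + 1) + step_east (i, j + 1)"
proof -
  have "step_east (i, j) + step_up (i + 1, j) (i + 1, j + 1)
      = (move (hlen i j) + turn (pi - se i j) + move (vlen (i + 1) j)) + turn (nw (i + 1) j - pi)"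
    by (simp add: step_east_def step_up_def add.assoc turn_add_left)
  also have "\<dots> = (turn (sw i j) + move (vlen i j) + turn (nw i j - pi) + move (hlen i (j + 1)) + turn (ne i j)) + turn (nw (i + 1) j - pi)"
    using square_rotation[of i j] assms by simp
  also have "\<dots> = turn (sw i j) + move (vlen i j) + turn (nw i j - pi) + move (hlen i (j + 1)) + (turn (ne i j) + turn (nw (i + 1) j - pi))"
    by (rule add.assoc)
  also have "turn (ne i j) + turn (nw (i + 1) j - pi) = turn (ne i j + nw (i + 1) j - pi)"
    unfolding turn_add by (rule arg_cong[of _ _ turn]) simp
  also have "ne i j + nw (i + 1) j - pi = pi - se i (j + 1) - sw (i + 1) (j + 1)"
    using vertex_angle_sum[OF assms] by simp
  also have "turn (sw i j) + move (vlen i j) + turn (nw i j - pi) + move (hlen i (j + 1)) + turn (pi - se i (j + 1) - sw (i + 1) (j + 1))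
      = step_up (i, j) (i, j + 1) + step_east (i, j + 1)"
    by (simp only: step_east_def step_up_def prod.case simp_thms if_True add.assoc)
  finally show ?thesis .
qed

definition corner_pos :: "(lattice \<Rightarrow> rotation) \<Rightarrow> lattice \<Rightarrow> lattice \<Rightarrow> real^3" where
  "corner_pos F = (\<lambda>(i, j) (m, n).
     if n = j then (if m = i then pos (F (i, j)) else pos (F (i, j) + move (hlen i j)))
     else if m = i then pos (F (i, j) + turn (sw i j) + move (vlen i j))
     else pos (F (i, j) + turn (sw i j) + move (vlen i j) + turn (nw i j - pi) + move (hlen i (j + 1))))"

lemma corner_pos_ne:
  assumes "(i, j) \<in> Q"
  shows "corner_pos F (i, j) (i + 1, j + 1) = pos (F (i, j) + move (hlen i j) + turn (pi - se i j) + move (vlen (i + 1) j))"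
proof -
  have "F (i, j) + move (hlen i j) + turn (pi - se i j) + move (vlen (i + 1) j)
    = F (i, j) + (move (hlen i j) + turn (pi - se i j) + move (vlen (i + 1) j))"
    by (simp add: add.assoc)
  also have "\<dots> = F (i, j) + turn (sw i j) + move (vlen i j) + turn (nw i j - pi) + move (hlen i (j + 1)) + turn (ne i j)"
    unfolding square_rotation[OF assms] by (simp add: add.assoc)
  finally show ?thesis by (simp add: corner_pos_def pos_turn)
qed

context
  fixes F :: "lattice \<Rightarrow> rotation"
  assumes east: "\<And>i j. (i, j) \<in> Q \<Longrightarrow> (i + 1, j) \<in> Q \<Longrightarrow> F (i + 1, j) = F (i, j) + step_east (i, j)"
    and up: "\<And>s t. upward_contact Q s t \<Longrightarrow> F t = F s + step_up s t"
begin

lemma corner_pos_east: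
  assumes "(i, j) \<in> Q" "(i + 1, j) \<in> Q" and x: "x \<in> corners (i, j)" "x \<in> corners (i + 1, j)"
  shows "corner_pos F (i, j) x = corner_pos F (i + 1, j) x"
proof -
  have e: "F (i + 1, j) = F (i, j) + move (hlen i j) + turn (pi - se i j - sw (i + 1) j)"
    using east[OF assms(1,2)] by (simp add: step_east_def add.assoc)
  have "x = (i + 1, j) \<or> x = (i + 1, j + 1)" using x by (auto simp: corners_def)
  then show ?thesis
  proof
    assume "x = (i + 1, j)"
    then show ?thesis by (simp add: corner_pos_def e pos_turn)
  next
    assume xe: "x = (i + 1, j + 1)"
    have "corner_pos F (i + 1, j) x = pos (F (i, j) + move (hlen i j) + turn (pi - se i j) + move (vlen (i + 1) j))"
      unfolding xe by (simp add: corner_pos_def e add.assoc turn_add_left)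
    then show ?thesis unfolding xe using corner_pos_ne[OF assms(1), of F] by simp
  qed
qed

lemma corner_pos_north:
  assumes "(i, j) \<in> Q" "(i, j + 1) \<in> Q" and x: "x \<in> corners (i, j)" "x \<in> corners (i, j + 1)"
  shows "corner_pos F (i, j) x = corner_pos F (i, j + 1) x"
proof -
  have "upward_contact Q (i, j) (i, j + 1)" using assms by (simp add: upward_contact_def)
  from up[OF this] have e: "F (i, j + 1) = F (i, j) + turn (sw i j) + move (vlen i j) + turn (nw i j - pi)"
    by (simp add: step_up_def add.assoc)
  have "x = (i, j + 1) \<or> x = (i + 1, j + 1)" using x by (auto simp: corners_def)
  then show ?thesis by (auto simp: corner_pos_def e pos_turn)
qed

text \<open>Two squares that meet at a corner are linked through a third one or are in direct contact.\<close>

lemma corner_pos_northeast: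
  assumes "(i, j) \<in> Q" "(i + 1, j + 1) \<in> Q" and x: "x \<in> corners (i, j)" "x \<in> corners (i + 1, j + 1)"
  shows "corner_pos F (i, j) x = corner_pos F (i + 1, j + 1) x"
proof -
  have xe: "x = (i + 1, j + 1)" using x by (auto simp: corners_def)
  consider "(i + 1, j) \<in> Q" | "(i, j + 1) \<in> Q" | "(i + 1, j) \<notin> Q" "(i, j + 1) \<notin> Q" by blast
  then show ?thesis
  proof cases
    case 1
    then show ?thesis
      using corner_pos_east[of i j x] corner_pos_north[of "i + 1" j x] assms xe by (simp add: corners_def)
  next
    case 2
    then show ?thesis
      using corner_pos_north[of i j x] corner_pos_east[of i "j + 1" x] assms xe by (simp add: corners_def)
  next
    case 3
    then have "upward_contact Q (i, j) (i + 1, j + 1)" using assms by (simp add: upward_contact_def)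
    from up[OF this] show ?thesis unfolding xe by (simp add: corner_pos_def step_up_def add.assoc)
  qed
qed

lemma corner_pos_northwest:
  assumes "(i + 1, j) \<in> Q" "(i, j + 1) \<in> Q" and x: "x \<in> corners (i + 1, j)" "x \<in> corners (i, j + 1)"
  shows "corner_pos F (i + 1, j) x = corner_pos F (i, j + 1) x"
proof -
  have xe: "x = (i + 1, j + 1)" using x by (auto simp: corners_def)
  consider "(i, j) \<in> Q" | "(i + 1, j + 1) \<in> Q" | "(i, j) \<notin> Q" "(i + 1, j + 1) \<notin> Q" by blast
  then show ?thesis
  proof cases
    case 1
    then show ?thesis
      using corner_pos_east[of i j x] corner_pos_north[of i j x] assms xe by (simp add: corners_def)
  next
    case 2
    then show ?thesis
      using corner_pos_north[of "i + 1" j x] corner_pos_east[of i "j + 1" x] assms xe by (simp add: corners_def)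
  next
    case 3
    then have "upward_contact Q (i + 1, j) (i, j + 1)" using assms by (simp add: upward_contact_def)
    from up[OF this] show ?thesis
      unfolding xe by (simp add: corner_pos_def step_up_def add.assoc move_add move_0)
  qed
qed

lemma corner_pos_shared:
  assumes st: "s \<in> Q" "t \<in> Q" and x: "x \<in> corners s" "x \<in> corners t"
  shows "corner_pos F s x = corner_pos F t x"
proof -
  obtain i j where s: "s = (i, j)" by (cases s)
  obtain k l where t: "t = (k, l)" by (cases t)
  have k: "k = i \<or> k = i + 1 \<or> i = k + 1" and l: "l = j \<or> l = j + 1 \<or> j = l + 1"
    using x unfolding s t by (auto simp: corners_def)
  note in_place = st[unfolded s t] x[unfolded s t]
  from k show ?thesis unfolding s t
  proof (elim disjE)
    assume k: "k = i"
    from l show "corner_pos F (i, j) x = corner_pos F (k, l) x"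
      using corner_pos_north[of i j x] corner_pos_north[of i l x] in_place unfolding k by (elim disjE) simp_all
  next
    assume k: "k = i + 1"
    from l show "corner_pos F (i, j) x = corner_pos F (k, l) x"
      using corner_pos_east[of i j x] corner_pos_northeast[of i j x] corner_pos_northwest[of i l x] in_place
      unfolding k by (elim disjE) simp_all
  next
    assume k: "i = k + 1"
    from l show "corner_pos F (i, j) x = corner_pos F (k, l) x"
      using corner_pos_east[of k j x] corner_pos_northwest[of k j x] corner_pos_northeast[of k l x] in_place
      unfolding k by (elim disjE) simp_all
  qed
qed

definition place :: "lattice \<Rightarrow> real^3" where
  "place x = corner_pos F (SOME s. s \<in> Q \<and> x \<in> corners s) x"

lemma place_eq: "s \<in> Q \<Longrightarrow> x \<in> corners s \<Longrightarrow> place x = corner_pos F s x"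
  unfolding place_def by (rule corner_pos_shared) (metis (mono_tags, lifting) someI)+

lemma norm_place: "norm (place x) = 1"
  by (auto simp: place_def corner_pos_def norm_pos split: prod.split)

text \<open>The side lengths, oriented angles and one diagonal of the quadrilateral that a square is placed on. For the
  angles at the other corners the frame is carried there along the boundary.\<close>

lemma place_square:
  assumes s: "(i, j) \<in> Q"
  defines "P0 \<equiv> place (i, j)" and "P1 \<equiv> place (i + 1, j)" and "P2 \<equiv> place (i + 1, j + 1)" and "P3 \<equiv> place (i, j + 1)"
  shows "P0 \<bullet> P1 = cos (hlen i j)" "P0 \<bullet> P3 = cos (vlen i j)"
    "P3 \<bullet> P2 = cos (hlen i (j + 1))" "P1 \<bullet> P2 = cos (vlen (i + 1) j)"
    and "P0 \<bullet> cross3 P1 P3 = sin (hlen i j) * sin (vlen i j) * sin (sw i j)"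
    and "P1 \<bullet> cross3 P2 P0 = sin (hlen i j) * sin (vlen (i + 1) j) * sin (se i j)"
    and "P2 \<bullet> cross3 P3 P1 = sin (hlen i (j + 1)) * sin (vlen (i + 1) j) * sin (ne i j)"
    and "P3 \<bullet> cross3 P0 P2 = sin (hlen i (j + 1)) * sin (vlen i j) * sin (nw i j)"
    and "even (i + j) \<Longrightarrow> P0 \<bullet> P2 = cos (hlen i j) * cos (vlen (i + 1) j)"
    and "odd (i + j) \<Longrightarrow> P1 \<bullet> P3 = cos (hlen i j) * cos (vlen i j)"
proof -
  let ?X = "F (i, j)"
  have c: "(i, j) \<in> corners (i, j)" "(i + 1, j) \<in> corners (i, j)" "(i + 1, j + 1) \<in> corners (i, j)" "(i, j + 1) \<in> corners (i, j)"
    by (simp_all add: corners_def)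
  let ?A = "?X + move (hlen i j)" and ?B = "?X + turn (sw i j) + move (vlen i j)"
  let ?C = "?B + turn (nw i j - pi) + move (hlen i (j + 1))"
  let ?C' = "?A + turn (pi - se i j) + move (vlen (i + 1) j)"
  have P: "P0 = pos ?X" "P1 = pos ?A" "P3 = pos ?B" "P2 = pos ?C"
    by (simp_all add: P0_def P1_def P2_def P3_def place_eq[OF s c(1)] place_eq[OF s c(2)] place_eq[OF s c(3)] place_eq[OF s c(4)] corner_pos_def)
  have P2': "P2 = pos ?C'" using corner_pos_ne[OF s, of F] by (simp add: P2_def place_eq[OF s c(3)])
  \<comment> \<open>The two ways to the upper right corner, headed east and north.\<close>
  have CC: "?C + turn (ne i j) = ?C'"
    using square_rotation[OF s] by (simp add: add.assoc)
  show "P0 \<bullet> P1 = cos (hlen i j)" unfolding P by (rule pos_move_inner)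
  show "P0 \<bullet> P3 = cos (vlen i j)" unfolding P using pos_move_inner[of "?X + turn (sw i j)"] by (simp add: pos_turn)
  show "P3 \<bullet> P2 = cos (hlen i (j + 1))" unfolding P using pos_move_inner[of "?B + turn (nw i j - pi)"] by (simp add: pos_turn)
  show "P1 \<bullet> P2 = cos (vlen (i + 1) j)" unfolding P2' P(2) using pos_move_inner[of "?A + turn (pi - se i j)"] by (simp add: pos_turn)
  show "P0 \<bullet> cross3 P1 P3 = sin (hlen i j) * sin (vlen i j) * sin (sw i j)"
    unfolding P by (rule pos_corner_triple)
  have A0: "?A + move (- hlen i j) = ?X" by (simp add: add.assoc move_add move_0)
  show "P1 \<bullet> cross3 P2 P0 = sin (hlen i j) * sin (vlen (i + 1) j) * sin (se i j)"
    using pos_corner_triple[of ?A "- hlen i j" "pi - se i j" "vlen (i + 1) j", unfolded A0] cross_skew[of P2 P0]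
    unfolding P(1,2) P2' by (simp add: sin_diff)
  have C3: "pos (?C + move (- hlen i (j + 1))) = pos ?B" 
    using pos_turn[of ?B] by (simp add: add.assoc move_add move_0)
  have C1: "pos (?C + turn (ne i j) + move (- vlen (i + 1) j)) = pos ?A"
    unfolding CC using pos_turn[of ?A] by (simp add: add.assoc move_add move_0)
  show "P2 \<bullet> cross3 P3 P1 = sin (hlen i (j + 1)) * sin (vlen (i + 1) j) * sin (ne i j)"
    using pos_corner_triple[of ?C "- hlen i (j + 1)" "ne i j" "- vlen (i + 1) j", unfolded C3 C1]
    unfolding P by simp
  have B0: "pos (?B + turn (nw i j - pi) + turn (pi - nw i j) + move (- vlen i j)) = pos ?X"
    using pos_turn[of ?X] by (simp add: add.assoc turn_add turn_add_left turn_0 move_add move_0)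
  show "P3 \<bullet> cross3 P0 P2 = sin (hlen i (j + 1)) * sin (vlen i j) * sin (nw i j)"
    using pos_corner_triple[of "?B + turn (nw i j - pi)" "hlen i (j + 1)" "pi - nw i j" "- vlen i j", unfolded B0 pos_turn]
      cross_skew[of P0 P2]
    unfolding P by (simp add: sin_diff)
  show "P0 \<bullet> P2 = cos (hlen i j) * cos (vlen (i + 1) j)" if "even (i + j)"
  proof -
    have "pi - se i j = pi/2" using that by (simp add: corner_angle_def)
    with P2' have e: "P2 = pos (?A + turn (pi/2) + move (vlen (i + 1) j))" by (simp only:)
    show ?thesis
      using pos_right_angle_inner[of ?A "- hlen i j" "vlen (i + 1) j", unfolded A0] unfolding e P(1) by simp
  qed
  show "P1 \<bullet> P3 = cos (hlen i j) * cos (vlen i j)" if "odd (i + j)"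
  proof -
    have e: "sw i j = pi/2" using that by (simp add: corner_angle_def)
    show ?thesis unfolding P e by (rule pos_right_angle_inner)
  qed
qed

text \<open>Depending on the direction of the neighbour, \<open>(m, n)\<close> is one of the four corners of the common square.\<close>

lemma place_neighbours:
  assumes v: "(m, n) \<in> G_verts Q" and w: "(m', n') \<in> nbrs Q (m, n)"
  defines "\<theta> \<equiv> turn_angle (r (m, n)) (R (m, n)) (r (m', n')) (R (m', n'))"
  shows "place (m, n) \<bullet> place (m', n) = cos (r (m, n))"
    and "place (m, n) \<bullet> place (m, n') = cos (R (m, n))"
    and "place (m, n) \<bullet> place (m', n') = cos (r (m, n)) * cos (R (m', n'))"
    and "place (m, n) \<bullet> place (m', n') = cos (R (m, n)) * cos (r (m', n'))"
    and "of_int ((m' - m) * (n' - n)) * (place (m, n) \<bullet> cross3 (place (m', n)) (place (m, n')))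
      = sin (r (m, n)) * sin (R (m, n)) * sin \<theta>"
proof -
  let ?v = "(m, n)" and ?w = "(m', n')"
  have ev: "even (m + n)" using v by (simp add: G_verts_def)
  have qq: "cos (R ?v) * cos (r ?w) = cos (r ?v) * cos (R ?w)"
    using radii[OF v] radii[OF nbrs_G_verts[OF v w]] by (simp add: ring_radii_def)
  have sk: "x \<bullet> cross3 y z = - (x \<bullet> cross3 z y)" for x y z :: "real^3"
    using cross_skew[of y z] by simp
  obtain s where s: "s \<in> Q" "?v \<in> corners s" "?w \<in> corners s" using w by (auto simp: nbrs_def)
  obtain i j where ij: "s = (i, j)" by (cases s)
  have d: "\<bar>m' - m\<bar> = 1" "\<bar>n' - n\<bar> = 1" using w by (auto simp: nbrs_def)
  consider "m = i" "n = j" "m' = i + 1" "n' = j + 1" | "m = i + 1" "n = j" "m' = i" "n' = j + 1"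
    | "m = i + 1" "n = j + 1" "m' = i" "n' = j" | "m = i" "n = j + 1" "m' = i + 1" "n' = j"
    using s d unfolding ij corners_def by auto
  then have "place ?v \<bullet> place (m', n) = cos (r ?v) \<and> place ?v \<bullet> place (m, n') = cos (R ?v) \<and>
     place ?v \<bullet> place ?w = cos (r ?v) * cos (R ?w) \<and>
     of_int ((m' - m) * (n' - n)) * (place ?v \<bullet> cross3 (place (m', n)) (place (m, n'))) = sin (r ?v) * sin (R ?v) * sin \<theta>"
  proof cases
    case 1
    have "even (i + j)" using ev 1 by simp
    then have h: "hlen i j = r ?v" "vlen i j = R ?v" "vlen (i + 1) j = R ?w" "sw i j = \<theta>"
      unfolding hlen_def vlen_def corner_angle_def \<theta>_def 1 by simp_all
    have "of_int ((m' - m) * (n' - n)) = (1 :: real)" unfolding 1 by simp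
    then show ?thesis
      using place_square(1,2,5,9)[of i j, unfolded h] s(1) \<open>even (i + j)\<close> unfolding 1 ij by simp
  next
    case 2
    have "odd (i + j)" using ev unfolding 2 by presburger
    then have h: "hlen i j = r ?v" "vlen i j = R ?w" "vlen (i + 1) j = R ?v" "se i j = \<theta>"
      unfolding hlen_def vlen_def corner_angle_def \<theta>_def 2 by simp_all
    have "of_int ((m' - m) * (n' - n)) = (- 1 :: real)" unfolding 2 by simp
    then show ?thesis
      using place_square(1,4,6,10)[of i j, unfolded h] s(1) \<open>odd (i + j)\<close> sk[of "place (i + 1, j)" "place (i, j)" "place (i + 1, j + 1)"]
      unfolding 2 ij by (simp add: inner_commute)
  next
    case 3
    have "even (i + j)" using ev unfolding 3 by presburger
    then have h: "hlen i j = r ?w" "hlen i (j + 1) = r ?v" "vlen (i + 1) j = R ?v" "ne i j = \<theta>"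
      unfolding hlen_def vlen_def corner_angle_def \<theta>_def 3 by simp_all
    have "of_int ((m' - m) * (n' - n)) = (1 :: real)" unfolding 3 by simp
    then show ?thesis
      using place_square(3,4,7,9)[of i j, unfolded h] s(1) \<open>even (i + j)\<close> qq
      unfolding 3 ij by (simp add: inner_commute mult.commute)
  next
    case 4
    have "odd (i + j)" using ev unfolding 4 by presburger
    then have h: "hlen i j = r ?w" "hlen i (j + 1) = r ?v" "vlen i j = R ?v" "nw i j = \<theta>"
      unfolding hlen_def vlen_def corner_angle_def \<theta>_def 4 by simp_all
    have "of_int ((m' - m) * (n' - n)) = (- 1 :: real)" unfolding 4 by simp
    then show ?thesis
      using place_square(2,3,8,10)[of i j, unfolded h] s(1) \<open>odd (i + j)\<close> qq
        sk[of "place (i, j + 1)" "place (i + 1, j + 1)" "place (i, j)"]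
      unfolding 4 ij by (simp add: inner_commute mult.commute)
  qed
  then show "place ?v \<bullet> place (m', n) = cos (r ?v)" "place ?v \<bullet> place (m, n') = cos (R ?v)"
    "place ?v \<bullet> place ?w = cos (r ?v) * cos (R ?w)" "place ?v \<bullet> place ?w = cos (R ?v) * cos (r ?w)"
    "of_int ((m' - m) * (n' - n)) * (place ?v \<bullet> cross3 (place (m', n)) (place (m, n'))) = sin (r ?v) * sin (R ?v) * sin \<theta>"
    using qq by auto
qed

lemma place_oriented_turn:
  assumes v: "(m, n) \<in> G_verts Q" and w: "(m', n') \<in> nbrs Q (m, n)"
  shows "(m' - m) * (n' - n) = 1 \<Longrightarrow> oriented_turn (r (m, n)) (place (m, n)) (place (m', n)) (place (m, n'))"
    and "(m' - m) * (n' - n) = - 1 \<Longrightarrow> oriented_turn (r (m, n)) (place (m, n)) (place (m, n')) (place (m', n))"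
proof -
  let ?v = "(m, n)" and ?w = "(m', n')" and ?t = "place (m, n) \<bullet> cross3 (place (m', n)) (place (m, n'))"
  note rv = radii[OF v] and rw = radii[OF nbrs_G_verts[OF v w]]
  let ?\<theta> = "turn_angle (r ?v) (R ?v) (r ?w) (R ?w)"
  have s: "0 < sin (R ?v) * sin ?\<theta>"
    using ring_radii_bounds(3)[OF rv] turn_angle_cos_sin(4,5)[OF rv rw] by (simp add: sin_gt_zero)
  have "of_int ((m' - m) * (n' - n)) * ?t = sin (r ?v) * (sin (R ?v) * sin ?\<theta>)"
    using place_neighbours(5)[OF v w] by (simp add: mult.assoc)
  then have p: "0 < r ?v \<longrightarrow> 0 < of_int ((m' - m) * (n' - n)) * ?t" "r ?v < 0 \<longrightarrow> of_int ((m' - m) * (n' - n)) * ?t < 0"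
    using s ring_radii_bounds(5,6)[OF rv] by (auto simp: zero_less_mult_iff mult_less_0_iff simp del: of_int_mult)
  have sk: "place ?v \<bullet> cross3 (place (m, n')) (place (m', n)) = - ?t"
    using cross_skew[of "place (m, n')"] by simp
  show "oriented_turn (r ?v) (place ?v) (place (m', n)) (place (m, n'))" if "(m' - m) * (n' - n) = 1"
    using p sk unfolding that by (simp add: oriented_turn_def ccw_turn_def)
  show "oriented_turn (r ?v) (place ?v) (place (m, n')) (place (m', n))" if "(m' - m) * (n' - n) = - 1"
    using p sk unfolding that by (simp add: oriented_turn_def ccw_turn_def)
qed

lemma place_ring_pattern: "orthogonal_ring_pattern Q place r R place"
  unfolding orthogonal_ring_pattern_def
proof (intro conjI ballI)
  fix v assume v: "v \<in> G_verts Q"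
  show "spherical_ring (place v) (r v) (R v)"
    using radii[OF v] ring_radii_bounds(10)[OF radii[OF v]] norm_place
    by (auto simp: spherical_ring_def S2_def ring_radii_def)
next
  fix u assume "u \<in> Gstar_verts Q"
  show "place u \<in> S2" by (simp add: S2_def norm_place)
next
  fix v w assume vw: "v \<in> G_verts Q" "w \<in> nbrs Q v"
  obtain m n where mn: "v = (m, n)" by (cases v)
  obtain m' n' where mn': "w = (m', n')" by (cases w)
  have wv: "w \<in> G_verts Q" "v \<in> nbrs Q w" using nbrs_G_verts[OF vw] vw nbrs_sym by auto
  have le: "\<bar>r u\<bar> \<le> pi" "\<bar>R u\<bar> \<le> pi" if "u \<in> G_verts Q" for u
    using radii[OF that] by (auto simp: ring_radii_def)
  note N = place_neighbours[OF vw[unfolded mn mn'], folded mn mn'] and N' = place_neighbours[OF wv[unfolded mn mn'], folded mn mn']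
  have C: "place (m', n) \<in> sph_circle (place v) (r v)" "place (m, n') \<in> sph_circle (place v) (R v)"
    "place (m', n) \<in> sph_circle (place w) (R w)" "place (m, n') \<in> sph_circle (place w) (r w)"
    using N(1,2) N'(1,2) le vw wv by (simp_all add: sph_circle_iff norm_place)
  show "orthogonal_circles (place v) (R v) (place w) (r w)"
    using orthogonal_circles_iff[OF norm_place norm_place le(2)[OF vw(1)] le(1)[OF wv(1)] C(2,4)] N(4) by simp
  show "orthogonal_circles (place w) (R w) (place v) (r v)"
    using orthogonal_circles_iff[OF norm_place norm_place le(2)[OF wv(1)] le(1)[OF vw(1)] C(3,1)] N(3)
    by (simp add: inner_commute mult.commute)
next
  fix v assume v: "v \<in> G_verts Q"
  obtain m n where mn: "v = (m, n)" by (cases v)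
  have le: "\<bar>r u\<bar> \<le> pi" "\<bar>R u\<bar> \<le> pi" if "u \<in> G_verts Q" for u
    using radii[OF that] by (auto simp: ring_radii_def)
  have "place (m', n) \<in> sph_circle (place v) (r v) \<and> place (m, n') \<in> sph_circle (place v) (R v)"
    if "(m', n') \<in> nbrs Q v" for m' n'
    using place_neighbours(1,2)[OF v[unfolded mn], of m' n'] that mn le[OF v] by (simp add: sph_circle_iff norm_place)
  then show "case v of (m, n) \<Rightarrow> \<forall>(m', n')\<in>nbrs Q (m, n). place (m', n) \<in> sph_circle (place (m, n)) (r (m, n)) \<and>
        place (m, n') \<in> sph_circle (place (m, n)) (R (m, n))"
    unfolding mn by auto
next
  fix v assume v: "v \<in> G_verts Q"
  obtain m n where mn: "v = (m, n)" by (cases v)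
  note T = place_oriented_turn[OF v[unfolded mn]]
  show "case v of (m, n) \<Rightarrow>
        let turn = oriented_turn (r (m, n)) (place (m, n));
            east = place (m + 1, n); north = place (m, n + 1);
            west = place (m - 1, n); south = place (m, n - 1)
        in ((m + 1, n + 1) \<in> nbrs Q (m, n) \<longrightarrow> turn east north) \<and>
           ((m - 1, n + 1) \<in> nbrs Q (m, n) \<longrightarrow> turn north west) \<and>
           ((m - 1, n - 1) \<in> nbrs Q (m, n) \<longrightarrow> turn west south) \<and>
           ((m + 1, n - 1) \<in> nbrs Q (m, n) \<longrightarrow> turn south east)"
    unfolding mn prod.case Let_def
    using T(1)[of "m + 1" "n + 1"] T(2)[of "m - 1" "n + 1"] T(1)[of "m - 1" "n - 1"] T(2)[of "m + 1" "n - 1"] by simp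
qed

end

lemma ring_pattern_exists: "determines_ring_pattern Q r R"
proof -
  obtain F where F: "\<And>i j. (i, j) \<in> Q \<Longrightarrow> (i + 1, j) \<in> Q \<Longrightarrow> F (i + 1, j) = F (i, j) + step_east (i, j)"
    "\<And>s t. upward_contact Q s t \<Longrightarrow> F t = F s + step_up s t"
    using flat_labelling_potential[OF complex step_flat] by metis
  from place_ring_pattern[OF F] show ?thesis
    unfolding determines_ring_pattern_def by blast
qed

end

section \<open>Uniformized rings\<close>

lemma uniformized_ring_radii:
  assumes q: "0 < q" "q \<le> 1" and u: "ring_uniformization q \<beta> r R" and r: "r \<noteq> 0" and s: "0 < jacobi_sn q \<beta>"
  shows "ring_radii q r R"
proof -
  have q': "0 \<le> q" "q \<le> 1" using q by auto
  have *: "- pi < r" "r \<le> pi" "0 < R" "R < pi" "cos r = jacobi_sn q \<beta>" "sin r = jacobi_cn q \<beta>" "cos R = q * cos r"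
    using u by (auto simp: ring_uniformization_def)
  have c: "0 < cos r" using s * by simp
  have r2: "\<bar>r\<bar> < pi/2"
  proof (rule ccontr)
    assume "\<not> ?thesis"
    then have "cos \<bar>r\<bar> \<le> cos (pi/2)" using * by (subst cos_mono_le_eq) auto
    then show False using c by (simp add: cos_abs_real)
  qed
  have "R < pi/2"
  proof (rule ccontr)
    assume "\<not> ?thesis"
    then have "cos R \<le> cos (pi/2)" using * by (subst cos_mono_le_eq) auto
    then show False using c q * by (simp add: mult_le_0_iff)
  qed
  moreover have "0 < r" if "q = 1"
  proof -
    have "jacobi_am q \<beta> \<in> ell_dom q" by (rule jacobi_am(1)[OF q'])
    then have "0 < jacobi_cn q \<beta>" unfolding jacobi_cn_def using that by (intro cos_gt_zero_pi) (auto simp: ell_dom_def)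
    then have "0 < sin r" using * by simp
    then show ?thesis using sin_ge_zero[of "- r"] r2 by (cases "0 < r") auto
  qed
  ultimately show ?thesis using * q r r2 by (auto simp: ring_radii_def abs_less_iff)
qed

text \<open>The functions \<open>sn\<close>, \<open>cn\<close>, \<open>dn\<close> of the variables are sine and cosine of the radii.\<close>

lemma turn_angle_uniformized:
  assumes q: "0 < q" "q \<le> 1" 
    and v: "ring_uniformization q \<beta> r R" and w: "ring_uniformization q \<beta>' r' R'"
    and s: "0 < jacobi_sn q \<beta>'" "0 < jacobi_am q \<beta>'" "jacobi_am q \<beta>' < pi"
  shows "turn_angle r R r' R' = pi - (ring_g q (\<beta> + \<beta>') - ring_g q (\<beta> - \<beta>'))"
proof -
  have "turn_angle r R r' R' = pi/2 - arctan (q * jacobi_cn q \<beta> * jacobi_sn q \<beta>' / jacobi_dn q \<beta>')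
     + arctan (jacobi_cn q \<beta>' / (jacobi_dn q \<beta> * jacobi_sn q \<beta>'))"
    using v w by (simp add: turn_angle_def ring_uniformization_def mult_ac)
  then show ?thesis using ring_g_diff[OF q s, of \<beta>] by simp
qed

lemma acute_outer_radius_iff:
  assumes q: "0 < q" "q \<le> 1" and u: "ring_uniformization q \<beta> r R"
  shows "R < pi/2 \<longleftrightarrow> 0 < jacobi_sn q \<beta>"
proof -
  have *: "0 < R" "R < pi" "cos R = q * jacobi_sn q \<beta>" using u by (auto simp: ring_uniformization_def)
  have "R < pi/2 \<longleftrightarrow> cos (pi/2) < cos R" using * by (subst cos_mono_less_eq) auto
  then show ?thesis using * q by (simp add: zero_less_mult_iff)
qed

text \<open>\<open>2 * K\<close> is the variable with amplitude \<open>pi\<close>, if \<open>q < 1\<close>.\<close>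

lemma jacobi_am_less_pi:
  assumes q: "0 \<le> q" "q \<le> 1" and b: "ereal \<beta> \<in> {0<..<2 * ell_K q}"
  shows "0 < jacobi_am q \<beta>" "jacobi_am q \<beta> < pi"
proof -
  show "0 < jacobi_am q \<beta>"
    using jacobi_am_less_iff[OF q, of 0 \<beta>] b by (simp add: jacobi_am_0[OF q])
  show "jacobi_am q \<beta> < pi"
  proof (cases "q < 1")
    case True
    then have "2 * ell_K q = ereal (ell_F q pi)" using q by (simp add: ell_K_less_1 ell_F_pi)
    then have "\<beta> < ell_F q pi" using b by simp
    moreover have "jacobi_am q (ell_F q pi) = pi" using True by (intro jacobi_am_unique q) (simp add: ell_dom_def)
    ultimately show ?thesis using jacobi_am_less_iff[OF q, of \<beta> "ell_F q pi"] by simp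
  next
    case False
    then have "jacobi_am q \<beta> < pi/2" using jacobi_am(1)[OF q, of \<beta>] by (auto simp: ell_dom_def)
    then show ?thesis using pi_gt_zero by linarith
  qed
qed

theorem theorem2p6:
  fixes Q :: "lattice set" and q :: real and \<beta> r R :: "lattice \<Rightarrow> real"
  assumes "0 < q" and "q \<le> 1"
    and "simply_connected_complex Q"
    and "\<And>v. v \<in> G_verts Q \<Longrightarrow> ereal (\<beta> v) \<in> {- (2 * ell_K q)<..2 * ell_K q}"
    and "\<And>v. v \<in> G_verts Q \<Longrightarrow> ring_uniformization q (\<beta> v) (r v) (R v)"
    and "\<And>v. v \<in> G_verts Q \<Longrightarrow> r v \<noteq> 0"
  shows "(determines_ring_pattern Q r R \<and> (\<forall>v \<in> G_verts Q. R v < pi/2) \<longleftrightarrow>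
            (\<forall>v \<in> G_verts Q. ereal (\<beta> v) \<in> {0<..<2 * ell_K q}) \<and>
            (\<forall>v \<in> internal_verts Q.
               (\<Sum>w \<in> nbrs Q v. ring_g q (\<beta> v + \<beta> w) - ring_g q (\<beta> v - \<beta> w)) = 2 * pi))
       \<and> (determines_ring_pattern Q r R \<and> (\<forall>v \<in> G_verts Q. R v < pi/2) \<longrightarrow>
            (\<forall>v \<in> boundary_verts Q.
               (r v > 0 \<longrightarrow>
                  pi * real (card (nbrs Q v))
                    + (\<Sum>w \<in> nbrs Q v. ring_g q (\<beta> v - \<beta> w) - ring_g q (\<beta> v + \<beta> w))
                  = cone_angle Q r R v) \<and>
               (r v < 0 \<longrightarrow>
                  (\<Sum>w \<in> nbrs Q v. ring_g q (\<beta> v - \<beta> w) - ring_g q (\<beta> v + \<beta> w))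
                  = cone_angle Q r R v)))"
proof -
  note q = assms(1,2)
  have q': "0 \<le> q" "q \<le> 1" using q by auto
  have range: "(\<forall>v\<in>G_verts Q. R v < pi/2) \<longleftrightarrow> (\<forall>v\<in>G_verts Q. ereal (\<beta> v) \<in> {0<..<2 * ell_K q})"
    using acute_outer_radius_iff[OF q assms(5)] jacobi_sn_pos_iff[OF q' assms(4)] by blast
  have main: "(determines_ring_pattern Q r R \<longleftrightarrow>
       (\<forall>v\<in>internal_verts Q. (\<Sum>w\<in>nbrs Q v. ring_g q (\<beta> v + \<beta> w) - ring_g q (\<beta> v - \<beta> w)) = 2 * pi)) \<and>
     (\<forall>v\<in>G_verts Q.
        (0 < r v \<longrightarrow> pi * real (card (nbrs Q v)) + (\<Sum>w\<in>nbrs Q v. ring_g q (\<beta> v - \<beta> w) - ring_g q (\<beta> v + \<beta> w)) = cone_angle Q r R v) \<and>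
        (r v < 0 \<longrightarrow> (\<Sum>w\<in>nbrs Q v. ring_g q (\<beta> v - \<beta> w) - ring_g q (\<beta> v + \<beta> w)) = cone_angle Q r R v))"
    if b: "\<forall>v\<in>G_verts Q. ereal (\<beta> v) \<in> {0<..<2 * ell_K q}"
  proof -
    have sn: "0 < jacobi_sn q (\<beta> v)" if "v \<in> G_verts Q" for v
      using jacobi_sn_pos_iff[OF q' assms(4)[OF that]] b that by blast
    have radii: "ring_radii q (r v) (R v)" if "v \<in> G_verts Q" for v
      by (rule uniformized_ring_radii[OF q assms(5)[OF that] assms(6)[OF that] sn[OF that]])
    have ang: "turn_angle (r v) (R v) (r w) (R w) = pi - (ring_g q (\<beta> v + \<beta> w) - ring_g q (\<beta> v - \<beta> w))"
      if v: "v \<in> G_verts Q" and w: "w \<in> nbrs Q v" for v w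
    proof -
      have wG: "w \<in> G_verts Q" by (rule nbrs_G_verts[OF v w])
      show ?thesis
        by (rule turn_angle_uniformized[OF q assms(5)[OF v] assms(5)[OF wG] sn[OF wG] jacobi_am_less_pi[OF q']])
           (use b wG in blast)+
    qed
    have fin: "finite (nbrs Q v)" for v
      using finite_subset[OF nbrs_subset[of Q "fst v" "snd v"]] by simp
    have sum: "(\<Sum>w\<in>nbrs Q v. turn_angle (r v) (R v) (r w) (R w))
       = pi * real (card (nbrs Q v)) - (\<Sum>w\<in>nbrs Q v. ring_g q (\<beta> v + \<beta> w) - ring_g q (\<beta> v - \<beta> w))"
      if "v \<in> G_verts Q" for v
    proof -
      have "(\<Sum>w\<in>nbrs Q v. turn_angle (r v) (R v) (r w) (R w))
        = (\<Sum>w\<in>nbrs Q v. pi - (ring_g q (\<beta> v + \<beta> w) - ring_g q (\<beta> v - \<beta> w)))"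
        by (rule sum.cong[OF refl]) (rule ang[OF that])
      then show ?thesis by (simp add: sum_subtractf)
    qed
    have int: "(\<Sum>w\<in>nbrs Q v. turn_angle (r v) (R v) (r w) (R w)) = 2 * pi
       \<longleftrightarrow> (\<Sum>w\<in>nbrs Q v. ring_g q (\<beta> v + \<beta> w) - ring_g q (\<beta> v - \<beta> w)) = 2 * pi"
      if "v \<in> internal_verts Q" for v
    proof -
      have "v \<in> G_verts Q" "card (nbrs Q v) = 4" using that by (auto simp: internal_verts_def)
      then show ?thesis using sum by auto
    qed
    have "determines_ring_pattern Q r R \<longleftrightarrow>
       (\<forall>v\<in>internal_verts Q. (\<Sum>w\<in>nbrs Q v. turn_angle (r v) (R v) (r w) (R w)) = 2 * pi)"
    proof
      assume "determines_ring_pattern Q r R"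
      then obtain p pt where "orthogonal_ring_pattern Q p r R pt" by (auto simp: determines_ring_pattern_def)
      then show "\<forall>v\<in>internal_verts Q. (\<Sum>w\<in>nbrs Q v. turn_angle (r v) (R v) (r w) (R w)) = 2 * pi"
        using ring_pattern_angle_sum radii by blast
    next
      assume "\<forall>v\<in>internal_verts Q. (\<Sum>w\<in>nbrs Q v. turn_angle (r v) (R v) (r w) (R w)) = 2 * pi"
      then interpret ring_angle_data Q q r R
        using assms(3) radii by unfold_locales auto
      show "determines_ring_pattern Q r R" by (rule ring_pattern_exists)
    qed
    moreover have "(0 < r v \<longrightarrow> pi * real (card (nbrs Q v)) + (\<Sum>w\<in>nbrs Q v. ring_g q (\<beta> v - \<beta> w) - ring_g q (\<beta> v + \<beta> w)) = cone_angle Q r R v) \<and>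
        (r v < 0 \<longrightarrow> (\<Sum>w\<in>nbrs Q v. ring_g q (\<beta> v - \<beta> w) - ring_g q (\<beta> v + \<beta> w)) = cone_angle Q r R v)"
      if v: "v \<in> G_verts Q" for v
    proof -
      have op: "opening_angle (r v) (R v) (r w) (R w) =
          (if 0 < r v then turn_angle (r v) (R v) (r w) (R w) else turn_angle (r v) (R v) (r w) (R w) - pi)"
        if "w \<in> nbrs Q v" for w
        by (rule opening_angle_eq_turn_angle[OF radii[OF v] radii[OF nbrs_G_verts[OF v that]]])
      have "cone_angle Q r R v = (\<Sum>w\<in>nbrs Q v. turn_angle (r v) (R v) (r w) (R w) - (if 0 < r v then 0 else pi))"
        unfolding cone_angle_def by (rule sum.cong) (auto simp: op)
      then have "cone_angle Q r R v = (\<Sum>w\<in>nbrs Q v. turn_angle (r v) (R v) (r w) (R w)) - (if 0 < r v then 0 else pi * real (card (nbrs Q v)))"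
        by (simp add: sum_subtractf)
      then show ?thesis unfolding sum[OF v] by (auto simp: sum_subtractf)
    qed
    ultimately show ?thesis using int by simp
  qed
  have "boundary_verts Q \<subseteq> G_verts Q" by (auto simp: boundary_verts_def)
  then show ?thesis unfolding range using main by blast
qed

end
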